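(* (Soundness of equality checking.) Let $T$ be a standard type theory, $\mathcal C$ and $\mathcal E$ families of computation and extensionality rules for $T$, and $\wp$ a specification of principal arguments. Then, for an object boundary $\mathcal{B}\!\!\mathcal{B}$ and with derivability meaning derivability in $T$: (1) if $\Theta;\Gamma\vdash\lceil\mathcal{B}\!\!\mathcal{B}\rceil(e)$ and $\Theta;\Gamma\vdash\lceil\mathcal{B}\!\!\mathcal{B}\rceil(e')$ are derivable and $\Theta;\Gamma\vdash\lceil\mathcal{B}\!\!\mathcal{B}\rceil(e\sim e')$ holds, then $\Theta;\Gamma\vdash\lceil\mathcal{B}\!\!\mathcal{B}\rceil(e\equiv e')$ is derivable; (2) if $\Theta;\Gamma\vdash u:A$ and $\Theta;\Gamma\vdash v:A$ are derivable and $\Theta;\Gamma\vdash u\sim_e v:A$ holds, then $\Theta;\Gamma\vdash u\equiv v:A$ is derivable; (3) if $\Theta;\Gamma\vdash A$ type and $\Theta;\Gamma\vdash B$ type are derivable and $\Theta;\Gamma\vdash A\sim_n B$ holds, then $\Theta;\Gamma\vdash A\equiv B$ is derivable; (4) if $\Theta;\Gamma\vdash u:A$ and $\Theta;\Gamma\vdash v:A$ are derivable and $\Theta;\Gamma\vdash u\sim_n v:A$ holds, then $\Theta;\Gamma\vdash u\equiv v:A$ is derivable.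
   Context: Finitary type theories. A signature assigns to each primitive symbol $S$ an arity $(c,[(c_1,n_1),\dots,(c_k,n_k)])$: expressions $S(e_1,\dots,e_k)$ have syntactic class $c\in\{\mathsf{Ty},\mathsf{Tm}\}$, and the $i$-th argument has class $c_i\in\{\mathsf{Ty},\mathsf{Tm},\mathsf{EqTy},\mathsf{EqTm}\}$ and binds $n_i$ variables. Type expressions are $S(\vec e)$ or $M(t_1,\dots,t_n)$ for a metavariable $M$; term expressions are free variables $a$, bound variables $x$, $S(\vec e)$ or $M(\vec t)$; arguments are type or term expressions, a dummy $\star$ (for equational arguments), or abstractions $\{x\}e$. A metavariable has an arity $(c,n)$; it is an object metavariable if $c\in\{\mathsf{Ty},\mathsf{Tm}\}$, equational otherwise. Judgement theses: "$A$ type", "$t:A$", "$A\equiv B$", "$s\equiv t:A$"; abstracted judgements $\{x_1:A_1\}\cdots\{x_m:A_m\}J$. Boundary theses: "$\Box$ type", "$\Box:A$" (object boundaries), "$A\equiv B$ by $\Box$", "$s\equiv t:A$ by $\Box$" (equation boundaries), and abstracted boundaries $\{\vec x:\vec A\}\mathcal B$ (written $\mathcal{B}\!\!\mathcal{B}$). $\lceil\mathcal{B}\!\!\mathcal{B}\rceil(e)$ is the judgement obtained by placing the head $e$ in the hole (with $\lceil\{x:A\}\mathcal{B}\!\!\mathcal{B}\rceil(\{x\}e)=\{x:A\}\lceil\mathcal{B}\!\!\mathcal{B}\rceil(e)$, equation boundaries filled by $\star$); for an object boundary, $\lceil\mathcal{B}\!\!\mathcal{B}\rceil(e\equiv e')$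 is the corresponding equation ($\lceil\Box\text{ type}\rceil(A\equiv B)$ is $A\equiv B$, $\lceil\Box:C\rceil(s\equiv t)$ is $s\equiv t:C$, commuting with abstraction). A metavariable context $\Theta=[M_1:\mathcal{B}\!\!\mathcal{B}_1,\dots]$ assigns closed boundaries to metavariables; a variable context $\Gamma=[a_1:A_1,\dots]$ assigns types to distinct free variables, $|\Gamma|$ its domain; hypothetical judgements are $\Theta;\Gamma\vdash\mathcal J$. An instantiation $I=[M_1\mapsto e_1,\dots,M_n\mapsto e_n]$ of $\Xi=[M_1:\mathcal{B}\!\!\mathcal{B}_1,\dots]$ over $\Theta;\Gamma$ assigns arguments of matching arity; it acts by $I_*$, replacing $M_i(\vec t)$ by $e[I_*\vec t/\vec x]$ where $e_i=\{\vec x\}e$; $I_{(i)}$ is the restriction to $M_1,\dots,M_{i-1}$. $I$ is derivable if $\Theta;\Gamma\vdash\lceil(I_{(k)})_*\mathcal{B}\!\!\mathcal{B}_k\rceil(e_k)$ for all $k$. A raw rule $\Xi\Longrightarrow J$ is a judgement $\Xi;\emptyset\vdash J$, derivable if that judgement is; its instances for an instantiation $I$ of $\Xi$ over $\Theta;\Gamma$ have premises $\Theta;\Gamma\vdash\lceil(I_{(i)})_*\mathcal{B}\!\!\mathcal{B}_i\rceil(e_i)$ and conclusion $\Theta;\Gamma\vdash I_*J$. A raw type theory is a family of raw rules; derivability is generated by the usual structural rules (variable, metavariable, metavariable congruence, abstraction, reflexivity/symmetry/transitivity, conversion of terms and term equations along type equations, boundary formation), instances of its rules, and congruence rules of its object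 rules. A rule $\Xi\Longrightarrow\lceil\mathcal B\rceil(e)$ is finitary if $\Xi$ is a well-formed metavariable context and $\Xi;\emptyset\vdash\mathcal B$ is derivable; a finitary type theory has only finitary rules. The generic application $\hat M$ of a metavariable of arity $(c,n)$ is $\{x_1\}\cdots\{x_n\}M(x_1,\dots,x_n)$ if it is an object metavariable and $\{x_1\}\cdots\{x_n\}\star$ otherwise. A finitary type theory is standard if each of its object rules is a symbol rule $M_1:\mathcal{B}\!\!\mathcal{B}_1,\dots,M_n:\mathcal{B}\!\!\mathcal{B}_n\Longrightarrow\lceil\mathcal B\rceil(S(\hat M_1,\dots,\hat M_n))$ and each symbol has exactly one such rule. Natural type: $\tau_{\Theta;\Gamma}(a)=\Gamma(a)$; $\tau_{\Theta;\Gamma}(M(\vec t))=A[\vec t/\vec x]$ if $\Theta(M)=\{\vec x:\vec A\}\,\Box:A$; $\tau_{\Theta;\Gamma}(S(\vec e))=[M_1\mapsto e_1,\dots,M_n\mapsto e_n]_*B$ if the symbol rule of $S$ has conclusion $S(\hat M_1,\dots,\hat M_n):B$. Patterns and rule classes. $\mathrm{mv}(e)$: metavariables in $e$; $\mathrm{objmv}(\Xi)$: object metavariables of $\Xi$. A rule $\Xi\Longrightarrow J$ is deterministic if for every $\Theta;\Gamma\vdash J'$ there is at most one instantiation $I$ of $\Xi$ over $\Theta;\Gamma$ with $I_*J=J'$. "$p$ matches $t$ with $I$" means $I$ is an instantiation of $\Xi$ over $\Theta;\Gamma$ with $I_*p=t$. For $I$ instantiating $\Xi$ over $\Theta;\emptyset$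 with $|\Xi|\cap|\Theta|=\emptyset$ and equational metavariables $M_{i_1},\dots,M_{i_m}$, the residue is $\Xi/I=[\Theta,M_{i_1}:(I_{(i_1)})_*\mathcal{B}\!\!\mathcal{B}_{i_1},\dots]$ and $\bar I$ (instantiation of $\Xi$ over $\Xi/I;\emptyset$) is $I(M)$ on object $M$ and $\hat M$ otherwise. A derivable raw rule $\Xi\Longrightarrow J$ is object-invertible if whenever $I$ instantiates $\Xi$ over $\Theta;\emptyset$ with $\Theta$ well formed, $|\Xi|\cap|\Theta|=\emptyset$ and $\Theta;\emptyset\vdash I_*J$ derivable, $\bar I$ is derivable. A type computation rule: derivable finitary $\Theta\Longrightarrow A\equiv B$ with $\Theta\Longrightarrow A$ type deterministic and object-invertible; a term computation rule: derivable finitary $\Theta\Longrightarrow u\equiv v:A$ with $u$ a term symbol application and $\Theta\Longrightarrow u:\tau_{\Theta;\emptyset}(u)$ deterministic and object-invertible. An extensionality rule: derivable finitary $\Theta,\mathsf s:(\Box:A),\mathsf t:(\Box:A),\Phi\Longrightarrow\mathsf s\equiv\mathsf t:A$ with $\Phi$ only equational premises and $\Theta\Longrightarrow A$ type deterministic and object-invertible. Algorithm. Fix $\mathcal C$, $\mathcal E$ and principal argument sets $\wp(S)\subseteq\{1,\dots,k\}$ for each symbol $S$ with $k$ arguments. Object metavariables of $\Theta$ of arity $(c,n)$ are treated as symbols of class $c$ with $n$ term arguments, whose "symbol rule" is given by their boundary. For an equational premise $M:\{\vec x:\vec A\}(L\equiv R\text{ by }\Box)$ resp. $\{\vec x:\vec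 A\}(L\equiv R:C\text{ by }\Box)$, "checking it under $K$" means $\Theta;\Gamma\vdash K_*(\{\vec x:\vec A\}\lceil\mathcal B\rceil(L\sim R))$ with $\mathcal B=\Box$ type resp. $\Box:C$. Write $\lceil\Box\text{ type}\rceil(A\,R\,B)$ as $A\,R\,B$ and $\lceil\Box:C\rceil(u\,R\,v)$ as $u\,R\,v:C$. The relations $\longrightarrow,\longrightarrow_P,\longrightarrow_C,\sim,\sim_e,\sim_n$ are the least closed under: (C) $\Theta;\Gamma\vdash\lceil\mathcal B\rceil(s\longrightarrow_C I_*v)$ if $(\Xi\Longrightarrow\lceil\mathcal B'\rceil(p\equiv v))\in\mathcal C$, $p$ matches $s$ with $I$, and every equational premise of $\Xi$ checks under $I$. (P) $\Theta;\Gamma\vdash\lceil\mathcal B\rceil(S(\vec e)\longrightarrow_P S(\vec e'))$ if, the rule of $S$ being $M_1:\mathcal{B}\!\!\mathcal{B}_1,\dots,M_n:\mathcal{B}\!\!\mathcal{B}_n\Longrightarrow\lceil\mathcal B'\rceil(S(\hat M_1,\ldots,\hat M_n))$, for $i\in\wp(S)$: $\Theta;\Gamma\vdash\lceil([M_1\mapsto e_1,\dots,M_{i-1}\mapsto e_{i-1}])_*\mathcal{B}\!\!\mathcal{B}_i\rceil(e_i\longrightarrow e_i')$, and $e_i=e_i'$ for $i\notin\wp(S)$. (N1) $S(\vec e)\longrightarrow e'''$ if $S(\vec e)\longrightarrow_P S(\vec e')$, $S(\vec e')\longrightarrow_C e''$, $e''\longrightarrow e'''$. (N2) $S(\vec e)\longrightarrow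 S(\vec e')$ if $S(\vec e)\longrightarrow_P S(\vec e')$ and no left-hand side $p$ of a rule in $\mathcal C$ matches $S(\vec e')$. (N3) $\Theta;\Gamma\vdash\{x:A\}\lceil\mathcal{B}\!\!\mathcal{B}\rceil(\{x\}e\longrightarrow\{x\}e'[x/a])$ if $a\notin|\Gamma|$ and $\Theta;\Gamma,a:A\vdash\lceil\mathcal{B}\!\!\mathcal{B}[a/x]\rceil(e[a/x]\longrightarrow e')$. (N4) $a\longrightarrow a:A$; $\star\longrightarrow\star$. (Q1) $u\sim v:A$ if $A\longrightarrow A'$ and $u\sim_e v:A'$. (Q2) $A\sim B$ if $A\longrightarrow A'$, $B\longrightarrow B'$, $A'\sim_n B'$. (Q3) $\{x:A\}\lceil\mathcal{B}\!\!\mathcal{B}\rceil(\{x\}e\sim\{x\}e')$ if $a\notin|\Gamma|$ and $\Theta;\Gamma,a:A\vdash\lceil\mathcal{B}\!\!\mathcal{B}[a/x]\rceil(e[a/x]\sim e'[a/x])$. (X1) $u\sim_e v:A$ if $(\Xi,\mathsf s:(\Box:P),\mathsf t:(\Box:P),\Phi\Longrightarrow\mathsf s\equiv\mathsf t:P)\in\mathcal E$, $P$ matches $A$ with $I$, every equational premise of $\Xi$ checks under $I$ and every premise of $\Phi$ checks under $[I,\mathsf s\mapsto u,\mathsf t\mapsto v]$. (X2) $u\sim_e v:A$ if no rule of $\mathcal E$ has its $P$ matching $A$, $u\longrightarrow u':A$, $v\longrightarrow v':A$ and $u'\sim_n v':A$. (M1) $a\sim_n a:A$. (M2) $\lceil\mathcal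 B\rceil(S(\vec e)\sim_n S(\vec e'))$ if with $K_i=[M_1\mapsto e_1,\dots,M_{i-1}\mapsto e_{i-1}]$: $\lceil(K_i)_*\mathcal{B}\!\!\mathcal{B}_i\rceil(e_i\sim_n e_i')$ for $i\in\wp(S)$ and $\lceil(K_i)_*\mathcal{B}\!\!\mathcal{B}_i\rceil(e_i\sim e_i')$ for $i\notin\wp(S)$.
   Formalization: Derivability of Θ;Γ ⊢ J is taken to include that Θ and Γ are well formed, both in claims (1)–(4) and in object-invertibility, where the residue Ξ/I must be well formed; without this the claim is false. *)

theory Defs
  imports Main
begin

section \<open>Raw syntax\<close>

text \<open>
  Expressions are locally nameless: free variables and metavariables are named by natural numbers,
  bound variables are de Bruijn indices. Term expressions, type expressions and arguments share one
  datatype; the relation \<open>wf_arg\<close> below singles out the syntactically valid ones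
  of each syntactic class.
\<close>

type_synonym fvar = nat
type_synonym mvar = nat

datatype cls = Ty | Tm | EqTy | EqTm

text \<open>An arity consists of a class and a number of bound variables.\<close>
type_synonym arity = "cls \<times> nat"

text \<open>A signature is partial, so that the set of symbols may be any subset of the type \<open>'s\<close>.\<close>
type_synonym 's signature = "'s \<Rightarrow> (cls \<times> arity list) option"

definition is_signature :: "'s signature \<Rightarrow> bool" where
  "is_signature Sg \<longleftrightarrow> (\<forall>S c as. Sg S = Some (c, as) \<longrightarrow> c \<in> {Ty, Tm})"

datatype 's expr =
    FVar fvar
  | BVar nat
  | SymApp 's "'s expr list"
  | MvApp mvar "'s expr list"
  | Star
  | Abs "'s expr"

datatype 'e jthesis =
    IsTy 'e                 \<comment> \<open>\<open>A type\<close>\<close>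
  | HasTy 'e 'e             \<comment> \<open>\<open>t : A\<close>\<close>
  | JEqTy 'e 'e             \<comment> \<open>\<open>A \<equiv> B\<close>\<close>
  | JEqTm 'e 'e 'e          \<comment> \<open>\<open>s \<equiv> t : A\<close>\<close>

datatype 'e bthesis =
    BTy                     \<comment> \<open>\<open>\<box> type\<close>\<close>
  | BTm 'e                  \<comment> \<open>\<open>\<box> : A\<close>\<close>
  | BEqTy 'e 'e             \<comment> \<open>\<open>A \<equiv> B by \<box>\<close>\<close>
  | BEqTm 'e 'e 'e          \<comment> \<open>\<open>s \<equiv> t : A by \<box>\<close>\<close>

datatype (binders: 'e, theses: 't) abstracted =
    Thesis 't
  | Abstr 'e "('e, 't) abstracted"   \<comment> \<open>\<open>{x : A} \<J>\<close>\<close>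
  for map: map_abstracted

type_synonym 's jdg = "('s expr, 's expr jthesis) abstracted"
type_synonym 's bdry = "('s expr, 's expr bthesis) abstracted"

text \<open>Contexts and instantiations are listed from the first to the last entry.\<close>
type_synonym 's mctx = "(mvar \<times> 's bdry) list"
type_synonym 's vctx = "(fvar \<times> 's expr) list"
type_synonym 's inst = "(mvar \<times> 's expr) list"

abbreviation names :: "('n \<times> 'x) list \<Rightarrow> 'n set" where
  "names xs \<equiv> set (map fst xs)"

fun bthesis_cls :: "'e bthesis \<Rightarrow> cls" where
  "bthesis_cls BTy = Ty"
| "bthesis_cls (BTm A) = Tm"
| "bthesis_cls (BEqTy A B) = EqTy"
| "bthesis_cls (BEqTm s t A) = EqTm"

fun core :: "('e, 't) abstracted \<Rightarrow> 't" where
  "core (Thesis j) = j"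
| "core (Abstr A J) = core J"

fun depth :: "('e, 't) abstracted \<Rightarrow> nat" where
  "depth (Thesis j) = 0"
| "depth (Abstr A J) = Suc (depth J)"

definition bdry_arity :: "'s bdry \<Rightarrow> arity" where
  "bdry_arity B = (bthesis_cls (core B), depth B)"

definition is_object_thesis :: "'e bthesis \<Rightarrow> bool" where
  "is_object_thesis b \<longleftrightarrow> bthesis_cls b \<in> {Ty, Tm}"

definition is_object :: "'s bdry \<Rightarrow> bool" where
  "is_object B \<longleftrightarrow> is_object_thesis (core B)"

definition mv_arity :: "'s mctx \<Rightarrow> mvar \<Rightarrow> arity option" where
  "mv_arity \<Theta> M = map_option bdry_arity (map_of \<Theta> M)"

subsection \<open>Variables and substitution\<close>

primrec fv :: "'s expr \<Rightarrow> fvar set" where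
  "fv (FVar a) = {a}"
| "fv (BVar i) = {}"
| "fv (SymApp S es) = \<Union> (set (map fv es))"
| "fv (MvApp M es) = \<Union> (set (map fv es))"
| "fv Star = {}"
| "fv (Abs e) = fv e"

definition fv_jdg :: "'s jdg \<Rightarrow> fvar set" where
  "fv_jdg J = (\<Union>A\<in>binders J. fv A) \<union> (\<Union>j\<in>theses J. \<Union>e\<in>set_jthesis j. fv e)"

definition fv_bdry :: "'s bdry \<Rightarrow> fvar set" where
  "fv_bdry B = (\<Union>A\<in>binders B. fv A) \<union> (\<Union>b\<in>theses B. \<Union>e\<in>set_bthesis b. fv e)"

text \<open>\<open>lift k e\<close> increments the dangling indices of \<open>e\<close> from \<open>k\<close> upwards; \<open>subst k u e\<close>
  replaces the index \<open>k\<close> by \<open>u\<close> and decrements the higher ones.\<close>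

primrec lift :: "nat \<Rightarrow> 's expr \<Rightarrow> 's expr" where
  "lift k (FVar a) = FVar a"
| "lift k (BVar i) = (if i < k then BVar i else BVar (Suc i))"
| "lift k (SymApp S es) = SymApp S (map (lift k) es)"
| "lift k (MvApp M es) = MvApp M (map (lift k) es)"
| "lift k Star = Star"
| "lift k (Abs e) = Abs (lift (Suc k) e)"

fun subst :: "nat \<Rightarrow> 's expr \<Rightarrow> 's expr \<Rightarrow> 's expr" where
  "subst k u (FVar a) = FVar a"
| "subst k u (BVar i) = (if i < k then BVar i else if i = k then u else BVar (i - 1))"
| "subst k u (SymApp S es) = SymApp S (map (subst k u) es)"
| "subst k u (MvApp M es) = MvApp M (map (subst k u) es)"
| "subst k u Star = Star"
| "subst k u (Abs e) = Abs (subst (Suc k) (lift 0 u) e)"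

text \<open>\<open>close k a e\<close> turns the free variable \<open>a\<close> into the index \<open>k\<close>, so \<open>Abs (close 0 a e)\<close>
  is \<open>{x} e[x/a]\<close>.\<close>

primrec close :: "nat \<Rightarrow> fvar \<Rightarrow> 's expr \<Rightarrow> 's expr" where
  "close k a (FVar b) = (if b = a then BVar k else FVar b)"
| "close k a (BVar i) = (if i < k then BVar i else BVar (Suc i))"
| "close k a (SymApp S es) = SymApp S (map (close k a) es)"
| "close k a (MvApp M es) = MvApp M (map (close k a) es)"
| "close k a Star = Star"
| "close k a (Abs e) = Abs (close (Suc k) a e)"

primrec subst_jdg :: "nat \<Rightarrow> 's expr \<Rightarrow> 's jdg \<Rightarrow> 's jdg" where
  "subst_jdg k u (Thesis j) = Thesis (map_jthesis (subst k u) j)"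
| "subst_jdg k u (Abstr A J) = Abstr (subst k u A) (subst_jdg (Suc k) (lift 0 u) J)"

primrec subst_bdry :: "nat \<Rightarrow> 's expr \<Rightarrow> 's bdry \<Rightarrow> 's bdry" where
  "subst_bdry k u (Thesis b) = Thesis (map_bthesis (subst k u) b)"
| "subst_bdry k u (Abstr A B) = Abstr (subst k u A) (subst_bdry (Suc k) (lift 0 u) B)"

text \<open>\<open>apply_arg ({x\<^sub>1}\<dots>{x\<^sub>n} e) [t\<^sub>1, \<dots>, t\<^sub>n]\<close> is \<open>e[t\<^sub>1/x\<^sub>1, \<dots>, t\<^sub>n/x\<^sub>n]\<close>, and similarly for
  \<open>apply_bdry\<close>; \<open>arg_types ({x\<^sub>1 : A\<^sub>1}\<dots>{x\<^sub>n : A\<^sub>n} b) [t\<^sub>1, \<dots>, t\<^sub>n]\<close> lists the types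
  \<open>A\<^sub>j[t\<^sub>1/x\<^sub>1, \<dots>, t\<^sub>j\<^sub>-\<^sub>1/x\<^sub>j\<^sub>-\<^sub>1]\<close>. They are only used on lists of the correct length.\<close>

fun apply_arg :: "'s expr \<Rightarrow> 's expr list \<Rightarrow> 's expr" where
  "apply_arg (Abs e) (t # ts) = apply_arg (subst 0 t e) ts"
| "apply_arg e ts = e"

fun apply_bdry :: "'s bdry \<Rightarrow> 's expr list \<Rightarrow> 's expr bthesis" where
  "apply_bdry (Abstr A B) (t # ts) = apply_bdry (subst_bdry 0 t B) ts"
| "apply_bdry B ts = core B"

fun arg_types :: "'s bdry \<Rightarrow> 's expr list \<Rightarrow> 's expr list" where
  "arg_types (Abstr A B) (t # ts) = A # arg_types (subst_bdry 0 t B) ts"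
| "arg_types B ts = []"

text \<open>The action \<open>I\<^sub>*\<close>. The arguments supplied by an instantiation have no dangling indices, hence
  nothing is lifted when passing under a binder.\<close>

fun act :: "'s inst \<Rightarrow> 's expr \<Rightarrow> 's expr" where
  "act I (FVar a) = FVar a"
| "act I (BVar i) = BVar i"
| "act I (SymApp S es) = SymApp S (map (act I) es)"
| "act I (MvApp M ts) =
     (case map_of I M of
        Some e \<Rightarrow> apply_arg e (map (act I) ts)
      | None \<Rightarrow> MvApp M (map (act I) ts))"
| "act I Star = Star"
| "act I (Abs e) = Abs (act I e)"

definition act_bdry :: "'s inst \<Rightarrow> 's bdry \<Rightarrow> 's bdry" where
  "act_bdry I = map_abstracted (act I) (map_bthesis (act I))"

subsection \<open>Filling boundaries\<close>

fun fill_thesis :: "'e bthesis \<Rightarrow> 'e \<Rightarrow> 'e jthesis" where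
  "fill_thesis BTy e = IsTy e"
| "fill_thesis (BTm A) e = HasTy e A"
| "fill_thesis (BEqTy A B) e = JEqTy A B"
| "fill_thesis (BEqTm s t A) e = JEqTm s t A"

text \<open>The last two clauses are never relevant: \<open>\<lceil>\<B>\<rceil>(e \<equiv> e')\<close> is only used for object boundaries.\<close>

fun fill_eq_thesis :: "'e bthesis \<Rightarrow> 'e \<Rightarrow> 'e \<Rightarrow> 'e jthesis" where
  "fill_eq_thesis BTy e e' = JEqTy e e'"
| "fill_eq_thesis (BTm A) e e' = JEqTm e e' A"
| "fill_eq_thesis (BEqTy A B) e e' = JEqTy A B"
| "fill_eq_thesis (BEqTm s t A) e e' = JEqTm s t A"

text \<open>The second clause is junk: an abstracted boundary is filled with an abstraction.\<close>

fun unabs :: "'s expr \<Rightarrow> 's expr" where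
  "unabs (Abs e) = e"
| "unabs e = e"

fun fill :: "'s bdry \<Rightarrow> 's expr \<Rightarrow> 's jdg" where
  "fill (Thesis b) e = Thesis (fill_thesis b e)"
| "fill (Abstr A B) e = Abstr A (fill B (unabs e))"

fun fill_eq :: "'s bdry \<Rightarrow> 's expr \<Rightarrow> 's expr \<Rightarrow> 's jdg" where
  "fill_eq (Thesis b) e e' = Thesis (fill_eq_thesis b e e')"
| "fill_eq (Abstr A B) e e' = Abstr A (fill_eq B (unabs e) (unabs e'))"

fun thesis_bdry :: "'e jthesis \<Rightarrow> 'e bthesis" where
  "thesis_bdry (IsTy A) = BTy"
| "thesis_bdry (HasTy t A) = BTm A"
| "thesis_bdry (JEqTy A B) = BEqTy A B"
| "thesis_bdry (JEqTm s t A) = BEqTm s t A"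

text \<open>For an equational boundary \<open>{x : A} (L \<equiv> R : C by \<box>)\<close>, these are \<open>{x : A} (\<box> : C)\<close>, \<open>{x} L\<close>
  and \<open>{x} R\<close>; and similarly for type equations.\<close>

fun eq_hole :: "'s bdry \<Rightarrow> 's bdry" where
  "eq_hole (Abstr A B) = Abstr A (eq_hole B)"
| "eq_hole (Thesis (BEqTy L R)) = Thesis BTy"
| "eq_hole (Thesis (BEqTm L R C)) = Thesis (BTm C)"
| "eq_hole (Thesis b) = Thesis b"

fun eq_lhs :: "'s bdry \<Rightarrow> 's expr" where
  "eq_lhs (Abstr A B) = Abs (eq_lhs B)"
| "eq_lhs (Thesis (BEqTy L R)) = L"
| "eq_lhs (Thesis (BEqTm L R C)) = L"
| "eq_lhs (Thesis b) = Star"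

fun eq_rhs :: "'s bdry \<Rightarrow> 's expr" where
  "eq_rhs (Abstr A B) = Abs (eq_rhs B)"
| "eq_rhs (Thesis (BEqTy L R)) = R"
| "eq_rhs (Thesis (BEqTm L R C)) = R"
| "eq_rhs (Thesis b) = Star"

definition generic :: "mvar \<times> 's bdry \<Rightarrow> 's expr" where
  "generic MB = (case MB of (M, B) \<Rightarrow>
     (Abs ^^ depth B) (if is_object B then MvApp M (map BVar (rev [0..<depth B])) else Star))"

subsection \<open>Syntactic validity\<close>

text \<open>\<open>wf_arg Sg ar V n (c, k) e\<close>: over the signature \<open>Sg\<close>, with metavariables of arities \<open>ar\<close>, free
  variables \<open>V\<close> and \<open>n\<close> bound variables in scope, \<open>e\<close> is an argument of class \<open>c\<close> binding \<open>k\<close>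
  variables. For \<open>k = 0\<close> and \<open>c\<close> one of \<open>Ty\<close>, \<open>Tm\<close> these are the type and term expressions.\<close>

inductive wf_arg ::
  "'s signature \<Rightarrow> (mvar \<Rightarrow> arity option) \<Rightarrow> fvar set \<Rightarrow> nat \<Rightarrow> arity \<Rightarrow> 's expr \<Rightarrow> bool"
  for Sg :: "'s signature" and ar :: "mvar \<Rightarrow> arity option" and V :: "fvar set"
where
  wf_FVar: "a \<in> V \<Longrightarrow> wf_arg Sg ar V n (Tm, 0) (FVar a)"
| wf_BVar: "i < n \<Longrightarrow> wf_arg Sg ar V n (Tm, 0) (BVar i)"
| wf_SymApp: "Sg S = Some (c, as) \<Longrightarrow> length es = length as \<Longrightarrow>
    (\<forall>i<length as. wf_arg Sg ar V n (as ! i) (es ! i)) \<Longrightarrow>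
    wf_arg Sg ar V n (c, 0) (SymApp S es)"
| wf_MvApp: "ar M = Some (c, k) \<Longrightarrow> c \<in> {Ty, Tm} \<Longrightarrow> length ts = k \<Longrightarrow>
    (\<forall>t\<in>set ts. wf_arg Sg ar V n (Tm, 0) t) \<Longrightarrow>
    wf_arg Sg ar V n (c, 0) (MvApp M ts)"
| wf_Star: "c \<in> {EqTy, EqTm} \<Longrightarrow> wf_arg Sg ar V n (c, 0) Star"
| wf_Abs: "wf_arg Sg ar V (Suc n) (c, k) e \<Longrightarrow> wf_arg Sg ar V n (c, Suc k) (Abs e)"

context
  fixes Sg :: "'s signature"
begin

fun wf_jthesis :: "(mvar \<Rightarrow> arity option) \<Rightarrow> fvar set \<Rightarrow> nat \<Rightarrow> 's expr jthesis \<Rightarrow> bool" where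
  "wf_jthesis ar V n (IsTy A) \<longleftrightarrow> wf_arg Sg ar V n (Ty, 0) A"
| "wf_jthesis ar V n (HasTy t A) \<longleftrightarrow>
     wf_arg Sg ar V n (Tm, 0) t \<and> wf_arg Sg ar V n (Ty, 0) A"
| "wf_jthesis ar V n (JEqTy A B) \<longleftrightarrow>
     wf_arg Sg ar V n (Ty, 0) A \<and> wf_arg Sg ar V n (Ty, 0) B"
| "wf_jthesis ar V n (JEqTm s t A) \<longleftrightarrow>
     wf_arg Sg ar V n (Tm, 0) s \<and> wf_arg Sg ar V n (Tm, 0) t \<and> wf_arg Sg ar V n (Ty, 0) A"

fun wf_bthesis :: "(mvar \<Rightarrow> arity option) \<Rightarrow> fvar set \<Rightarrow> nat \<Rightarrow> 's expr bthesis \<Rightarrow> bool" where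
  "wf_bthesis ar V n BTy \<longleftrightarrow> True"
| "wf_bthesis ar V n (BTm A) \<longleftrightarrow> wf_arg Sg ar V n (Ty, 0) A"
| "wf_bthesis ar V n (BEqTy A B) \<longleftrightarrow>
     wf_arg Sg ar V n (Ty, 0) A \<and> wf_arg Sg ar V n (Ty, 0) B"
| "wf_bthesis ar V n (BEqTm s t A) \<longleftrightarrow>
     wf_arg Sg ar V n (Tm, 0) s \<and> wf_arg Sg ar V n (Tm, 0) t \<and> wf_arg Sg ar V n (Ty, 0) A"

primrec wf_bdry :: "(mvar \<Rightarrow> arity option) \<Rightarrow> fvar set \<Rightarrow> nat \<Rightarrow> 's bdry \<Rightarrow> bool" where
  "wf_bdry ar V n (Thesis b) \<longleftrightarrow> wf_bthesis ar V n b"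
| "wf_bdry ar V n (Abstr A B) \<longleftrightarrow> wf_arg Sg ar V n (Ty, 0) A \<and> wf_bdry ar V (Suc n) B"

text \<open>Raw contexts are syntactically valid contexts; their types and boundaries need not be
  derivable.\<close>

definition raw_mctx :: "'s mctx \<Rightarrow> bool" where
  "raw_mctx \<Theta> \<longleftrightarrow> distinct (map fst \<Theta>) \<and>
     (\<forall>i<length \<Theta>. wf_bdry (mv_arity (take i \<Theta>)) {} 0 (snd (\<Theta> ! i)))"

definition raw_vctx :: "'s mctx \<Rightarrow> 's vctx \<Rightarrow> bool" where
  "raw_vctx \<Theta> \<Gamma> \<longleftrightarrow> distinct (map fst \<Gamma>) \<and>
     (\<forall>i<length \<Gamma>. wf_arg Sg (mv_arity \<Theta>) (names (take i \<Gamma>)) 0 (Ty, 0) (snd (\<Gamma> ! i)))"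

text \<open>\<open>I\<close> is an instantiation of \<open>\<Xi>\<close> over \<open>\<Theta>; \<Gamma>\<close>.\<close>

definition instantiates :: "'s mctx \<Rightarrow> 's mctx \<Rightarrow> 's vctx \<Rightarrow> 's inst \<Rightarrow> bool" where
  "instantiates \<Xi> \<Theta> \<Gamma> I \<longleftrightarrow> map fst I = map fst \<Xi> \<and>
     (\<forall>i<length \<Xi>.
        wf_arg Sg (mv_arity \<Theta>) (names \<Gamma>) 0 (bdry_arity (snd (\<Xi> ! i))) (snd (I ! i)))"

end

section \<open>Raw type theories and derivability\<close>

text \<open>A raw rule \<open>\<Xi> \<Longrightarrow> J\<close>; its conclusion is not abstracted.\<close>
type_synonym 's rul = "'s mctx \<times> 's expr jthesis"

definition raw_rule :: "'s signature \<Rightarrow> 's rul \<Rightarrow> bool" where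
  "raw_rule Sg R \<longleftrightarrow> (case R of (\<Xi>, J) \<Rightarrow> raw_mctx Sg \<Xi> \<and> wf_jthesis Sg (mv_arity \<Xi>) {} 0 J)"

definition raw_theory :: "'s signature \<Rightarrow> 's rul set \<Rightarrow> bool" where
  "raw_theory Sg T \<longleftrightarrow> is_signature Sg \<and> (\<forall>R\<in>T. raw_rule Sg R)"

text \<open>
  The boundary \<open>(I\<^sub>(\<^sub>i\<^sub>))\<^sub>* \<BB>\<^sub>i\<close> of the \<open>i\<close>-th premise, counting from \<open>0\<close>.
\<close>

definition premise_bdry :: "'s mctx \<Rightarrow> 's inst \<Rightarrow> nat \<Rightarrow> 's bdry" where
  "premise_bdry \<Xi> I i = act_bdry (take i I) (snd (\<Xi> ! i))"

text \<open>
  The relation \<open>deriv\<close> is the closure under the structural rules, the rules of the theory \<open>T\<close> and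
  the congruence rules of its object rules, irrespective of whether the contexts are well formed
  (see \<open>derivable\<close> below for that). A variable taken to be fresh for the context must
  also not occur in the expressions it is fresh for, which is automatic for judgements whose free
  variables are declared in the context.

  In the instances of metavariables and rules, and in the congruence rules, there are no premises
  stating the derivability of the boundary of the conclusion, nor of the equality of the types
  of the two sides.
\<close>

inductive deriv :: "'s signature \<Rightarrow> 's rul set \<Rightarrow> 's mctx \<Rightarrow> 's vctx \<Rightarrow> 's jdg \<Rightarrow> bool"
  for Sg :: "'s signature" and T :: "'s rul set"
where
  d_var:
    "map_of \<Gamma> a = Some A \<Longrightarrow> deriv Sg T \<Theta> \<Gamma> (Thesis (HasTy (FVar a) A))"
| d_meta:
    "map_of \<Theta> M = Some B \<Longrightarrow> length ts = depth B \<Longrightarrow>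
     (\<forall>j<length ts. deriv Sg T \<Theta> \<Gamma> (Thesis (HasTy (ts ! j) (arg_types B ts ! j)))) \<Longrightarrow>
     deriv Sg T \<Theta> \<Gamma> (Thesis (fill_thesis (apply_bdry B ts) (MvApp M ts)))"
| d_meta_congr:
    "map_of \<Theta> M = Some B \<Longrightarrow> is_object B \<Longrightarrow> length ss = depth B \<Longrightarrow> length ts = depth B \<Longrightarrow>
     (\<forall>j<depth B. deriv Sg T \<Theta> \<Gamma> (Thesis (HasTy (ss ! j) (arg_types B ss ! j)))) \<Longrightarrow>
     (\<forall>j<depth B. deriv Sg T \<Theta> \<Gamma> (Thesis (HasTy (ts ! j) (arg_types B ts ! j)))) \<Longrightarrow>
     (\<forall>j<depth B. deriv Sg T \<Theta> \<Gamma> (Thesis (JEqTm (ss ! j) (ts ! j) (arg_types B ss ! j)))) \<Longrightarrow>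
     deriv Sg T \<Theta> \<Gamma> (Thesis (fill_eq_thesis (apply_bdry B ss) (MvApp M ss) (MvApp M ts)))"
| d_abstr:
    "deriv Sg T \<Theta> \<Gamma> (Thesis (IsTy A)) \<Longrightarrow> a \<notin> names \<Gamma> \<Longrightarrow> a \<notin> fv A \<union> fv_jdg J \<Longrightarrow>
     deriv Sg T \<Theta> (\<Gamma> @ [(a, A)]) (subst_jdg 0 (FVar a) J) \<Longrightarrow>
     deriv Sg T \<Theta> \<Gamma> (Abstr A J)"
| d_ty_refl:
    "deriv Sg T \<Theta> \<Gamma> (Thesis (IsTy A)) \<Longrightarrow> deriv Sg T \<Theta> \<Gamma> (Thesis (JEqTy A A))"
| d_ty_sym:
    "deriv Sg T \<Theta> \<Gamma> (Thesis (JEqTy A B)) \<Longrightarrow> deriv Sg T \<Theta> \<Gamma> (Thesis (JEqTy B A))"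
| d_ty_trans:
    "deriv Sg T \<Theta> \<Gamma> (Thesis (JEqTy A B)) \<Longrightarrow> deriv Sg T \<Theta> \<Gamma> (Thesis (JEqTy B C)) \<Longrightarrow>
     deriv Sg T \<Theta> \<Gamma> (Thesis (JEqTy A C))"
| d_tm_refl:
    "deriv Sg T \<Theta> \<Gamma> (Thesis (HasTy t A)) \<Longrightarrow> deriv Sg T \<Theta> \<Gamma> (Thesis (JEqTm t t A))"
| d_tm_sym:
    "deriv Sg T \<Theta> \<Gamma> (Thesis (JEqTm s t A)) \<Longrightarrow> deriv Sg T \<Theta> \<Gamma> (Thesis (JEqTm t s A))"
| d_tm_trans:
    "deriv Sg T \<Theta> \<Gamma> (Thesis (JEqTm s t A)) \<Longrightarrow> deriv Sg T \<Theta> \<Gamma> (Thesis (JEqTm t u A)) \<Longrightarrow>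
     deriv Sg T \<Theta> \<Gamma> (Thesis (JEqTm s u A))"
| d_conv_tm:
    "deriv Sg T \<Theta> \<Gamma> (Thesis (HasTy t A)) \<Longrightarrow> deriv Sg T \<Theta> \<Gamma> (Thesis (JEqTy A B)) \<Longrightarrow>
     deriv Sg T \<Theta> \<Gamma> (Thesis (HasTy t B))"
| d_conv_eq:
    "deriv Sg T \<Theta> \<Gamma> (Thesis (JEqTm s t A)) \<Longrightarrow> deriv Sg T \<Theta> \<Gamma> (Thesis (JEqTy A B)) \<Longrightarrow>
     deriv Sg T \<Theta> \<Gamma> (Thesis (JEqTm s t B))"
| d_rule:
    "(\<Xi>, J) \<in> T \<Longrightarrow> instantiates Sg \<Xi> \<Theta> \<Gamma> I \<Longrightarrow>
     (\<forall>i<length \<Xi>. deriv Sg T \<Theta> \<Gamma> (fill (premise_bdry \<Xi> I i) (snd (I ! i)))) \<Longrightarrow>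
     deriv Sg T \<Theta> \<Gamma> (Thesis (map_jthesis (act I) J))"
| d_rule_congr:
    "(\<Xi>, fill_thesis b e) \<in> T \<Longrightarrow> is_object_thesis b \<Longrightarrow>
     instantiates Sg \<Xi> \<Theta> \<Gamma> I \<Longrightarrow> instantiates Sg \<Xi> \<Theta> \<Gamma> I' \<Longrightarrow>
     (\<forall>i<length \<Xi>. deriv Sg T \<Theta> \<Gamma> (fill (premise_bdry \<Xi> I i) (snd (I ! i)))) \<Longrightarrow>
     (\<forall>i<length \<Xi>. deriv Sg T \<Theta> \<Gamma> (fill (premise_bdry \<Xi> I' i) (snd (I' ! i)))) \<Longrightarrow>
     (\<forall>i<length \<Xi>. is_object (snd (\<Xi> ! i)) \<longrightarrow>
        deriv Sg T \<Theta> \<Gamma> (fill_eq (premise_bdry \<Xi> I i) (snd (I ! i)) (snd (I' ! i)))) \<Longrightarrow>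
     deriv Sg T \<Theta> \<Gamma> (Thesis (fill_eq_thesis (map_bthesis (act I) b) (act I e) (act I' e)))"

inductive deriv_bdry :: "'s signature \<Rightarrow> 's rul set \<Rightarrow> 's mctx \<Rightarrow> 's vctx \<Rightarrow> 's bdry \<Rightarrow> bool"
  for Sg :: "'s signature" and T :: "'s rul set"
where
  b_ty: "deriv_bdry Sg T \<Theta> \<Gamma> (Thesis BTy)"
| b_tm: "deriv Sg T \<Theta> \<Gamma> (Thesis (IsTy A)) \<Longrightarrow> deriv_bdry Sg T \<Theta> \<Gamma> (Thesis (BTm A))"
| b_eqty:
    "deriv Sg T \<Theta> \<Gamma> (Thesis (IsTy A)) \<Longrightarrow> deriv Sg T \<Theta> \<Gamma> (Thesis (IsTy B)) \<Longrightarrow>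
     deriv_bdry Sg T \<Theta> \<Gamma> (Thesis (BEqTy A B))"
| b_eqtm:
    "deriv Sg T \<Theta> \<Gamma> (Thesis (IsTy A)) \<Longrightarrow>
     deriv Sg T \<Theta> \<Gamma> (Thesis (HasTy s A)) \<Longrightarrow> deriv Sg T \<Theta> \<Gamma> (Thesis (HasTy t A)) \<Longrightarrow>
     deriv_bdry Sg T \<Theta> \<Gamma> (Thesis (BEqTm s t A))"
| b_abstr:
    "deriv Sg T \<Theta> \<Gamma> (Thesis (IsTy A)) \<Longrightarrow> a \<notin> names \<Gamma> \<Longrightarrow> a \<notin> fv A \<union> fv_bdry B \<Longrightarrow>
     deriv_bdry Sg T \<Theta> (\<Gamma> @ [(a, A)]) (subst_bdry 0 (FVar a) B) \<Longrightarrow>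
     deriv_bdry Sg T \<Theta> \<Gamma> (Abstr A B)"

inductive wf_mctx :: "'s signature \<Rightarrow> 's rul set \<Rightarrow> 's mctx \<Rightarrow> bool"
  for Sg :: "'s signature" and T :: "'s rul set"
where
  wf_mctx_empty: "wf_mctx Sg T []"
| wf_mctx_extend:
    "wf_mctx Sg T \<Theta> \<Longrightarrow> M \<notin> names \<Theta> \<Longrightarrow> deriv_bdry Sg T \<Theta> [] B \<Longrightarrow>
     wf_mctx Sg T (\<Theta> @ [(M, B)])"

inductive wf_vctx :: "'s signature \<Rightarrow> 's rul set \<Rightarrow> 's mctx \<Rightarrow> 's vctx \<Rightarrow> bool"
  for Sg :: "'s signature" and T :: "'s rul set" and \<Theta> :: "'s mctx"
where
  wf_vctx_empty: "wf_vctx Sg T \<Theta> []"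
| wf_vctx_extend:
    "wf_vctx Sg T \<Theta> \<Gamma> \<Longrightarrow> a \<notin> names \<Gamma> \<Longrightarrow> deriv Sg T \<Theta> \<Gamma> (Thesis (IsTy A)) \<Longrightarrow>
     wf_vctx Sg T \<Theta> (\<Gamma> @ [(a, A)])"

text \<open>
  Derivability of a hypothetical judgement \<open>\<Theta>; \<Gamma> \<turnstile> \<J>\<close> is only considered over well-formed contexts.
  Without this convention soundness fails for ill-typed variable contexts. In the definition of
  object-invertible rules below it means that the residue has to be well formed.
\<close>

definition derivable :: "'s signature \<Rightarrow> 's rul set \<Rightarrow> 's mctx \<Rightarrow> 's vctx \<Rightarrow> 's jdg \<Rightarrow> bool" where
  "derivable Sg T \<Theta> \<Gamma> J \<longleftrightarrow> wf_mctx Sg T \<Theta> \<and> wf_vctx Sg T \<Theta> \<Gamma> \<and> deriv Sg T \<Theta> \<Gamma> J"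

definition derivable_inst ::
  "'s signature \<Rightarrow> 's rul set \<Rightarrow> 's mctx \<Rightarrow> 's mctx \<Rightarrow> 's vctx \<Rightarrow> 's inst \<Rightarrow> bool" where
  "derivable_inst Sg T \<Xi> \<Theta> \<Gamma> I \<longleftrightarrow> instantiates Sg \<Xi> \<Theta> \<Gamma> I \<and>
     (\<forall>i<length \<Xi>. derivable Sg T \<Theta> \<Gamma> (fill (premise_bdry \<Xi> I i) (snd (I ! i))))"

definition derivable_rule :: "'s signature \<Rightarrow> 's rul set \<Rightarrow> 's rul \<Rightarrow> bool" where
  "derivable_rule Sg T R \<longleftrightarrow>
     (case R of (\<Xi>, J) \<Rightarrow> raw_rule Sg R \<and> derivable Sg T \<Xi> [] (Thesis J))"

section \<open>Finitary and standard type theories\<close>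

definition finitary_rule :: "'s signature \<Rightarrow> 's rul set \<Rightarrow> 's rul \<Rightarrow> bool" where
  "finitary_rule Sg T R \<longleftrightarrow> (case R of (\<Xi>, J) \<Rightarrow>
     wf_mctx Sg T \<Xi> \<and> deriv_bdry Sg T \<Xi> [] (Thesis (thesis_bdry J)))"

definition finitary_theory :: "'s signature \<Rightarrow> 's rul set \<Rightarrow> bool" where
  "finitary_theory Sg T \<longleftrightarrow> raw_theory Sg T \<and> (\<forall>R\<in>T. finitary_rule Sg T R)"

text \<open>\<open>(\<Xi>, symbol_concl S \<Xi> b)\<close> is the symbol rule \<open>\<Xi> \<Longrightarrow> \<lceil>b\<rceil>(S(e\<^sub>1, \<dots>, e\<^sub>n))\<close> with \<open>e\<^sub>i\<close> the
  generic application of \<open>M\<^sub>i\<close>.\<close>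

definition symbol_concl :: "'s \<Rightarrow> 's mctx \<Rightarrow> 's expr bthesis \<Rightarrow> 's expr jthesis" where
  "symbol_concl S \<Xi> b = fill_thesis b (SymApp S (map generic \<Xi>))"

definition is_symbol_rule :: "'s \<Rightarrow> 's rul \<Rightarrow> bool" where
  "is_symbol_rule S R \<longleftrightarrow> (\<exists>\<Xi> b. is_object_thesis b \<and> R = (\<Xi>, symbol_concl S \<Xi> b))"

definition is_object_rule :: "'s rul \<Rightarrow> bool" where
  "is_object_rule R \<longleftrightarrow> is_object_thesis (thesis_bdry (snd R))"

definition standard_theory :: "'s signature \<Rightarrow> 's rul set \<Rightarrow> bool" where
  "standard_theory Sg T \<longleftrightarrow> finitary_theory Sg T \<and>
     (\<forall>R\<in>T. is_object_rule R \<longrightarrow> (\<exists>S. is_symbol_rule S R)) \<and>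
     (\<forall>S\<in>dom Sg. \<exists>!R. R \<in> T \<and> is_symbol_rule S R)"

text \<open>Only meaningful on term expressions that are variables or applications.\<close>

fun natural_type :: "'s rul set \<Rightarrow> 's mctx \<Rightarrow> 's vctx \<Rightarrow> 's expr \<Rightarrow> 's expr" where
  "natural_type T \<Theta> \<Gamma> (FVar a) = the (map_of \<Gamma> a)"
| "natural_type T \<Theta> \<Gamma> (MvApp M ts) =
     (THE A. \<exists>B. map_of \<Theta> M = Some B \<and> apply_bdry B ts = BTm A)"
| "natural_type T \<Theta> \<Gamma> (SymApp S es) =
     (THE A. \<exists>\<Xi> B. (\<Xi>, symbol_concl S \<Xi> (BTm B)) \<in> T \<and> A = act (zip (map fst \<Xi>) es) B)"
| "natural_type T \<Theta> \<Gamma> e = undefined"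

section \<open>Computation and extensionality rules\<close>

definition deterministic :: "'s signature \<Rightarrow> 's rul \<Rightarrow> bool" where
  "deterministic Sg R \<longleftrightarrow> (case R of (\<Xi>, J) \<Rightarrow>
     (\<forall>\<Theta> \<Gamma> J'. raw_mctx Sg \<Theta> \<longrightarrow> raw_vctx Sg \<Theta> \<Gamma> \<longrightarrow>
        (\<exists>\<^sub>\<le>\<^sub>1 I. instantiates Sg \<Xi> \<Theta> \<Gamma> I \<and> map_jthesis (act I) J = J')))"

definition residue :: "'s mctx \<Rightarrow> 's mctx \<Rightarrow> 's inst \<Rightarrow> 's mctx" where
  "residue \<Xi> \<Theta> I = \<Theta> @ map (\<lambda>i. (fst (\<Xi> ! i), premise_bdry \<Xi> I i))
     (filter (\<lambda>i. \<not> is_object (snd (\<Xi> ! i))) [0..<length \<Xi>])"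

definition residual_inst :: "'s mctx \<Rightarrow> 's inst \<Rightarrow> 's inst" where
  "residual_inst \<Xi> I = map (\<lambda>i. (fst (\<Xi> ! i),
     if is_object (snd (\<Xi> ! i)) then snd (I ! i) else generic (\<Xi> ! i))) [0..<length \<Xi>]"

definition object_invertible :: "'s signature \<Rightarrow> 's rul set \<Rightarrow> 's rul \<Rightarrow> bool" where
  "object_invertible Sg T R \<longleftrightarrow> derivable_rule Sg T R \<and> (case R of (\<Xi>, J) \<Rightarrow>
     (\<forall>\<Theta> I. wf_mctx Sg T \<Theta> \<longrightarrow> names \<Xi> \<inter> names \<Theta> = {} \<longrightarrow>
        instantiates Sg \<Xi> \<Theta> [] I \<longrightarrow> derivable Sg T \<Theta> [] (Thesis (map_jthesis (act I) J)) \<longrightarrow>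
        derivable_inst Sg T \<Xi> (residue \<Xi> \<Theta> I) [] (residual_inst \<Xi> I)))"

definition type_computation_rule :: "'s signature \<Rightarrow> 's rul set \<Rightarrow> 's rul \<Rightarrow> bool" where
  "type_computation_rule Sg T R \<longleftrightarrow> (\<exists>\<Theta> A B. R = (\<Theta>, JEqTy A B) \<and>
     derivable_rule Sg T R \<and> finitary_rule Sg T R \<and>
     deterministic Sg (\<Theta>, IsTy A) \<and> object_invertible Sg T (\<Theta>, IsTy A))"

definition term_computation_rule :: "'s signature \<Rightarrow> 's rul set \<Rightarrow> 's rul \<Rightarrow> bool" where
  "term_computation_rule Sg T R \<longleftrightarrow> (\<exists>\<Theta> u v A S es. R = (\<Theta>, JEqTm u v A) \<and> u = SymApp S es \<and>
     derivable_rule Sg T R \<and> finitary_rule Sg T R \<and>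
     deterministic Sg (\<Theta>, HasTy u (natural_type T \<Theta> [] u)) \<and>
     object_invertible Sg T (\<Theta>, HasTy u (natural_type T \<Theta> [] u)))"

definition computation_rule :: "'s signature \<Rightarrow> 's rul set \<Rightarrow> 's rul \<Rightarrow> bool" where
  "computation_rule Sg T R \<longleftrightarrow> type_computation_rule Sg T R \<or> term_computation_rule Sg T R"

text \<open>The rule \<open>\<Theta>, s : (\<box> : A), t : (\<box> : A), \<Phi> \<Longrightarrow> s \<equiv> t : A\<close>.\<close>

definition ext_rule :: "'s mctx \<Rightarrow> 's expr \<Rightarrow> mvar \<Rightarrow> mvar \<Rightarrow> 's mctx \<Rightarrow> 's rul" where
  "ext_rule \<Theta> A s t \<Phi> =
     (\<Theta> @ [(s, Thesis (BTm A)), (t, Thesis (BTm A))] @ \<Phi>, JEqTm (MvApp s []) (MvApp t []) A)"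

definition extensionality_rule :: "'s signature \<Rightarrow> 's rul set \<Rightarrow> 's rul \<Rightarrow> bool" where
  "extensionality_rule Sg T R \<longleftrightarrow> (\<exists>\<Theta> A s t \<Phi>. R = ext_rule \<Theta> A s t \<Phi> \<and>
     (\<forall>(M, B)\<in>set \<Phi>. \<not> is_object B) \<and>
     derivable_rule Sg T R \<and> finitary_rule Sg T R \<and>
     deterministic Sg (\<Theta>, IsTy A) \<and> object_invertible Sg T (\<Theta>, IsTy A))"

section \<open>The equality checking algorithm\<close>

text \<open>Heads of applications: object metavariables of the ambient context are treated as symbols.\<close>

datatype 's head = HSym 's | HMv mvar

fun happ :: "'s head \<Rightarrow> 's expr list \<Rightarrow> 's expr" where
  "happ (HSym S) es = SymApp S es"
| "happ (HMv M) es = MvApp M es"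

text \<open>
  The principal arguments, with arguments numbered from \<open>0\<close>. The arity of a metavariable depends on
  the metavariable context, so for metavariables no bound is imposed; only the indices of actual
  arguments are ever consulted.
\<close>

definition principal_spec :: "'s signature \<Rightarrow> ('s head \<Rightarrow> nat set) \<Rightarrow> bool" where
  "principal_spec Sg pr \<longleftrightarrow> (\<forall>S c as. Sg S = Some (c, as) \<longrightarrow> pr (HSym S) \<subseteq> {..<length as})"

text \<open>
  \<open>head_bdrys T \<Theta> h es c Bs\<close>: the head \<open>h\<close> has class \<open>c\<close> and, if \<open>M\<^sub>1 : \<BB>\<^sub>1, \<dots>, M\<^sub>n : \<BB>\<^sub>n\<close> are the
  premises of its symbol rule, \<open>Bs\<close> lists \<open>[M\<^sub>1 \<mapsto> es\<^sub>1, \<dots>, M\<^sub>i\<^sub>-\<^sub>1 \<mapsto> es\<^sub>i\<^sub>-\<^sub>1]\<^sub>* \<BB>\<^sub>i\<close>. The premises of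
  the symbol rule given by the boundary \<open>{x\<^sub>1 : A\<^sub>1}\<dots>{x\<^sub>n : A\<^sub>n} b\<close> of a metavariable
  are \<open>\<box> : A\<^sub>i[M\<^sub>1/x\<^sub>1, \<dots>, M\<^sub>i\<^sub>-\<^sub>1/x\<^sub>i\<^sub>-\<^sub>1]\<close>.
\<close>

inductive head_bdrys ::
  "'s rul set \<Rightarrow> 's mctx \<Rightarrow> 's head \<Rightarrow> 's expr list \<Rightarrow> cls \<Rightarrow> 's bdry list \<Rightarrow> bool"
  for T :: "'s rul set" and \<Theta> :: "'s mctx"
where
  head_sym:
    "(\<Xi>, symbol_concl S \<Xi> b) \<in> T \<Longrightarrow> is_object_thesis b \<Longrightarrow> length es = length \<Xi> \<Longrightarrow>
     head_bdrys T \<Theta> (HSym S) es (bthesis_cls b)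
       (map (premise_bdry \<Xi> (zip (map fst \<Xi>) es)) [0..<length \<Xi>])"
| head_mv:
    "map_of \<Theta> M = Some B \<Longrightarrow> is_object B \<Longrightarrow> length ts = depth B \<Longrightarrow>
     head_bdrys T \<Theta> (HMv M) ts (bthesis_cls (core B))
       (map (\<lambda>A. Thesis (BTm A)) (arg_types B ts))"

definition matches ::
  "'s signature \<Rightarrow> 's mctx \<Rightarrow> 's expr \<Rightarrow> 's mctx \<Rightarrow> 's vctx \<Rightarrow> 's expr \<Rightarrow> 's inst \<Rightarrow> bool" where
  "matches Sg \<Xi> p \<Theta> \<Gamma> t I \<longleftrightarrow> instantiates Sg \<Xi> \<Theta> \<Gamma> I \<and> act I p = t"

text \<open>
  The relations are \<open>red\<close> (\<open>\<longrightarrow>\<close>), \<open>red_p\<close> (\<open>\<longrightarrow>\<^sub>P\<close>), \<open>red_c\<close> (\<open>\<longrightarrow>\<^sub>C\<close>), \<open>chk\<close> (\<open>\<sim>\<close>), \<open>chk_e\<close> (\<open>\<sim>\<^sub>e\<close>) and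
  \<open>chk_n\<close> (\<open>\<sim>\<^sub>n\<close>), with \<open>red Sg T C E pr \<Theta> \<Gamma> B e e'\<close> standing for \<open>\<Theta>; \<Gamma> \<turnstile> \<lceil>B\<rceil>(e \<longrightarrow> e')\<close>.

  In \<open>chk_n_app\<close> the notation \<open>\<lceil>B\<rceil>(e \<sim> e')\<close> has a meaning for object boundaries only; equational
  arguments, which are all of the form \<open>{x} \<star>\<close>, are required to be the same.
\<close>

inductive
  red and red_p and red_c and chk and chk_e and chk_n
  for Sg :: "'s signature" and T :: "'s rul set"
    and C :: "'s rul set" and E :: "'s rul set" and pr :: "'s head \<Rightarrow> nat set"
where
  red_c_rule:
    "(\<Xi>, fill_eq_thesis b' p v) \<in> C \<Longrightarrow>
     is_object_thesis b' \<Longrightarrow> bthesis_cls b = bthesis_cls b' \<Longrightarrow>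
     matches Sg \<Xi> p \<Theta> \<Gamma> s I \<Longrightarrow>
     (\<forall>(M, B)\<in>set \<Xi>. \<not> is_object B \<longrightarrow>
        chk Sg T C E pr \<Theta> \<Gamma> (act_bdry I (eq_hole B)) (act I (eq_lhs B)) (act I (eq_rhs B))) \<Longrightarrow>
     red_c Sg T C E pr \<Theta> \<Gamma> (b :: 's expr bthesis) s (act I v)"
| red_p_app:
    "head_bdrys T \<Theta> h es (bthesis_cls b) Bs \<Longrightarrow> length es' = length es \<Longrightarrow>
     (\<forall>i<length es. i \<in> pr h \<longrightarrow> red Sg T C E pr \<Theta> \<Gamma> (Bs ! i) (es ! i) (es' ! i)) \<Longrightarrow>
     (\<forall>i<length es. i \<notin> pr h \<longrightarrow> es' ! i = es ! i) \<Longrightarrow>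
     red_p Sg T C E pr \<Theta> \<Gamma> (b :: 's expr bthesis) (happ h es) (happ h es')"
| red_step:
    "red_p Sg T C E pr \<Theta> \<Gamma> b (happ h es) (happ h es') \<Longrightarrow>
     red_c Sg T C E pr \<Theta> \<Gamma> b (happ h es') e'' \<Longrightarrow>
     red Sg T C E pr \<Theta> \<Gamma> (Thesis b) e'' e''' \<Longrightarrow>
     red Sg T C E pr \<Theta> \<Gamma> (Thesis b) (happ h es) e'''"
| red_stop:
    "red_p Sg T C E pr \<Theta> \<Gamma> b (happ h es) (happ h es') \<Longrightarrow>
     \<not> (\<exists>\<Xi> b' p v I. (\<Xi>, fill_eq_thesis b' p v) \<in> C \<and> is_object_thesis b' \<and>
          matches Sg \<Xi> p \<Theta> \<Gamma> (happ h es') I) \<Longrightarrow>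
     red Sg T C E pr \<Theta> \<Gamma> (Thesis b) (happ h es) (happ h es')"
| red_abs:
    "a \<notin> names \<Gamma> \<Longrightarrow> a \<notin> fv A \<union> fv_bdry B \<union> fv e \<Longrightarrow>
     red Sg T C E pr \<Theta> (\<Gamma> @ [(a, A)]) (subst_bdry 0 (FVar a) B) (subst 0 (FVar a) e) e' \<Longrightarrow>
     red Sg T C E pr \<Theta> \<Gamma> (Abstr A B) (Abs e) (Abs (close 0 a e'))"
| red_var:
    "red Sg T C E pr \<Theta> \<Gamma> (Thesis (BTm A)) (FVar a) (FVar a)"
| red_star:
    "\<not> is_object_thesis b \<Longrightarrow> red Sg T C E pr \<Theta> \<Gamma> (Thesis b) Star Star"
| chk_tm:
    "red Sg T C E pr \<Theta> \<Gamma> (Thesis BTy) A A' \<Longrightarrow> chk_e Sg T C E pr \<Theta> \<Gamma> A' u v \<Longrightarrow>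
     chk Sg T C E pr \<Theta> \<Gamma> (Thesis (BTm A)) u v"
| chk_ty:
    "red Sg T C E pr \<Theta> \<Gamma> (Thesis BTy) A A' \<Longrightarrow> red Sg T C E pr \<Theta> \<Gamma> (Thesis BTy) B B' \<Longrightarrow>
     chk_n Sg T C E pr \<Theta> \<Gamma> (Thesis BTy) A' B' \<Longrightarrow>
     chk Sg T C E pr \<Theta> \<Gamma> (Thesis BTy) A B"
| chk_abs:
    "a \<notin> names \<Gamma> \<Longrightarrow> a \<notin> fv A \<union> fv_bdry B \<union> fv e \<union> fv e' \<Longrightarrow>
     chk Sg T C E pr \<Theta> (\<Gamma> @ [(a, A)]) (subst_bdry 0 (FVar a) B)
       (subst 0 (FVar a) e) (subst 0 (FVar a) e') \<Longrightarrow>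
     chk Sg T C E pr \<Theta> \<Gamma> (Abstr A B) (Abs e) (Abs e')"
| chk_e_ext:
    "ext_rule \<Xi> P s t \<Phi> \<in> E \<Longrightarrow> matches Sg \<Xi> P \<Theta> \<Gamma> A I \<Longrightarrow>
     (\<forall>(M, B)\<in>set \<Xi>. \<not> is_object B \<longrightarrow>
        chk Sg T C E pr \<Theta> \<Gamma> (act_bdry I (eq_hole B)) (act I (eq_lhs B)) (act I (eq_rhs B))) \<Longrightarrow>
     I' = I @ [(s, u), (t, v)] \<Longrightarrow>
     (\<forall>(M, B)\<in>set \<Phi>.
        chk Sg T C E pr \<Theta> \<Gamma> (act_bdry I' (eq_hole B)) (act I' (eq_lhs B)) (act I' (eq_rhs B))) \<Longrightarrow>
     chk_e Sg T C E pr \<Theta> \<Gamma> A u v"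
| chk_e_norm:
    "\<not> (\<exists>\<Xi> P s t \<Phi> I. ext_rule \<Xi> P s t \<Phi> \<in> E \<and> matches Sg \<Xi> P \<Theta> \<Gamma> A I) \<Longrightarrow>
     red Sg T C E pr \<Theta> \<Gamma> (Thesis (BTm A)) u u' \<Longrightarrow>
     red Sg T C E pr \<Theta> \<Gamma> (Thesis (BTm A)) v v' \<Longrightarrow>
     chk_n Sg T C E pr \<Theta> \<Gamma> (Thesis (BTm A)) u' v' \<Longrightarrow>
     chk_e Sg T C E pr \<Theta> \<Gamma> A u v"
| chk_n_var:
    "chk_n Sg T C E pr \<Theta> \<Gamma> (Thesis (BTm A)) (FVar a) (FVar a)"
| chk_n_app:
    "head_bdrys T \<Theta> h es (bthesis_cls b) Bs \<Longrightarrow> length es' = length es \<Longrightarrow>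
     (\<forall>i<length es. is_object (Bs ! i) \<longrightarrow> i \<in> pr h \<longrightarrow>
        chk_n Sg T C E pr \<Theta> \<Gamma> (Bs ! i) (es ! i) (es' ! i)) \<Longrightarrow>
     (\<forall>i<length es. is_object (Bs ! i) \<longrightarrow> i \<notin> pr h \<longrightarrow>
        chk Sg T C E pr \<Theta> \<Gamma> (Bs ! i) (es ! i) (es' ! i)) \<Longrightarrow>
     (\<forall>i<length es. \<not> is_object (Bs ! i) \<longrightarrow> es ! i = es' ! i) \<Longrightarrow>
     chk_n Sg T C E pr \<Theta> \<Gamma> (Thesis b) (happ h es) (happ h es')"

end

theory Submission
  imports Defs
begin

text \<open>
  By induction on the algorithm, every reduction and every check between derivable expressions yields
  a derivable equation. Computation and extensionality rules are applied by matching only, so the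
  derivability of the matching instantiation has to be recovered: object-invertibility provides it
  over the residue, and since the residue is a well-formed context, its equational premises, which
  the algorithm has checked, can be discharged one at a time, each making the sides of the next one
  derivable. The congruence steps of the algorithm compare the arguments at the boundaries of the
  left-hand side, so the arguments on the right have to be converted along the equality of the
  preceding ones. Both use that simultaneous substitutions and instantiations preserve derivability,
  that equal ones send an expression to equal expressions, and presuppositivity.
\<close>

section \<open>Parallel substitution of bound variables\<close>

text \<open>The rules of \<open>deriv\<close> have no premise on the boundary of the conclusion, and
  a congruence rule asks each side to satisfy its premises at its own boundaries. Presuppositivity
  and the conversion of arguments are therefore not built in. Both come from comparing two
  instantiations of one telescope, so derivability has to be stable under morphisms of contexts and
  under pairs of equal morphisms before the algorithm can be considered. One notion of morphism,
  sending variables to expressions and metavariables to arguments or to metavariables, covers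
  renaming, weakening, substitution, instantiation and promotion, so that each of these metatheorems
  is a single induction over derivations. Its price is that images must be locally closed, because
  the action does not lift under binders.

  Two gaps separate object-invertibility from its use. It concerns empty variable contexts and
  disjoint names, while matching happens over any context. For term rules it concerns the natural
  type, while the matched term may be given at another type, judgementally equal to it.\<close>

fun lc :: "nat \<Rightarrow> 's expr \<Rightarrow> bool" where
  "lc n (FVar a) \<longleftrightarrow> True"
| "lc n (BVar i) \<longleftrightarrow> i < n"
| "lc n (SymApp S es) \<longleftrightarrow> (\<forall>e\<in>set es. lc n e)"
| "lc n (MvApp M es) \<longleftrightarrow> (\<forall>e\<in>set es. lc n e)"
| "lc n Star \<longleftrightarrow> True"
| "lc n (Abs e) \<longleftrightarrow> lc (Suc n) e"

definition up :: "(nat \<Rightarrow> 's expr) \<Rightarrow> nat \<Rightarrow> 's expr" where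
  "up s i = (case i of 0 \<Rightarrow> BVar 0 | Suc j \<Rightarrow> lift 0 (s j))"

text \<open>\<open>lift\<close>, \<open>subst\<close> and \<open>apply_arg\<close> are all instances
  of one parallel substitution, so the single composition law \<open>bs_bs\<close> replaces the
  exchange laws between them.\<close>

fun bs :: "(nat \<Rightarrow> 's expr) \<Rightarrow> 's expr \<Rightarrow> 's expr" where
  "bs s (FVar a) = FVar a"
| "bs s (BVar i) = s i"
| "bs s (SymApp S es) = SymApp S (map (bs s) es)"
| "bs s (MvApp M es) = MvApp M (map (bs s) es)"
| "bs s Star = Star"
| "bs s (Abs e) = Abs (bs (up s) e)"

lemma up_simps [simp]: "up s 0 = BVar 0" "up s (Suc i) = lift 0 (s i)"
  by (auto simp: up_def)

lemma bs_cong: "lc n e \<Longrightarrow> (\<And>i. i < n \<Longrightarrow> s i = t i) \<Longrightarrow> bs s e = bs t e"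
proof (induction n e arbitrary: s t rule: lc.induct)
  case (6 n e)
  have "up s i = up t i" if "i < Suc n" for i
    using that 6(3) by (cases i) auto
  with 6(1)[of "up s" "up t"] 6(2) show ?case by simp
next
  case (3 n S es)
  then have "map (bs s) es = map (bs t) es" by (metis lc.simps(3) map_cong)
  then show ?case by simp
next
  case (4 n M es)
  then have "map (bs s) es = map (bs t) es" by (metis lc.simps(4) map_cong)
  then show ?case by simp
qed auto

lemma up_BVar [simp]: "up BVar = BVar"
  by (rule ext) (simp add: up_def split: nat.split)

lemma bs_BVar [simp]: "bs BVar e = e"
  by (induction e) (auto simp: map_idI)

lemma bs_lc0: "lc 0 e \<Longrightarrow> bs s e = e"
  by (metis bs_BVar bs_cong not_less_zero)

lemma up_ren: "up (\<lambda>i. BVar (r i)) = (\<lambda>i. BVar (case i of 0 \<Rightarrow> 0 | Suc j \<Rightarrow> Suc (r j)))"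
  by (rule ext) (simp add: up_def split: nat.split)

lemma lift_bs: "lift k e = bs (\<lambda>i. BVar (if i < k then i else Suc i)) e"
proof (induction e arbitrary: k)
  case (Abs e)
  have "(\<lambda>i. case i of 0 \<Rightarrow> 0 | Suc j \<Rightarrow> Suc (if j < k then j else Suc j)) =
        (\<lambda>i. if i < Suc k then i else Suc i)"
    by (rule ext) (simp split: nat.split)
  with Abs show ?case by (simp add: up_ren)
qed auto

text \<open>Under a binder, the general composition law needs that \<open>lift\<close> commutes with
  a substitution. Since \<open>lift\<close> is a renaming, the cases with a renaming on one side
  have to be settled first.\<close>

lemma bs_ren_right: "bs s (bs (\<lambda>i. BVar (r i)) e) = bs (\<lambda>i. s (r i)) e"
proof (induction e arbitrary: s r)
  case (Abs e)
  have "(\<lambda>i. up s (case i of 0 \<Rightarrow> 0 | Suc j \<Rightarrow> Suc (r j))) = up (\<lambda>i. s (r i))"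
    by (rule ext) (simp split: nat.split add: up_def)
  with Abs show ?case by (simp add: up_ren)
qed auto

lemma bs_ren_left: "bs (\<lambda>i. BVar (r i)) (bs s e) = bs (\<lambda>i. bs (\<lambda>i. BVar (r i)) (s i)) e"
proof (induction e arbitrary: s r)
  case (Abs e)
  have "bs (\<lambda>i. BVar (case i of 0 \<Rightarrow> 0 | Suc j \<Rightarrow> Suc (r j))) (up s i) =
        up (\<lambda>i. bs (\<lambda>i. BVar (r i)) (s i)) i" for i
    by (cases i) (auto simp: lift_bs bs_ren_right)
  with Abs show ?case by (simp add: up_ren)
qed auto

lemma bs_bs: "bs s (bs t e) = bs (\<lambda>i. bs s (t i)) e"
proof (induction e arbitrary: s t)
  case (Abs e)
  have "bs (up s) (up t i) = up (\<lambda>i. bs s (t i)) i" for i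
    by (cases i) (auto simp: lift_bs bs_ren_right bs_ren_left)
  with Abs show ?case by simp
qed auto

definition sub :: "nat \<Rightarrow> 's expr \<Rightarrow> nat \<Rightarrow> 's expr" where
  "sub k u i = (if i < k then BVar i else if i = k then u else BVar (i - 1))"

lemma up_sub: "up (sub k u) = sub (Suc k) (lift 0 u)"
  by (rule ext) (auto simp: up_def sub_def split: nat.split)

lemma subst_bs: "subst k u e = bs (sub k u) e"
  by (induction k u e rule: subst.induct) (auto simp: up_sub, auto simp: sub_def)

lemma bs_absn: "bs s ((Abs ^^ k) b) = (Abs ^^ k) (bs ((up ^^ k) s) b)"
  by (induction k arbitrary: s) (auto simp: funpow_swap1[of up])

lemma up_pow: "(up ^^ n) s i = (if i < n then BVar i else bs (\<lambda>j. BVar (j + n)) (s (i - n)))"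
proof (induction n arbitrary: i)
  case (Suc n)
  show ?case
    by (cases i) (auto simp: Suc lift_bs bs_ren_right)
qed simp

text \<open>Arguments are listed from the outermost binder inwards, but index \<open>0\<close>
  refers to the innermost one, hence \<open>rev\<close>. Indices beyond the list dangle in the whole
  abstraction and drop by its length.\<close>

definition env :: "'s expr list \<Rightarrow> nat \<Rightarrow> 's expr" where
  "env ts i = (if i < length ts then rev ts ! i else BVar (i - length ts))"

lemma env_Nil [simp]: "env [] = BVar"
  by (rule ext) (simp add: env_def)

lemma apply_arg_absn: "length ts = n \<Longrightarrow> apply_arg ((Abs ^^ n) b) ts = bs (env ts) b"
proof (induction ts arbitrary: n b)
  case Nil
  have "apply_arg b [] = b" by (cases b) auto
  with Nil show ?case by simp
next
  case (Cons t ts)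
  \<comment> \<open>Below the remaining \<open>length ts\<close> binders the first argument replaces
    index \<open>length ts\<close> and is lifted by that many; substituting the later arguments
    undoes the lift.\<close>
  have "bs (env ts) ((up ^^ length ts) (sub 0 t) i) = env (t # ts) i" for i
    unfolding up_pow
    by (auto simp: env_def sub_def bs_ren_right nth_append not_less le_Suc_eq)
  with Cons show ?case
    by (auto simp: subst_bs bs_absn bs_bs)
qed

lemma env_map: "i < length ts \<Longrightarrow> env (map f ts) i = f (env ts i)"
  by (simp add: env_def rev_map)

lemma subst_close: "subst k (FVar a) (close k a e) = e"
  by (induction e arbitrary: k) (auto simp: map_idI)

lemma fv_close: "a \<notin> fv (close k a e)"
  by (induction e arbitrary: k) auto

lemma finite_fv [simp]: "finite (fv e)"
  by (induction e) auto

section \<open>Simultaneous substitution and instantiation\<close>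

text \<open>Renaming is kept apart from instantiation because an equational metavariable is not the head of
  a valid expression, so that its renaming is not an instantiation.\<close>

datatype 's mval = Ren mvar | Ins "'s expr"

type_synonym 's morph = "(fvar \<Rightarrow> 's expr) \<times> (mvar \<Rightarrow> 's mval)"

fun mapp :: "'s mval \<Rightarrow> 's expr list \<Rightarrow> 's expr" where
  "mapp (Ren M) ts = MvApp M ts"
| "mapp (Ins e) ts = apply_arg e ts"

fun sact :: "'s morph \<Rightarrow> 's expr \<Rightarrow> 's expr" where
  "sact f (FVar a) = fst f a"
| "sact f (BVar i) = BVar i"
| "sact f (SymApp S es) = SymApp S (map (sact f) es)"
| "sact f (MvApp M ts) = mapp (snd f M) (map (sact f) ts)"
| "sact f Star = Star"
| "sact f (Abs e) = Abs (sact f e)"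

definition closed_abs :: "nat \<Rightarrow> 's expr \<Rightarrow> bool" where
  "closed_abs n e \<longleftrightarrow> (\<exists>b. e = (Abs ^^ n) b \<and> lc n b)"

text \<open>\<open>ok f e\<close> guarantees that the action of \<open>f\<close> on \<open>e\<close> commutes with substitution, even though
  nothing is lifted under binders.\<close>

fun ok :: "'s morph \<Rightarrow> 's expr \<Rightarrow> bool" where
  "ok f (FVar a) \<longleftrightarrow> lc 0 (fst f a)"
| "ok f (BVar i) \<longleftrightarrow> True"
| "ok f (SymApp S es) \<longleftrightarrow> (\<forall>e\<in>set es. ok f e)"
| "ok f (MvApp M ts) \<longleftrightarrow> (\<forall>e\<in>set ts. ok f e) \<and>
     (\<forall>e. snd f M = Ins e \<longrightarrow> closed_abs (length ts) e)"
| "ok f Star \<longleftrightarrow> True"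
| "ok f (Abs e) \<longleftrightarrow> ok f e"

text \<open>The body of an inserted argument has no dangling indices besides the abstracted ones, so
  an outer substitution only reaches the arguments \<open>ts\<close>.\<close>

lemma bs_mapp:
  assumes "\<And>e. v = Ins e \<Longrightarrow> closed_abs (length ts) e"
  shows "bs s (mapp v ts) = mapp v (map (bs s) ts)"
proof (cases v)
  case (Ins e)
  with assms obtain b where b: "e = (Abs ^^ length ts) b" "lc (length ts) b"
    by (auto simp: closed_abs_def)
  have "bs s (mapp v ts) = bs (\<lambda>i. bs s (env ts i)) b"
    by (simp add: Ins b apply_arg_absn bs_bs)
  also have "\<dots> = bs (env (map (bs s) ts)) b"
    by (rule bs_cong[OF b(2)]) (simp add: env_map)
  finally show ?thesis by (simp add: Ins b apply_arg_absn)
qed simp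

lemma ok_lift [simp]: "ok f (lift k e) \<longleftrightarrow> ok f e"
  by (induction e arbitrary: k) auto

text \<open>Passing under a binder in \<open>sact_bs\<close> meets the \<open>lift\<close> inside
  \<open>up\<close>, so renamings come first here as well.\<close>

lemma sact_bs_ren: "ok f e \<Longrightarrow> sact f (bs (\<lambda>i. BVar (r i)) e) = bs (\<lambda>i. BVar (r i)) (sact f e)"
proof (induction e arbitrary: r)
  case (MvApp M ts)
  then have "map (sact f) (map (bs (\<lambda>i. BVar (r i))) ts) =
      map (bs (\<lambda>i. BVar (r i))) (map (sact f) ts)"
    by auto
  then show ?case using MvApp.prems by (simp del: map_map add: bs_mapp)
qed (auto simp: bs_lc0 up_ren)

lemma sact_lift: "ok f e \<Longrightarrow> sact f (lift k e) = lift k (sact f e)"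
  using sact_bs_ren by (simp add: lift_bs)

lemma sact_bs:
  "ok f e \<Longrightarrow> (\<And>i. ok f (s i)) \<Longrightarrow> sact f (bs s e) = bs (\<lambda>i. sact f (s i)) (sact f e)"
proof (induction e arbitrary: s)
  case (MvApp M ts)
  then have "map (sact f) (map (bs s) ts) = map (bs (\<lambda>i. sact f (s i))) (map (sact f) ts)"
    by auto
  then show ?case using MvApp.prems by (simp del: map_map add: bs_mapp)
next
  case (Abs e)
  have u: "ok f (up s i)" for i using Abs.prems by (cases i) auto
  have "(\<lambda>i. sact f (up s i)) = up (\<lambda>i. sact f (s i))"
    by (rule ext) (use Abs.prems in \<open>auto simp: up_def sact_lift split: nat.split\<close>)
  with Abs u show ?case by simp
qed (auto simp: bs_lc0)

lemma sact_subst: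
  assumes "ok f e" "ok f u"
  shows "sact f (subst k u e) = subst k (sact f u) (sact f e)"
proof -
  have "(\<lambda>i. sact f (sub k u i)) = sub k (sact f u)"
    by (auto simp: sub_def)
  moreover have "ok f (sub k u i)" for i using assms by (auto simp: sub_def)
  ultimately show ?thesis using assms by (simp add: subst_bs sact_bs)
qed

lemma sact_apply_arg:
  assumes "ok f b" "\<forall>t\<in>set ts. ok f t" "n = length ts"
  shows "sact f (apply_arg ((Abs ^^ n) b) ts) = apply_arg (sact f ((Abs ^^ n) b)) (map (sact f) ts)"
proof -
  have a: "sact f ((Abs ^^ n) b) = (Abs ^^ n) (sact f b)" for n
    by (induction n) auto
  have "(\<lambda>i. sact f (env ts i)) = env (map (sact f) ts)"
    by (auto simp: env_def rev_map)
  moreover have "ok f (env ts i)" for i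
    using assms by (auto simp: env_def rev_nth)
  ultimately show ?thesis
    using assms by (simp add: a apply_arg_absn sact_bs)
qed

section \<open>Composition of morphisms\<close>

definition comp_morph :: "'s morph \<Rightarrow> 's morph \<Rightarrow> 's morph" where
  "comp_morph g f = (\<lambda>a. sact g (fst f a),
     \<lambda>M. case snd f M of Ren M' \<Rightarrow> snd g M' | Ins e \<Rightarrow> Ins (sact g e))"

lemma ok_absn: "ok f ((Abs ^^ n) b) = ok f b"
  by (induction n) auto

text \<open>A composite applies \<open>g\<close> to everything that \<open>f\<close> inserts, so
  \<open>g\<close> has to be admissible there: on images of variables, on inserted arguments, and,
  where \<open>f\<close> merely renames, for the number of arguments of the renamed
  metavariable.\<close>

fun okc :: "'s morph \<Rightarrow> 's morph \<Rightarrow> 's expr \<Rightarrow> bool" where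
  "okc g f (FVar a) \<longleftrightarrow> ok g (fst f a)"
| "okc g f (BVar i) \<longleftrightarrow> True"
| "okc g f (SymApp S es) \<longleftrightarrow> (\<forall>e\<in>set es. okc g f e)"
| "okc g f (MvApp M ts) \<longleftrightarrow> (\<forall>e\<in>set ts. okc g f e) \<and>
     (case snd f M of Ins e \<Rightarrow> ok g e
      | Ren M' \<Rightarrow> \<forall>e. snd g M' = Ins e \<longrightarrow> closed_abs (length ts) e)"
| "okc g f Star \<longleftrightarrow> True"
| "okc g f (Abs e) \<longleftrightarrow> okc g f e"

lemma ok_bs: "ok f e \<Longrightarrow> (\<And>i. ok f (s i)) \<Longrightarrow> ok f (bs s e)"
proof (induction e arbitrary: s)
  case (Abs e)
  have "ok f (up s i)" for i using Abs.prems by (cases i) auto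
  with Abs show ?case by auto
qed auto

lemma ok_sact: "ok f e \<Longrightarrow> okc g f e \<Longrightarrow> ok g (sact f e)"
proof (induction e)
  case (MvApp M ts)
  show ?case
  proof (cases "snd f M")
    case (Ins e)
    then obtain b where b: "e = (Abs ^^ length ts) b" using MvApp.prems by (auto simp: closed_abs_def)
    have "ok g (env (map (sact f) ts) i)" for i
      using MvApp by (auto simp: env_def rev_nth)
    then show ?thesis using Ins MvApp b by (simp add: apply_arg_absn ok_absn ok_bs)
  qed (use MvApp in auto)
qed auto

lemma sact_comp: "ok f e \<Longrightarrow> okc g f e \<Longrightarrow> sact g (sact f e) = sact (comp_morph g f) e"
proof (induction e)
  case (MvApp M ts)
  have eq: "map (sact g) (map (sact f) ts) = map (sact (comp_morph g f)) ts"
    using MvApp by auto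
  show ?case
  proof (cases "snd f M")
    case (Ins e)
    then obtain b where b: "e = (Abs ^^ length ts) b" using MvApp.prems by (auto simp: closed_abs_def)
    have "sact g (sact f (MvApp M ts)) = sact g (apply_arg e (map (sact f) ts))"
      by (simp add: Ins)
    also have "\<dots> = apply_arg (sact g e) (map (sact g) (map (sact f) ts))"
      unfolding b by (rule sact_apply_arg) (use Ins MvApp.prems in \<open>auto simp: b ok_absn ok_sact\<close>)
    finally show ?thesis unfolding eq by (simp add: Ins comp_morph_def)
  next
    case (Ren M')
    then show ?thesis using eq by (simp del: map_map) (simp add: comp_morph_def)
  qed
qed (auto simp: comp_morph_def)

text \<open>Only object metavariables occur in a well-formed expression.\<close>

lemma sact_cong:
  assumes "wf_arg Sg ar V n ck e" "\<And>a. a \<in> V \<Longrightarrow> fst f a = fst g a"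
    "\<And>M c k. ar M = Some (c, k) \<Longrightarrow> c \<in> {Ty, Tm} \<Longrightarrow> snd f M = snd g M"
  shows "sact f e = sact g e"
  using assms
proof (induction rule: wf_arg.induct)
  case (wf_SymApp S c as es n)
  then show ?case by (auto simp: in_set_conv_nth)
next
  case (wf_MvApp M c k ts n)
  then have "map (sact f) ts = map (sact g) ts" by auto
  moreover have "snd f M = snd g M" using wf_MvApp by blast
  ultimately show ?case by (simp only: sact.simps)
qed auto

abbreviation id_morph :: "'s morph" where
  "id_morph \<equiv> (FVar, Ren)"

lemma sact_id [simp]: "sact id_morph e = e"
  by (induction e) (auto simp: map_idI)

definition upd :: "'s morph \<Rightarrow> fvar \<Rightarrow> 's expr \<Rightarrow> 's morph" where
  "upd f a u = ((fst f)(a := u), snd f)"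

lemma sact_upd: "a \<notin> fv e \<Longrightarrow> sact (upd f a u) e = sact f e"
proof (induction e)
  case (MvApp M ts)
  then have "map (sact (upd f a u)) ts = map (sact f) ts" by auto
  then show ?case by (simp only: sact.simps) (simp add: upd_def)
qed (auto simp: upd_def)

definition inst_morph :: "'s inst \<Rightarrow> 's morph" where
  "inst_morph I = (FVar, \<lambda>M. case map_of I M of Some e \<Rightarrow> Ins e | None \<Rightarrow> Ren M)"

lemma act_sact: "act I e = sact (inst_morph I) e"
proof (induction e)
  case (MvApp M ts)
  then have "map (act I) ts = map (sact (inst_morph I)) ts" by auto
  then show ?case by (simp only: sact.simps act.simps) (auto simp: inst_morph_def split: option.split)
qed (auto simp: inst_morph_def)

section \<open>Syntactic validity\<close>

lemma wf_arg_lc: "wf_arg Sg ar V n (c, k) e \<Longrightarrow> lc n e"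
proof (induction n "(c, k)" e arbitrary: c k rule: wf_arg.induct)
  case (wf_SymApp S c as es n)
  then show ?case by (auto simp: in_set_conv_nth)
qed auto

lemma wf_arg_fv: "wf_arg Sg ar V n ck e \<Longrightarrow> fv e \<subseteq> V"
  by (induction rule: wf_arg.induct) (auto simp: in_set_conv_nth subset_iff)

lemma wf_arg_mono:
  assumes "wf_arg Sg ar V n ck e" "V \<subseteq> V'" "\<And>M ck. ar M = Some ck \<Longrightarrow> ar' M = Some ck"
  shows "wf_arg Sg ar' V' n ck e"
  using assms by (induction rule: wf_arg.induct) (auto intro: wf_arg.intros)

lemma wf_arg_absn: "wf_arg Sg ar V n (c, k) e \<Longrightarrow>
  \<exists>b. e = (Abs ^^ k) b \<and> wf_arg Sg ar V (n + k) (c, 0) b"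
proof (induction k arbitrary: n e)
  case (Suc k)
  then obtain e' where "e = Abs e'" "wf_arg Sg ar V (Suc n) (c, k) e'"
    by (auto elim: wf_arg.cases)
  with Suc show ?case by fastforce
qed auto

lemma wf_arg_closed_abs: "wf_arg Sg ar V 0 (c, k) e \<Longrightarrow> closed_abs k e"
  unfolding closed_abs_def using wf_arg_absn wf_arg_lc by fastforce

lemma wf_arg_lift: "wf_arg Sg ar V n ck e \<Longrightarrow> wf_arg Sg ar V (Suc n) ck (lift k e)"
  by (induction arbitrary: k rule: wf_arg.induct) (auto intro!: wf_arg.intros)

lemma wf_arg_bs:
  "wf_arg Sg ar V n ck e \<Longrightarrow> (\<And>i. i < n \<Longrightarrow> wf_arg Sg ar V m (Tm, 0) (s i)) \<Longrightarrow>
   wf_arg Sg ar V m ck (bs s e)"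
proof (induction arbitrary: m s rule: wf_arg.induct)
  case (wf_Abs n c k e)
  have "wf_arg Sg ar V (Suc m) (Tm, 0) (up s i)" if "i < Suc n" for i
    using that wf_Abs.prems by (cases i) (auto intro: wf_arg_lift wf_arg.intros)
  with wf_Abs show ?case by (auto intro: wf_arg.intros)
qed (auto intro!: wf_arg.intros)

lemma wf_arg_subst:
  assumes "wf_arg Sg ar V (Suc n) ck e" "wf_arg Sg ar V n (Tm, 0) u" "k \<le> n"
  shows "wf_arg Sg ar V n ck (subst k u e)"
  unfolding subst_bs
  by (rule wf_arg_bs[OF assms(1)]) (use assms in \<open>auto simp: sub_def intro: wf_arg.intros\<close>)

lemma wf_arg_apply_arg:
  assumes "wf_arg Sg ar V 0 (c, length ts) e" "\<forall>t\<in>set ts. wf_arg Sg ar V n (Tm, 0) t"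
  shows "wf_arg Sg ar V n (c, 0) (apply_arg e ts)"
proof -
  obtain b where b: "e = (Abs ^^ length ts) b" "wf_arg Sg ar V (length ts) (c, 0) b"
    using wf_arg_absn[OF assms(1)] by auto
  show ?thesis unfolding b(1) apply_arg_absn[OF refl]
    by (rule wf_arg_bs[OF b(2)]) (use assms in \<open>auto simp: env_def rev_nth\<close>)
qed

text \<open>As \<open>a\<close> does not occur in \<open>e\<close>, each of its occurrences in the
  opened expression comes from index \<open>n\<close>, so \<open>a\<close> can be traded for one
  more bound variable. This recovers validity of an abstracted body from validity of its
  opening.\<close>

lemma wf_arg_subst_FVar_D:
  "wf_arg Sg ar (insert a V) n ck e' \<Longrightarrow> e' = subst n (FVar a) e \<Longrightarrow> a \<notin> fv e \<Longrightarrow>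
   wf_arg Sg ar V (Suc n) ck e"
proof (induction arbitrary: e rule: wf_arg.induct)
  case (wf_FVar b n)
  then show ?case by (cases e) (auto intro: wf_arg.intros split: if_splits)
next
  case (wf_BVar i n)
  then show ?case by (cases e) (auto intro: wf_arg.intros split: if_splits)
next
  case (wf_SymApp S c as es n)
  then obtain es' where e: "e = SymApp S es'" "es = map (subst n (FVar a)) es'"
    by (cases e) (auto split: if_splits)
  show ?case unfolding e
    by (rule wf_arg.wf_SymApp) (use wf_SymApp e in auto)
next
  case (wf_MvApp M c k ts n)
  then obtain es' where e: "e = MvApp M es'" "ts = map (subst n (FVar a)) es'"
    by (cases e) (auto split: if_splits)
  show ?case unfolding e
    by (rule wf_arg.wf_MvApp) (use wf_MvApp e in auto)
next
  case (wf_Star c n)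
  then show ?case by (cases e) (auto intro: wf_arg.intros split: if_splits)
next
  case (wf_Abs n c k e0)
  then obtain e' where "e = Abs e'" "e0 = subst (Suc n) (FVar a) e'"
    by (cases e) (auto split: if_splits)
  with wf_Abs show ?case by (auto intro: wf_arg.intros)
qed

text \<open>The part of being a morphism that concerns raw expressions. Images are valid with no
  bound variable in scope, hence locally closed, which is why valid expressions satisfy
  \<open>ok\<close> and \<open>okc\<close>.\<close>

definition wmor :: "'s signature \<Rightarrow> (mvar \<Rightarrow> arity option) \<Rightarrow> fvar set \<Rightarrow>
    (mvar \<Rightarrow> arity option) \<Rightarrow> fvar set \<Rightarrow> 's morph \<Rightarrow> bool" where
  "wmor Sg ar V ar' V' f \<longleftrightarrow> (\<forall>a\<in>V. wf_arg Sg ar' V' 0 (Tm, 0) (fst f a)) \<and>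
     (\<forall>M c k. ar M = Some (c, k) \<longrightarrow> (case snd f M of
         Ren M' \<Rightarrow> ar' M' = Some (c, k) | Ins e \<Rightarrow> wf_arg Sg ar' V' 0 (c, k) e))"

lemma wf_arg_level: "wf_arg Sg ar V n ck e \<Longrightarrow> n \<le> m \<Longrightarrow> wf_arg Sg ar V m ck e"
  by (induction arbitrary: m rule: wf_arg.induct) (auto intro: wf_arg.intros)

lemma wf_sact:
  assumes "wf_arg Sg ar V n ck e" "wmor Sg ar V ar' V' f"
  shows "wf_arg Sg ar' V' n ck (sact f e)"
  using assms
proof (induction rule: wf_arg.induct)
  case (wf_FVar a n)
  then show ?case by (auto simp: wmor_def intro: wf_arg_level)
next
  case (wf_MvApp M c k ts n)
  show ?case
  proof (cases "snd f M")
    case (Ren M')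
    then have "ar' M' = Some (c, k)" using wf_MvApp.hyps wf_MvApp.prems by (fastforce simp: wmor_def)
    then show ?thesis using Ren wf_MvApp by (auto intro!: wf_arg.intros)
  next
    case (Ins e)
    then have "wf_arg Sg ar' V' 0 (c, k) e"
      using wf_MvApp.hyps wf_MvApp.prems by (auto simp: wmor_def split: mval.splits)
    then show ?thesis using Ins wf_MvApp by (auto intro!: wf_arg_apply_arg)
  qed
qed (auto intro: wf_arg.intros)

lemma wf_ok:
  assumes "wf_arg Sg ar V n ck e" "wmor Sg ar V ar' V' f"
  shows "ok f e"
  using assms
proof (induction rule: wf_arg.induct)
  case (wf_FVar a n)
  then show ?case by (auto simp: wmor_def intro: wf_arg_lc)
next
  case (wf_MvApp M c k ts n)
  then have "closed_abs k e" if "snd f M = Ins e" for e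
    using that wf_MvApp.hyps wf_MvApp.prems
    by (fastforce simp: wmor_def intro: wf_arg_closed_abs)
  then show ?case using wf_MvApp by auto
qed (auto simp: in_set_conv_nth)

lemma wf_okc:
  assumes "wf_arg Sg ar V n ck e" "wmor Sg ar V ar' V' f" "wmor Sg ar' V' ar'' V'' g"
  shows "okc g f e"
  using assms
proof (induction rule: wf_arg.induct)
  case (wf_FVar a n)
  then show ?case by (auto simp: wmor_def[of _ _ _ _ _ f] intro: wf_ok)
next
  case (wf_MvApp M c k ts n)
  show ?case
  proof (cases "snd f M")
    case (Ren M')
    then have "ar' M' = Some (c, k)" using wf_MvApp.hyps wf_MvApp.prems by (fastforce simp: wmor_def)
    then have "closed_abs k e" if "snd g M' = Ins e" for e
      using that wf_MvApp.prems(2)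
      by (fastforce simp: wmor_def intro: wf_arg_closed_abs)
    then show ?thesis using Ren wf_MvApp by auto
  next
    case (Ins e)
    then have "wf_arg Sg ar' V' 0 (c, k) e"
      using wf_MvApp.hyps wf_MvApp.prems by (auto simp: wmor_def split: mval.splits)
    then show ?thesis using Ins wf_MvApp by (auto intro: wf_ok)
  qed
qed (auto simp: in_set_conv_nth)

lemma wf_sact_comp:
  assumes "wf_arg Sg ar V n ck e" "wmor Sg ar V ar' V' f" "wmor Sg ar' V' ar'' V'' g"
  shows "sact g (sact f e) = sact (comp_morph g f) e"
  using sact_comp[OF wf_ok[OF assms(1,2)] wf_okc[OF assms]] .

section \<open>Judgements and boundaries\<close>

definition sact_jdg :: "'s morph \<Rightarrow> 's jdg \<Rightarrow> 's jdg" where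
  "sact_jdg f = map_abstracted (sact f) (map_jthesis (sact f))"

definition sact_bdry :: "'s morph \<Rightarrow> 's bdry \<Rightarrow> 's bdry" where
  "sact_bdry f = map_abstracted (sact f) (map_bthesis (sact f))"

definition exprs_jdg :: "'s jdg \<Rightarrow> 's expr set" where
  "exprs_jdg J = binders J \<union> (\<Union>j\<in>theses J. set_jthesis j)"

definition exprs_bdry :: "'s bdry \<Rightarrow> 's expr set" where
  "exprs_bdry B = binders B \<union> (\<Union>b\<in>theses B. set_bthesis b)"

lemma sact_jdg_simps [simp]:
  "sact_jdg f (Thesis j) = Thesis (map_jthesis (sact f) j)"
  "sact_jdg f (Abstr A J) = Abstr (sact f A) (sact_jdg f J)"
  by (auto simp: sact_jdg_def)

lemma sact_bdry_simps [simp]: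
  "sact_bdry f (Thesis b) = Thesis (map_bthesis (sact f) b)"
  "sact_bdry f (Abstr A B) = Abstr (sact f A) (sact_bdry f B)"
  by (auto simp: sact_bdry_def)

lemma exprs_jdg_simps [simp]:
  "exprs_jdg (Thesis j) = set_jthesis j"
  "exprs_jdg (Abstr A J) = insert A (exprs_jdg J)"
  by (auto simp: exprs_jdg_def)

lemma exprs_bdry_simps [simp]:
  "exprs_bdry (Thesis b) = set_bthesis b"
  "exprs_bdry (Abstr A B) = insert A (exprs_bdry B)"
  by (auto simp: exprs_bdry_def)

lemma fv_jdg_exprs: "fv_jdg J = (\<Union>e\<in>exprs_jdg J. fv e)"
  by (auto simp: fv_jdg_def exprs_jdg_def)

lemma fv_bdry_exprs: "fv_bdry B = (\<Union>e\<in>exprs_bdry B. fv e)"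
  by (auto simp: fv_bdry_def exprs_bdry_def)

lemma finite_jthesis [simp]: "finite (set_jthesis j)"
  by (cases j) auto

lemma finite_bthesis [simp]: "finite (set_bthesis b)"
  by (cases b) auto

lemma finite_fv_jdg [simp]: "finite (fv_jdg J)"
proof -
  have "finite (exprs_jdg J)" by (induction J) auto
  then show ?thesis by (simp add: fv_jdg_exprs)
qed

lemma finite_fv_bdry [simp]: "finite (fv_bdry B)"
proof -
  have "finite (exprs_bdry B)" by (induction B) auto
  then show ?thesis by (simp add: fv_bdry_exprs)
qed

lemma sact_jdg_cong:
  "(\<And>e. e \<in> exprs_jdg J \<Longrightarrow> sact f e = sact g e) \<Longrightarrow> sact_jdg f J = sact_jdg g J"
  by (induction J) (auto intro: jthesis.map_cong0)

lemma sact_bdry_cong: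
  "(\<And>e. e \<in> exprs_bdry B \<Longrightarrow> sact f e = sact g e) \<Longrightarrow> sact_bdry f B = sact_bdry g B"
  by (induction B) (auto intro: bthesis.map_cong0)

lemma sact_jdg_id [simp]: "sact_jdg id_morph J = J"
  by (induction J) (auto simp: jthesis.map_ident_strong)

lemma sact_bdry_id [simp]: "sact_bdry id_morph B = B"
  by (induction B) (auto simp: bthesis.map_ident_strong)

lemma act_bdry_sact: "act_bdry I B = sact_bdry (inst_morph I) B"
proof -
  have "act I = sact (inst_morph I)" by (rule ext) (rule act_sact)
  then show ?thesis by (simp add: act_bdry_def sact_bdry_def)
qed

lemma depth_sact_bdry [simp]: "depth (sact_bdry f B) = depth B"
  by (induction B) auto

lemma bthesis_cls_map [simp]: "bthesis_cls (map_bthesis g b) = bthesis_cls b"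
  by (cases b) auto

lemma core_sact_bdry [simp]: "core (sact_bdry f B) = map_bthesis (sact f) (core B)"
  by (induction B) auto

lemma bdry_arity_sact [simp]: "bdry_arity (sact_bdry f B) = bdry_arity B"
  by (simp add: bdry_arity_def)

lemma is_object_thesis_map [simp]: "is_object_thesis (map_bthesis g b) = is_object_thesis b"
  by (simp add: is_object_thesis_def)

lemma is_object_sact [simp]: "is_object (sact_bdry f B) = is_object B"
  by (simp add: is_object_def)

lemma depth_subst_bdry [simp]: "depth (subst_bdry k u B) = depth B"
  by (induction B arbitrary: k u) auto

lemma core_subst_cls [simp]: "bthesis_cls (core (subst_bdry k u B)) = bthesis_cls (core B)"
  by (induction B arbitrary: k u) auto

lemma is_object_subst [simp]: "is_object (subst_bdry k u B) = is_object B"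
  by (simp add: is_object_def is_object_thesis_def)

lemma bdry_arity_subst [simp]: "bdry_arity (subst_bdry k u B) = bdry_arity B"
  by (simp add: bdry_arity_def)

lemma is_object_Abstr [simp]: "is_object (Abstr A B) = is_object B"
  by (simp add: is_object_def)

lemma sact_subst_jdg:
  assumes "\<And>e. e \<in> exprs_jdg J \<Longrightarrow> ok f e" "ok f u"
  shows "sact_jdg f (subst_jdg k u J) = subst_jdg k (sact f u) (sact_jdg f J)"
  using assms
proof (induction J arbitrary: k u)
  case (Thesis j)
  then show ?case by (cases j) (auto simp: sact_subst)
qed (auto simp: sact_subst sact_lift)

lemma sact_subst_bdry:
  assumes "\<And>e. e \<in> exprs_bdry B \<Longrightarrow> ok f e" "ok f u"
  shows "sact_bdry f (subst_bdry k u B) = subst_bdry k (sact f u) (sact_bdry f B)"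
  using assms
proof (induction B arbitrary: k u)
  case (Thesis b)
  then show ?case by (cases b) (auto simp: sact_subst)
qed (auto simp: sact_subst sact_lift)

primrec wf_jdg :: "'s signature \<Rightarrow> (mvar \<Rightarrow> arity option) \<Rightarrow> fvar set \<Rightarrow> nat \<Rightarrow> 's jdg \<Rightarrow> bool" where
  "wf_jdg Sg ar V n (Thesis j) \<longleftrightarrow> wf_jthesis Sg ar V n j"
| "wf_jdg Sg ar V n (Abstr A J) \<longleftrightarrow> wf_arg Sg ar V n (Ty, 0) A \<and> wf_jdg Sg ar V (Suc n) J"

lemma wf_jdg_exprs: "wf_jdg Sg ar V n J \<Longrightarrow> e \<in> exprs_jdg J \<Longrightarrow> \<exists>m ck. wf_arg Sg ar V m ck e"
proof (induction J arbitrary: n)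
  case (Thesis j)
  then show ?case by (cases j) auto
qed auto

lemma wf_bdry_exprs: "wf_bdry Sg ar V n B \<Longrightarrow> e \<in> exprs_bdry B \<Longrightarrow> \<exists>m ck. wf_arg Sg ar V m ck e"
proof (induction B arbitrary: n)
  case (Thesis b)
  then show ?case by (cases b) auto
qed auto

lemma wf_bdry_fv: "wf_bdry Sg ar V n B \<Longrightarrow> fv_bdry B \<subseteq> V"
  using wf_bdry_exprs wf_arg_fv by (force simp: fv_bdry_exprs)

lemma wf_bdry_mono:
  assumes "wf_bdry Sg ar V n B" "V \<subseteq> V'" "\<And>M ck. ar M = Some ck \<Longrightarrow> ar' M = Some ck"
  shows "wf_bdry Sg ar' V' n B"
  using assms
proof (induction B arbitrary: n)
  case (Thesis b)
  then show ?case by (cases b) (auto elim!: wf_arg_mono)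
next
  case (Abstr A B)
  then show ?case using wf_arg_mono[of Sg ar V n "(Ty, 0)" A V' ar'] by auto
qed

lemma wf_bdry_subst: "wf_bdry Sg ar V (Suc n) B \<Longrightarrow> wf_arg Sg ar V n (Tm, 0) u \<Longrightarrow> k \<le> n \<Longrightarrow>
  wf_bdry Sg ar V n (subst_bdry k u B)"
proof (induction B arbitrary: n k u)
  case (Thesis b)
  then show ?case by (cases b) (auto intro: wf_arg_subst)
next
  case (Abstr A B)
  then show ?case using Abstr.IH[OF _ wf_arg_lift[OF Abstr.prems(2)], of "Suc k" 0]
    by (auto intro: wf_arg_subst)
qed

lemma wf_jdg_subst_FVar_D: "wf_jdg Sg ar (insert a V) n (subst_jdg n (FVar a) J) \<Longrightarrow>
  a \<notin> fv_jdg J \<Longrightarrow> wf_jdg Sg ar V (Suc n) J"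
proof (induction J arbitrary: n)
  case (Thesis j)
  then show ?case by (cases j) (auto simp: fv_jdg_exprs intro: wf_arg_subst_FVar_D)
qed (auto simp: fv_jdg_exprs intro: wf_arg_subst_FVar_D)

lemma wf_bdry_subst_FVar_D: "wf_bdry Sg ar (insert a V) n (subst_bdry n (FVar a) B) \<Longrightarrow>
  a \<notin> fv_bdry B \<Longrightarrow> wf_bdry Sg ar V (Suc n) B"
proof (induction B arbitrary: n)
  case (Thesis b)
  then show ?case by (cases b) (auto simp: fv_bdry_exprs intro: wf_arg_subst_FVar_D)
qed (auto simp: fv_bdry_exprs intro: wf_arg_subst_FVar_D)

lemma wf_sact_jdg: "wf_jdg Sg ar V n J \<Longrightarrow> wmor Sg ar V ar' V' f \<Longrightarrow> wf_jdg Sg ar' V' n (sact_jdg f J)"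
proof (induction J arbitrary: n)
  case (Thesis j)
  then show ?case by (cases j) (auto intro: wf_sact)
qed (auto intro: wf_sact)

lemma wf_sact_bdry: "wf_bdry Sg ar V n B \<Longrightarrow> wmor Sg ar V ar' V' f \<Longrightarrow> wf_bdry Sg ar' V' n (sact_bdry f B)"
proof (induction B arbitrary: n)
  case (Thesis b)
  then show ?case by (cases b) (auto intro: wf_sact)
qed (auto intro: wf_sact)

lemma wf_ok_jdg: "wf_jdg Sg ar V n J \<Longrightarrow> wmor Sg ar V ar' V' f \<Longrightarrow> e \<in> exprs_jdg J \<Longrightarrow> ok f e"
  using wf_jdg_exprs wf_ok by blast

lemma wf_ok_bdry: "wf_bdry Sg ar V n B \<Longrightarrow> wmor Sg ar V ar' V' f \<Longrightarrow> e \<in> exprs_bdry B \<Longrightarrow> ok f e"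
  using wf_bdry_exprs wf_ok by blast

lemma ok_upd: "ok f e \<Longrightarrow> lc 0 u \<Longrightarrow> ok (upd f a u) e"
  by (induction e) (auto simp: upd_def)

text \<open>The action commutes with substitution, and the update at \<open>a\<close> is invisible
  on \<open>J\<close> itself since \<open>a\<close> does not occur there. In this way an induction
  hypothesis about an opened body becomes a statement about the opening of its image.\<close>

lemma sact_jdg_upd_subst:
  assumes "wf_jdg Sg ar V n J" "wmor Sg ar V ar' V' f" "a \<notin> fv_jdg J" "lc 0 u"
  shows "sact_jdg (upd f a u) (subst_jdg k (FVar a) J) = subst_jdg k u (sact_jdg f J)"
proof -
  have "sact_jdg (upd f a u) (subst_jdg k (FVar a) J) = subst_jdg k u (sact_jdg (upd f a u) J)"
    by (subst sact_subst_jdg)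
        (use assms in \<open>auto simp: upd_def[of f a u] intro: ok_upd[unfolded upd_def] wf_ok_jdg\<close>)
  also have "sact_jdg (upd f a u) J = sact_jdg f J"
    by (rule sact_jdg_cong) (use assms in \<open>auto simp: fv_jdg_exprs intro: sact_upd\<close>)
  finally show ?thesis .
qed

lemma sact_bdry_upd_subst:
  assumes "wf_bdry Sg ar V n B" "wmor Sg ar V ar' V' f" "a \<notin> fv_bdry B" "lc 0 u"
  shows "sact_bdry (upd f a u) (subst_bdry k (FVar a) B) = subst_bdry k u (sact_bdry f B)"
proof -
  have "sact_bdry (upd f a u) (subst_bdry k (FVar a) B) = subst_bdry k u (sact_bdry (upd f a u) B)"
    by (subst sact_subst_bdry)
        (use assms in \<open>auto simp: upd_def[of f a u] intro: ok_upd[unfolded upd_def] wf_ok_bdry\<close>)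
  also have "sact_bdry (upd f a u) B = sact_bdry f B"
    by (rule sact_bdry_cong) (use assms in \<open>auto simp: fv_bdry_exprs intro: sact_upd\<close>)
  finally show ?thesis .
qed

lemma sact_bdry_comp:
  assumes "wf_bdry Sg ar V n B" "wmor Sg ar V ar' V' f" "wmor Sg ar' V' ar'' V'' g"
  shows "sact_bdry g (sact_bdry f B) = sact_bdry (comp_morph g f) B"
proof -
  have "\<forall>e\<in>exprs_bdry B. sact g (sact f e) = sact (comp_morph g f) e"
    using wf_bdry_exprs[OF assms(1)] wf_sact_comp[OF _ assms(2,3)] by blast
  then show ?thesis
  proof (induction B)
    case (Thesis b)
    then show ?case by (cases b) auto
  qed auto
qed

subsection \<open>Filled boundaries\<close>

lemma map_fill_thesis: "map_jthesis g (fill_thesis b e) = fill_thesis (map_bthesis g b) (g e)"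
  by (cases b) auto

lemma map_fill_eq_thesis:
  "map_jthesis g (fill_eq_thesis b e e') = fill_eq_thesis (map_bthesis g b) (g e) (g e')"
  by (cases b) auto

text \<open>\<open>fill\<close> strips abstractions by \<open>unabs\<close>, which is junk on other
  expressions. The laws for filled boundaries hold under this condition on shape, which substitution
  and the action preserve.\<close>

definition nabs :: "nat \<Rightarrow> 's expr \<Rightarrow> bool" where
  "nabs n e \<longleftrightarrow> (\<exists>b. e = (Abs ^^ n) b)"

lemma nabs_0 [simp]: "nabs 0 e"
  by (simp add: nabs_def)

lemma nabs_Suc: "nabs (Suc n) e \<longleftrightarrow> (\<exists>e'. e = Abs e' \<and> nabs n e')"
  by (auto simp: nabs_def)

lemma nabs_subst: "nabs n e \<Longrightarrow> nabs n (subst k u e)"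
  by (induction n arbitrary: e k u) (auto simp: nabs_Suc)

lemma nabs_sact: "nabs n e \<Longrightarrow> nabs n (sact f e)"
  by (induction n arbitrary: e) (auto simp: nabs_Suc)

lemma wf_arg_nabs: "wf_arg Sg ar V n (c, k) e \<Longrightarrow> nabs k e"
  unfolding nabs_def using wf_arg_absn by blast

lemma wf_arg_bdry_nabs: "wf_arg Sg ar V n (bdry_arity B) e \<Longrightarrow> nabs (depth B) e"
  by (auto simp: bdry_arity_def intro: wf_arg_nabs)

lemma sact_fill: "nabs (depth B) e \<Longrightarrow> sact_jdg f (fill B e) = fill (sact_bdry f B) (sact f e)"
  by (induction B arbitrary: e) (auto simp: map_fill_thesis nabs_Suc)

lemma sact_fill_eq: "nabs (depth B) e \<Longrightarrow> nabs (depth B) e' \<Longrightarrow>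
  sact_jdg f (fill_eq B e e') = fill_eq (sact_bdry f B) (sact f e) (sact f e')"
  by (induction B arbitrary: e e') (auto simp: map_fill_eq_thesis nabs_Suc)

lemma subst_fill: "nabs (depth B) e \<Longrightarrow> subst_jdg k u (fill B e) = fill (subst_bdry k u B) (subst k u e)"
  by (induction B arbitrary: e k u) (auto simp: map_fill_thesis nabs_Suc)

lemma subst_fill_eq: "nabs (depth B) e \<Longrightarrow> nabs (depth B) e' \<Longrightarrow>
  subst_jdg k u (fill_eq B e e') = fill_eq (subst_bdry k u B) (subst k u e) (subst k u e')"
  by (induction B arbitrary: e e' k u) (auto simp: map_fill_eq_thesis nabs_Suc)

lemma fv_fill: "nabs (depth B) e \<Longrightarrow> fv_jdg (fill B e) \<subseteq> fv_bdry B \<union> fv e"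
proof (induction B arbitrary: e)
  case (Thesis b)
  then show ?case by (cases b) (auto simp: fv_jdg_exprs fv_bdry_exprs)
next
  case (Abstr A B)
  then obtain e' where "e = Abs e'" "nabs (depth B) e'" by (auto simp: nabs_Suc)
  with Abstr.IH[of e'] show ?case by (auto simp: fv_jdg_exprs fv_bdry_exprs)
qed

lemma fv_fill_eq: "nabs (depth B) e \<Longrightarrow> nabs (depth B) e' \<Longrightarrow>
  fv_jdg (fill_eq B e e') \<subseteq> fv_bdry B \<union> fv e \<union> fv e'"
proof (induction B arbitrary: e e')
  case (Thesis b)
  then show ?case by (cases b) (auto simp: fv_jdg_exprs fv_bdry_exprs)
next
  case (Abstr A B)
  then obtain d d' where "e = Abs d" "nabs (depth B) d" "e' = Abs d'" "nabs (depth B) d'"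
    by (auto simp: nabs_Suc)
  with Abstr.IH[of d d'] show ?case by (auto simp: fv_jdg_exprs fv_bdry_exprs)
qed

text \<open>Counterpart of \<open>apply_bdry\<close> for judgements, so that substitution of
  arguments is treated once for filled boundaries and filled equations alike.\<close>

fun apply_jdg :: "'s jdg \<Rightarrow> 's expr list \<Rightarrow> 's expr jthesis" where
  "apply_jdg (Abstr A J) (t # ts) = apply_jdg (subst_jdg 0 t J) ts"
| "apply_jdg J ts = core J"

fun jarg_types :: "'s jdg \<Rightarrow> 's expr list \<Rightarrow> 's expr list" where
  "jarg_types (Abstr A J) (t # ts) = A # jarg_types (subst_jdg 0 t J) ts"
| "jarg_types J ts = []"

lemma depth_subst_jdg [simp]: "depth (subst_jdg k u J) = depth J"
  by (induction J arbitrary: k u) auto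

lemma depth_sact_jdg [simp]: "depth (sact_jdg f J) = depth J"
  by (induction J) auto

lemma depth_fill [simp]: "depth (fill B e) = depth B"
  by (induction B arbitrary: e) auto

lemma depth_fill_eq [simp]: "depth (fill_eq B e e') = depth B"
  by (induction B arbitrary: e e') auto

lemma length_arg_types: "length ts = depth B \<Longrightarrow> length (arg_types B ts) = depth B"
  by (induction B ts rule: arg_types.induct) auto

lemma apply_fill: "nabs (depth B) e \<Longrightarrow> length ts = depth B \<Longrightarrow>
  apply_jdg (fill B e) ts = fill_thesis (apply_bdry B ts) (apply_arg e ts)"
proof (induction ts arbitrary: B e)
  case Nil
  then obtain b where "B = Thesis b" by (cases B) auto
  then show ?case by (cases e) auto
next
  case (Cons t ts)
  then obtain A B' where B: "B = Abstr A B'" by (cases B) auto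
  with Cons show ?case by (auto simp: nabs_Suc subst_fill nabs_subst)
qed

lemma apply_fill_eq: "nabs (depth B) e \<Longrightarrow> nabs (depth B) e' \<Longrightarrow> length ts = depth B \<Longrightarrow>
  apply_jdg (fill_eq B e e') ts = fill_eq_thesis (apply_bdry B ts) (apply_arg e ts) (apply_arg e' ts)"
proof (induction ts arbitrary: B e e')
  case Nil
  then obtain b where "B = Thesis b" by (cases B) auto
  moreover have "apply_arg e [] = e" for e :: "'a expr" by (cases e) auto
  ultimately show ?case by auto
next
  case (Cons t ts)
  then obtain A B' where B: "B = Abstr A B'" by (cases B) auto
  with Cons show ?case by (auto simp: nabs_Suc subst_fill_eq nabs_subst)
qed

lemma jarg_types_fill: "nabs (depth B) e \<Longrightarrow> jarg_types (fill B e) ts = arg_types B ts"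
proof (induction ts arbitrary: B e)
  case (Cons t ts)
  then show ?case by (cases B) (auto simp: nabs_Suc subst_fill nabs_subst)
qed (case_tac B; auto)

lemma jarg_types_fill_eq: "nabs (depth B) e \<Longrightarrow> nabs (depth B) e' \<Longrightarrow>
  jarg_types (fill_eq B e e') ts = arg_types B ts"
proof (induction ts arbitrary: B e e')
  case (Cons t ts)
  then show ?case by (cases B) (auto simp: nabs_Suc subst_fill_eq nabs_subst)
qed (case_tac B; auto)

lemma sact_apply_bdry:
  "wf_bdry Sg ar V 0 B \<Longrightarrow> wmor Sg ar V ar' V' f \<Longrightarrow> \<forall>t\<in>set ts. wf_arg Sg ar V 0 (Tm, 0) t \<Longrightarrow>
   map_bthesis (sact f) (apply_bdry B ts) = apply_bdry (sact_bdry f B) (map (sact f) ts) \<and>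
   map (sact f) (arg_types B ts) = arg_types (sact_bdry f B) (map (sact f) ts)"
proof (induction ts arbitrary: B)
  case Nil
  then show ?case by (cases B) auto
next
  case (Cons t ts)
  show ?case
  proof (cases B)
    case (Abstr A B')
    have "sact_bdry f (subst_bdry 0 t B') = subst_bdry 0 (sact f t) (sact_bdry f B')"
      by (rule sact_subst_bdry) (use Cons.prems Abstr in \<open>auto intro: wf_ok_bdry wf_ok\<close>)
    moreover have "wf_bdry Sg ar V 0 (subst_bdry 0 t B')"
      using Cons.prems Abstr by (auto intro: wf_bdry_subst)
    ultimately show ?thesis using Cons Abstr by auto
  qed auto
qed

lemma wf_apply_bdry:
  "wf_bdry Sg ar V 0 B \<Longrightarrow> \<forall>t\<in>set ts. wf_arg Sg ar V 0 (Tm, 0) t \<Longrightarrow> length ts = depth B \<Longrightarrow>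
   wf_bthesis Sg ar V 0 (apply_bdry B ts)"
proof (induction ts arbitrary: B)
  case Nil
  then show ?case by (cases B) auto
next
  case (Cons t ts)
  then obtain A B' where B: "B = Abstr A B'" by (cases B) auto
  have "wf_bdry Sg ar V 0 (subst_bdry 0 t B')"
    using Cons.prems B by (auto intro: wf_bdry_subst)
  with Cons B show ?case by auto
qed

lemma cls_apply_bdry [simp]: "bthesis_cls (apply_bdry B ts) = bthesis_cls (core B)"
  by (induction B ts rule: apply_bdry.induct) auto

lemma is_object_apply_bdry: "is_object_thesis (apply_bdry B ts) = is_object B"
  by (simp add: is_object_def is_object_thesis_def)

lemma map_act_bthesis: "map_bthesis (act I) b = map_bthesis (sact (inst_morph I)) b"
  by (cases b) (auto simp: act_sact)

lemma map_act_jthesis: "map_jthesis (act I) j = map_jthesis (sact (inst_morph I)) j"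
  by (cases j) (auto simp: act_sact)

subsection \<open>Instantiations\<close>

definition inst_act :: "'s morph \<Rightarrow> 's inst \<Rightarrow> 's inst" where
  "inst_act f I = map (\<lambda>(M, e). (M, sact f e)) I"

lemma inst_act_simps [simp]:
  "length (inst_act f I) = length I" "take n (inst_act f I) = inst_act f (take n I)"
  "map fst (inst_act f I) = map fst I"
  "i < length I \<Longrightarrow> inst_act f I ! i = (fst (I ! i), sact f (snd (I ! i)))"
  "map_of (inst_act f I) M = map_option (sact f) (map_of I M)"
  by (auto simp: inst_act_def take_map map_of_map split_beta)

lemma instantiates_length: "instantiates Sg \<Xi> \<Theta> \<Gamma> I \<Longrightarrow> length I = length \<Xi>"
  unfolding instantiates_def by (metis length_map)

lemma instantiates_fst: "instantiates Sg \<Xi> \<Theta> \<Gamma> I \<Longrightarrow> i < length \<Xi> \<Longrightarrow> fst (I ! i) = fst (\<Xi> ! i)"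
  using instantiates_length[of Sg \<Xi> \<Theta> \<Gamma> I] unfolding instantiates_def by (metis nth_map)

lemma instantiates_take:
  assumes "instantiates Sg \<Xi> \<Theta> \<Gamma> I"
  shows "instantiates Sg (take n \<Xi>) \<Theta> \<Gamma> (take n I)"
  using assms instantiates_length[OF assms] unfolding instantiates_def
      by (simp add: take_map[symmetric])

lemma distinct_map_of_nth: "distinct (map fst xs) \<Longrightarrow> i < length xs \<Longrightarrow>
    map_of xs (fst (xs ! i)) = Some (snd (xs ! i))"
  by (simp add: map_of_eq_Some_iff)

lemma mv_arity_nth:
  assumes "mv_arity \<Xi> M = Some ck"
  obtains i where "i < length \<Xi>" "fst (\<Xi> ! i) = M" "bdry_arity (snd (\<Xi> ! i)) = ck"
      "map_of \<Xi> M = Some (snd (\<Xi> ! i))"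
proof -
  obtain B where B: "map_of \<Xi> M = Some B" "bdry_arity B = ck"
    using assms by (auto simp: mv_arity_def)
  then obtain i where "i < length \<Xi>" "\<Xi> ! i = (M, B)"
    using map_of_SomeD in_set_conv_nth by metis
  with B that show thesis by auto
qed

lemma raw_mctx_distinct: "raw_mctx Sg \<Theta> \<Longrightarrow> distinct (map fst \<Theta>)"
  by (simp add: raw_mctx_def)

lemma wmor_inst:
  assumes "instantiates Sg \<Xi> \<Theta> \<Gamma> I" "distinct (map fst \<Xi>)"
  shows "wmor Sg (mv_arity \<Xi>) {} (mv_arity \<Theta>) (names \<Gamma>) (inst_morph I)"
  unfolding wmor_def
proof (intro conjI allI impI ballI)
  fix M c k assume "mv_arity \<Xi> M = Some (c, k)"
  then obtain i where i: "i < length \<Xi>" "fst (\<Xi> ! i) = M" "bdry_arity (snd (\<Xi> ! i)) = (c, k)"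
    by (rule mv_arity_nth)
  have "distinct (map fst I)" using assms by (simp add: instantiates_def)
  then have "map_of I M = Some (snd (I ! i))"
    using distinct_map_of_nth[of I i] instantiates_fst[OF assms(1) i(1)] i
        instantiates_length[OF assms(1)]
    by simp
  then show "case snd (inst_morph I) M of Ren M' \<Rightarrow> mv_arity \<Theta> M' = Some (c, k)
      | Ins e \<Rightarrow> wf_arg Sg (mv_arity \<Theta>) (names \<Gamma>) 0 (c, k) e"
    using assms(1) i unfolding instantiates_def by (auto simp: inst_morph_def)
qed simp

lemma instantiates_inst_act:
  assumes "instantiates Sg \<Xi> \<Theta> \<Gamma> I" "wmor Sg (mv_arity \<Theta>) (names \<Gamma>) (mv_arity \<Theta>') (names \<Gamma>') f"
  shows "instantiates Sg \<Xi> \<Theta>' \<Gamma>' (inst_act f I)"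
  using assms instantiates_length[OF assms(1)] unfolding instantiates_def by (auto intro: wf_sact)

lemma mv_arity_inst:
  assumes "instantiates Sg \<Xi> \<Theta> \<Gamma> I" "mv_arity \<Xi> M = Some ck"
  shows "\<exists>e. map_of I M = Some e"
proof -
  have "M \<in> set (map fst \<Xi>)"
    using assms(2) by (auto simp: mv_arity_def dest: map_of_SomeD intro: rev_image_eqI)
  then show ?thesis using assms(1) by (metis instantiates_def map_of_eq_None_iff not_None_eq set_map)
qed

text \<open>The composite of \<open>f\<close> with \<open>inst_morph I\<close> and the morphism of
  \<open>inst_act f I\<close> agree on the metavariables of \<open>\<Xi>\<close>, and a valid
  expression over \<open>\<Xi>\<close> without free variables sees only those.\<close>

lemma sact_inst:
  assumes "wf_arg Sg (mv_arity \<Xi>) {} n ck e" "instantiates Sg \<Xi> \<Theta> \<Gamma> I" "distinct (map fst \<Xi>)"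
    "wmor Sg (mv_arity \<Theta>) (names \<Gamma>) ar' V' f"
  shows "sact f (sact (inst_morph I) e) = sact (inst_morph (inst_act f I)) e"
proof -
  have "sact f (sact (inst_morph I) e) = sact (comp_morph f (inst_morph I)) e"
    using wf_sact_comp[OF assms(1) wmor_inst[OF assms(2,3)] assms(4)] .
  also have "\<dots> = sact (inst_morph (inst_act f I)) e"
    by (rule sact_cong[OF assms(1)])
      (use mv_arity_inst[OF assms(2)] in \<open>fastforce simp: comp_morph_def inst_morph_def\<close>)+
  finally show ?thesis .
qed

lemma sact_inst_bdry:
  assumes "wf_bdry Sg (mv_arity \<Xi>) {} n B" "instantiates Sg \<Xi> \<Theta> \<Gamma> I" "distinct (map fst \<Xi>)"
    "wmor Sg (mv_arity \<Theta>) (names \<Gamma>) ar' V' f"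
  shows "sact_bdry f (sact_bdry (inst_morph I) B) = sact_bdry (inst_morph (inst_act f I)) B"
  using assms(1)
proof (induction B arbitrary: n)
  case (Thesis b)
  then show ?case by (cases b) (auto intro: sact_inst[OF _ assms(2-4)])
qed (auto intro: sact_inst[OF _ assms(2-4)])

lemma sact_inst_jthesis:
  assumes "wf_jthesis Sg (mv_arity \<Xi>) {} n j" "instantiates Sg \<Xi> \<Theta> \<Gamma> I" "distinct (map fst \<Xi>)"
    "wmor Sg (mv_arity \<Theta>) (names \<Gamma>) ar' V' f"
  shows "map_jthesis (sact f) (map_jthesis (act I) j) = map_jthesis (act (inst_act f I)) j"
  using assms(1) by (cases j) (auto simp: act_sact intro: sact_inst[OF _ assms(2-4)])

lemma raw_mctx_nth: "raw_mctx Sg \<Xi> \<Longrightarrow> i < length \<Xi> \<Longrightarrow> wf_bdry Sg (mv_arity (take i \<Xi>)) {} 0 (snd (\<Xi> ! i))"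
  by (simp add: raw_mctx_def)

lemma raw_mctx_take: "raw_mctx Sg \<Xi> \<Longrightarrow> raw_mctx Sg (take n \<Xi>)"
  by (auto simp: raw_mctx_def take_map[symmetric] min_def)

lemma sact_premise_bdry:
  assumes "raw_mctx Sg \<Xi>" "instantiates Sg \<Xi> \<Theta> \<Gamma> I" "i < length \<Xi>"
    "wmor Sg (mv_arity \<Theta>) (names \<Gamma>) ar' V' f"
  shows "sact_bdry f (premise_bdry \<Xi> I i) = premise_bdry \<Xi> (inst_act f I) i"
  unfolding premise_bdry_def act_bdry_sact
  using sact_inst_bdry[OF raw_mctx_nth[OF assms(1,3)] instantiates_take[OF assms(2)] _ assms(4)]
    raw_mctx_distinct[OF raw_mctx_take[OF assms(1)]] by simp

lemma mv_arity_take: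
  assumes "distinct (map fst \<Xi>)" "mv_arity (take i \<Xi>) M = Some ck"
  shows "mv_arity \<Xi> M = Some ck"
proof -
  have "map_of \<Xi> M = Some B" if "map_of (take i \<Xi>) M = Some B" for B
    using that assms(1) by (auto dest!: map_of_SomeD in_set_takeD)
  then show ?thesis using assms(2) by (auto simp: mv_arity_def)
qed

lemma raw_mctx_nth': "raw_mctx Sg \<Xi> \<Longrightarrow> i < length \<Xi> \<Longrightarrow> wf_bdry Sg (mv_arity \<Xi>) {} 0 (snd (\<Xi> ! i))"
  using wf_bdry_mono[OF raw_mctx_nth] mv_arity_take raw_mctx_distinct by blast

lemma raw_mctx_map_of:
  assumes "raw_mctx Sg \<Xi>" "map_of \<Xi> M = Some B"
  shows "wf_bdry Sg (mv_arity \<Xi>) {} 0 B"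
proof -
  obtain i where "i < length \<Xi>" "\<Xi> ! i = (M, B)"
    using assms(2) map_of_SomeD in_set_conv_nth by metis
  then show ?thesis using raw_mctx_nth'[OF assms(1)] by fastforce
qed

text \<open>A boundary in a raw context mentions only earlier metavariables, on which
  \<open>take i I\<close> and \<open>I\<close> agree. Hence the premises at all positions are images
  under one and the same morphism.\<close>

lemma premise_bdry_full:
  assumes "raw_mctx Sg \<Xi>" "instantiates Sg \<Xi> \<Theta> \<Gamma> I" "i < length \<Xi>"
  shows "premise_bdry \<Xi> I i = sact_bdry (inst_morph I) (snd (\<Xi> ! i))"
  unfolding premise_bdry_def act_bdry_sact
proof (rule sact_bdry_cong)
  fix e assume "e \<in> exprs_bdry (snd (\<Xi> ! i))"
  then obtain n ck where wf: "wf_arg Sg (mv_arity (take i \<Xi>)) {} n ck e"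
    using wf_bdry_exprs[OF raw_mctx_nth[OF assms(1,3)]] by blast
  have d: "distinct (map fst I)"
    using assms by (simp add: instantiates_def raw_mctx_distinct)
  show "sact (inst_morph (take i I)) e = sact (inst_morph I) e"
  proof (rule sact_cong[OF wf])
    fix M c k assume M: "mv_arity (take i \<Xi>) M = Some (c, k)"
    obtain e' where e': "map_of (take i I) M = Some e'"
      using mv_arity_inst[OF instantiates_take[OF assms(2)] M] by blast
    then have "(M, e') \<in> set I" by (meson in_set_takeD map_of_SomeD)
    then have "map_of I M = Some e'" using d by simp
    with e' show "snd (inst_morph (take i I)) M = snd (inst_morph I) M" by (simp add: inst_morph_def)
  qed (simp add: inst_morph_def)
qed

lemma lc_generic_body: "lc n b \<Longrightarrow> bs (env (map BVar (rev [0..<n]))) b = b"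
proof -
  assume "lc n b"
  have "bs (env (map BVar (rev [0..<n]))) b = bs BVar b"
    by (rule bs_cong[OF \<open>lc n b\<close>]) (simp add: env_def rev_map)
  then show ?thesis by simp
qed

lemma sact_absn: "sact f ((Abs ^^ n) b) = (Abs ^^ n) (sact f b)"
  by (induction n) auto

text \<open>Variables are terms, symbols are of object class by \<open>is_signature\<close>, and
  metavariable applications are valid for object classes only, which leaves \<open>Star\<close> as
  the body.\<close>

lemma wf_arg_eq_Star:
  assumes "is_signature Sg" "wf_arg Sg ar V 0 (c, k) e" "c \<notin> {Ty, Tm}"
  shows "e = (Abs ^^ k) Star"
proof -
  obtain b where b: "e = (Abs ^^ k) b" "wf_arg Sg ar V k (c, 0) b"
    using wf_arg_absn[OF assms(2)] by auto
  from b(2) have "b = Star"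
    by cases (use assms in \<open>auto simp: is_signature_def\<close>)
  with b show ?thesis by simp
qed

text \<open>Applying an abstraction to its own bound variables returns its body; for an equational
  metavariable the iterated abstraction of \<open>Star\<close> is the only valid argument.\<close>

lemma sact_generic:
  assumes "is_signature Sg" "wf_arg Sg ar V 0 (bdry_arity B) e" "map_of I M = Some e"
  shows "sact (inst_morph I) (generic (M, B)) = e"
proof (cases "is_object B")
  case True
  obtain b where b: "e = (Abs ^^ depth B) b" "wf_arg Sg ar V (depth B) (bthesis_cls (core B), 0) b"
    using wf_arg_absn[of Sg ar V 0] assms(2) by (fastforce simp: bdry_arity_def)
  have "sact (inst_morph I) (generic (M, B)) = (Abs ^^ depth B)
      (apply_arg e (map BVar (rev [0..<depth B])))"
    using True assms(3) by (simp add: generic_def sact_absn inst_morph_def comp_def)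
  also have "apply_arg e (map BVar (rev [0..<depth B])) = b"
    using wf_arg_lc[OF b(2)] unfolding b(1) by (simp add: apply_arg_absn lc_generic_body)
  finally show ?thesis by (simp add: b(1))
next
  case False
  then have "e = (Abs ^^ depth B) Star"
    using wf_arg_eq_Star[OF assms(1), of ar V "bthesis_cls (core B)" "depth B" e] assms(2)
    by (auto simp: is_object_def is_object_thesis_def bdry_arity_def)
  then show ?thesis using False by (simp add: generic_def sact_absn)
qed

section \<open>Derivations\<close>

lemma wf_fill_thesis_D:
  "wf_jthesis Sg ar V n (fill_thesis b e) \<Longrightarrow> is_object_thesis b \<Longrightarrow> wf_arg Sg ar V n (bthesis_cls b, 0) e"
  by (cases b) (auto simp: is_object_thesis_def)

lemma wf_fill_thesis:
  "wf_bthesis Sg ar V n b \<Longrightarrow> wf_arg Sg ar V n (bthesis_cls b, 0) e \<Longrightarrow>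
      wf_jthesis Sg ar V n (fill_thesis b e)"
  by (cases b) auto

lemma wf_fill_thesis_eq:
  "wf_bthesis Sg ar V n b \<Longrightarrow> \<not> is_object_thesis b \<Longrightarrow> wf_jthesis Sg ar V n (fill_thesis b e)"
  by (cases b) (auto simp: is_object_thesis_def)

lemma wf_fill_eq_thesis:
  "wf_bthesis Sg ar V n b \<Longrightarrow> wf_arg Sg ar V n (bthesis_cls b, 0) e \<Longrightarrow>
      wf_arg Sg ar V n (bthesis_cls b, 0) e' \<Longrightarrow>
   wf_jthesis Sg ar V n (fill_eq_thesis b e e')"
  by (cases b) auto

lemma map_of_snoc: "a \<notin> names \<Gamma> \<Longrightarrow> map_of (\<Gamma> @ [(a, A)]) b = (if b = a then Some A else map_of \<Gamma> b)"
  by (induction \<Gamma>) auto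

lemma names_snoc [simp]: "names (\<Gamma> @ [(a, A)]) = insert a (names \<Gamma>)"
  by auto

lemma ext_snoc: "a \<notin> names \<Gamma> \<Longrightarrow> map_of \<Gamma> \<subseteq>\<^sub>m map_of (\<Gamma> @ [(a, A)])"
  by (auto simp: map_le_def map_of_snoc dom_map_of_conv_image_fst simp del: map_of_append)

lemma ext_names: "map_of \<Gamma> \<subseteq>\<^sub>m map_of \<Delta> \<Longrightarrow> names \<Gamma> \<subseteq> names \<Delta>"
  by (metis dom_map_of_conv_image_fst map_le_implies_dom_le set_map)

lemma ext_lookup: "map_of \<Gamma> \<subseteq>\<^sub>m map_of \<Delta> \<Longrightarrow> map_of \<Gamma> a = Some A \<Longrightarrow> map_of \<Delta> a = Some A"
  by (metis domI map_le_def)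

lemma ext_snoc_lookup: "map_of (\<Gamma> @ [(a, A)]) \<subseteq>\<^sub>m map_of \<Delta> \<Longrightarrow> a \<notin> names \<Gamma> \<Longrightarrow> map_of \<Delta> a = Some A"
  using ext_lookup map_of_snoc by metis

lemma raw_vctx_Nil [simp]: "raw_vctx Sg \<Theta> []"
  by (simp add: raw_vctx_def)

lemma raw_vctx_snoc:
  assumes "raw_vctx Sg \<Theta> \<Gamma>" "a \<notin> names \<Gamma>" "wf_arg Sg (mv_arity \<Theta>) (names \<Gamma>) 0 (Ty, 0) A"
  shows "raw_vctx Sg \<Theta> (\<Gamma> @ [(a, A)])"
  using assms unfolding raw_vctx_def by (auto simp: nth_append less_Suc_eq)

lemma raw_vctx_lookup:
  assumes "raw_vctx Sg \<Theta> \<Gamma>" "map_of \<Gamma> a = Some A"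
  shows "wf_arg Sg (mv_arity \<Theta>) (names \<Gamma>) 0 (Ty, 0) A"
proof -
  obtain i where i: "i < length \<Gamma>" "\<Gamma> ! i = (a, A)"
    using assms(2) map_of_SomeD in_set_conv_nth by metis
  then have "wf_arg Sg (mv_arity \<Theta>) (names (take i \<Gamma>)) 0 (Ty, 0) A"
    using assms(1) by (auto simp: raw_vctx_def)
  then show ?thesis
    by (rule wf_arg_mono) (auto dest: in_set_takeD)
qed

lemma lookup_names: "map_of \<Gamma> a = Some A \<Longrightarrow> a \<in> names \<Gamma>"
  by (auto dest!: map_of_SomeD intro: rev_image_eqI)

lemma wf_instance:
  assumes "raw_rule Sg (\<Xi>, J)" "instantiates Sg \<Xi> \<Theta> \<Gamma> I"
  shows "wf_jthesis Sg (mv_arity \<Theta>) (names \<Gamma>) 0 (map_jthesis (act I) J)"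
proof -
  have "wf_jdg Sg (mv_arity \<Xi>) {} 0 (Thesis J)"
    using assms(1) by (simp add: raw_rule_def)
  moreover have "distinct (map fst \<Xi>)"
    using assms(1) by (simp add: raw_rule_def raw_mctx_def)
  ultimately show ?thesis
    using wf_sact_jdg[OF _ wmor_inst[OF assms(2)]] by (fastforce simp: map_act_jthesis)
qed

section \<open>Derivable judgements of a raw type theory are valid expressions\<close>

locale raw_tt =
  fixes Sg :: "'s signature" and T :: "'s rul set"
  assumes raw: "raw_theory Sg T"
begin

abbreviation D where "D \<equiv> deriv Sg T"

abbreviation DT where "DT \<Theta> \<Gamma> j \<equiv> D \<Theta> \<Gamma> (Thesis j)"

abbreviation DB where "DB \<equiv> deriv_bdry Sg T"

abbreviation wfe where "wfe \<Theta> \<Gamma> \<equiv> wf_arg Sg (mv_arity \<Theta>) (names \<Gamma>) 0"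

abbreviation wfm where
  "wfm \<Theta> \<Gamma> \<Theta>' \<Gamma>' \<equiv> wmor Sg (mv_arity \<Theta>) (names \<Gamma>) (mv_arity \<Theta>') (names \<Gamma>')"

abbreviation premise :: "'s mctx \<Rightarrow> 's inst \<Rightarrow> nat \<Rightarrow> 's jdg" where
  "premise \<Xi> I i \<equiv> fill (premise_bdry \<Xi> I i) (snd (I ! i))"

definition tys :: "'s mctx \<Rightarrow> 's vctx \<Rightarrow> 's expr list \<Rightarrow> 's expr list \<Rightarrow> bool" where
  "tys \<Theta> \<Gamma> As ts \<longleftrightarrow> list_all2 (\<lambda>t A. DT \<Theta> \<Gamma> (HasTy t A)) ts As"

definition eqs :: "'s mctx \<Rightarrow> 's vctx \<Rightarrow> 's expr list \<Rightarrow> 's expr list \<Rightarrow> 's expr list \<Rightarrow> bool" where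
  "eqs \<Theta> \<Gamma> As ss ts \<longleftrightarrow> list_all2 (\<lambda>(s, t) A. DT \<Theta> \<Gamma> (JEqTm s t A)) (zip ss ts) As"

lemma raw_sig: "is_signature Sg"
  using raw by (simp add: raw_theory_def)

lemma raw_rule: "R \<in> T \<Longrightarrow> raw_rule Sg R"
  using raw by (simp add: raw_theory_def)

text \<open>Among the rules of \<open>deriv\<close> only those with instantiations impose validity,
  so in general it has to be recovered by induction, over valid contexts. For an abstraction the
  opened body is valid and is closed again by \<open>wf_jdg_subst_FVar_D\<close>.\<close>

lemma deriv_wf:
  "D \<Theta> \<Gamma> J \<Longrightarrow> raw_mctx Sg \<Theta> \<Longrightarrow> raw_vctx Sg \<Theta> \<Gamma> \<Longrightarrow> wf_jdg Sg (mv_arity \<Theta>) (names \<Gamma>) 0 J"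
proof (induction rule: deriv.induct)
  case (d_var \<Gamma> a A \<Theta>)
  then show ?case using lookup_names[of \<Gamma> a A] raw_vctx_lookup[of Sg \<Theta> \<Gamma> a A]
    by (auto intro: wf_arg.intros)
next
  case (d_meta \<Theta> M B ts \<Gamma>)
  have ts: "\<forall>t\<in>set ts. wfe \<Theta> \<Gamma> (Tm, 0) t"
    using d_meta.IH d_meta.prems by (auto simp: in_set_conv_nth)
  have "wf_bdry Sg (mv_arity \<Theta>) (names \<Gamma>) 0 B"
    by (rule wf_bdry_mono[OF raw_mctx_map_of]) (use d_meta in auto)
  then have b: "wf_bthesis Sg (mv_arity \<Theta>) (names \<Gamma>) 0 (apply_bdry B ts)"
    using wf_apply_bdry ts d_meta by blast
  show ?case
  proof (cases "is_object B")
    case True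
    have "wfe \<Theta> \<Gamma> (bthesis_cls (core B), 0) (MvApp M ts)"
      by (rule wf_MvApp[where k = "length ts"])
        (use ts d_meta True in \<open>auto simp: mv_arity_def bdry_arity_def is_object_def
            is_object_thesis_def\<close>)
    then show ?thesis using b by (auto intro: wf_fill_thesis)
  next
    case False
    then show ?thesis using b by (auto intro: wf_fill_thesis_eq simp: is_object_apply_bdry)
  qed
next
  case (d_meta_congr \<Theta> M B ss ts \<Gamma>)
  have ss: "\<forall>t\<in>set ss. wfe \<Theta> \<Gamma> (Tm, 0) t"
    using d_meta_congr by (auto simp: in_set_conv_nth)
  have ts: "\<forall>t\<in>set ts. wfe \<Theta> \<Gamma> (Tm, 0) t"
    using d_meta_congr by (auto simp: in_set_conv_nth)
  have "wf_bdry Sg (mv_arity \<Theta>) (names \<Gamma>) 0 B"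
    by (rule wf_bdry_mono[OF raw_mctx_map_of]) (use d_meta_congr in auto)
  then have b: "wf_bthesis Sg (mv_arity \<Theta>) (names \<Gamma>) 0 (apply_bdry B ss)"
    using wf_apply_bdry ss d_meta_congr by blast
  have "wfe \<Theta> \<Gamma> (bthesis_cls (core B), 0) (MvApp M us)"
    if "\<forall>t\<in>set us. wfe \<Theta> \<Gamma> (Tm, 0) t" "length us = depth B" for us
    by (rule wf_MvApp[where k = "length us"])
      (use that d_meta_congr in \<open>auto simp: mv_arity_def bdry_arity_def is_object_def
          is_object_thesis_def\<close>)
  then show ?case using b ss ts d_meta_congr by (auto intro: wf_fill_eq_thesis)
next
  case (d_abstr \<Theta> \<Gamma> A a J)
  then have "raw_vctx Sg \<Theta> (\<Gamma> @ [(a, A)])" by (auto intro: raw_vctx_snoc)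
  then have "wf_jdg Sg (mv_arity \<Theta>) (insert a (names \<Gamma>)) 0 (subst_jdg 0 (FVar a) J)"
    using d_abstr by (simp only: names_snoc)
  then show ?case using d_abstr by (auto dest: wf_jdg_subst_FVar_D)
next
  case (d_rule \<Xi> J \<Theta> \<Gamma> I)
  then show ?case using wf_instance[OF raw_rule] by auto
next
  case (d_rule_congr \<Xi> b e \<Theta> \<Gamma> I I')
  have "wf_jthesis Sg (mv_arity \<Theta>) (names \<Gamma>) 0 (fill_thesis (map_bthesis (act I) b) (act I e))"
    "wf_jthesis Sg (mv_arity \<Theta>) (names \<Gamma>) 0 (fill_thesis (map_bthesis (act I') b) (act I' e))"
    using wf_instance[OF raw_rule] d_rule_congr by (metis map_fill_thesis)+
  then show ?case using d_rule_congr.hyps(2) by (cases b) (auto simp: is_object_thesis_def)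
qed auto

section \<open>Morphisms of contexts and their action on derivations\<close>

text \<open>The conditions on variables and metavariables are imposed in all extensions \<open>\<Delta>\<close> of the target,
  which makes passing under binders immediate. Metavariables are required to act correctly on all
  typed arguments, rather than to be mapped to derivable abstractions: passing from the latter to the
  former is itself an instance of substitution.\<close>

definition mor :: "'s mctx \<Rightarrow> 's vctx \<Rightarrow> 's mctx \<Rightarrow> 's vctx \<Rightarrow> 's morph \<Rightarrow> bool" where
  "mor \<Theta> \<Gamma> \<Theta>' \<Gamma>' f \<longleftrightarrow> raw_mctx Sg \<Theta>' \<and> raw_vctx Sg \<Theta>' \<Gamma>' \<and>
     wfm \<Theta> \<Gamma> \<Theta>' \<Gamma>' f \<and>
     (\<forall>\<Delta>. map_of \<Gamma>' \<subseteq>\<^sub>m map_of \<Delta> \<longrightarrow> raw_vctx Sg \<Theta>' \<Delta> \<longrightarrow>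
        (\<forall>a A. map_of \<Gamma> a = Some A \<longrightarrow> DT \<Theta>' \<Delta> (HasTy (fst f a) (sact f A))) \<and>
        (\<forall>M B ts. map_of \<Theta> M = Some B \<longrightarrow> length ts = depth B \<longrightarrow>
           tys \<Theta>' \<Delta> (arg_types (sact_bdry f B) ts) ts \<longrightarrow>
           DT \<Theta>' \<Delta> (fill_thesis (apply_bdry (sact_bdry f B) ts) (mapp (snd f M) ts))) \<and>
        (\<forall>M B ss ts. map_of \<Theta> M = Some B \<longrightarrow> is_object B \<longrightarrow> length ss = depth B \<longrightarrow> length ts = depth B \<longrightarrow>
           tys \<Theta>' \<Delta> (arg_types (sact_bdry f B) ss) ss \<longrightarrow>
           tys \<Theta>' \<Delta> (arg_types (sact_bdry f B) ts) ts \<longrightarrow>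
           eqs \<Theta>' \<Delta> (arg_types (sact_bdry f B) ss) ss ts \<longrightarrow>
           DT \<Theta>' \<Delta> (fill_eq_thesis (apply_bdry (sact_bdry f B) ss)
             (mapp (snd f M) ss) (mapp (snd f M) ts))))"

lemma mor_wmor: "mor \<Theta> \<Gamma> \<Theta>' \<Gamma>' f \<Longrightarrow> wfm \<Theta> \<Gamma> \<Theta>' \<Gamma>' f"
  by (auto simp: mor_def)

lemma wmor_ext:
  assumes "wmor Sg ar V ar' V' f" "V' \<subseteq> V''"
  shows "wmor Sg ar V ar' V'' f"
  unfolding wmor_def
proof (intro conjI ballI allI impI)
  fix a assume "a \<in> V"
  then show "wf_arg Sg ar' V'' 0 (Tm, 0) (fst f a)"
    using assms wf_arg_mono[of Sg ar' V' 0 "(Tm, 0)" "fst f a" V'' ar'] by (auto simp: wmor_def)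
next
  fix M c k assume "ar M = Some (c, k)"
  with assms(1) show "case snd f M of Ren M' \<Rightarrow> ar' M' = Some (c, k) | Ins e \<Rightarrow> wf_arg Sg ar' V'' 0
      (c, k) e"
    using assms(2) wf_arg_mono[of Sg ar' V' 0 "(c, k)" _ V'' ar']
    by (auto simp: wmor_def split: mval.splits)
qed

lemma mor_ext: "mor \<Theta> \<Gamma> \<Theta>' \<Gamma>' f \<Longrightarrow> map_of \<Gamma>' \<subseteq>\<^sub>m map_of \<Delta> \<Longrightarrow> raw_vctx Sg \<Theta>' \<Delta> \<Longrightarrow> mor \<Theta> \<Gamma> \<Theta>' \<Delta> f"
  unfolding mor_def by (meson ext_names map_le_trans wmor_ext)

lemma wmor_upd:
  assumes "wmor Sg ar V ar' V' f" "wf_arg Sg ar' V' 0 (Tm, 0) u"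
  shows "wmor Sg ar (insert a V) ar' V' (upd f a u)"
  using assms by (auto simp: wmor_def upd_def)

lemma sact_bdry_upd_closed: "wf_bdry Sg ar {} n B \<Longrightarrow> sact_bdry (upd f a u) B = sact_bdry f B"
  using wf_bdry_fv[of Sg ar "{}" n B]
  by (intro sact_bdry_cong sact_upd) (auto simp: fv_bdry_exprs)

text \<open>The typing of \<open>u\<close> is assumed in all extensions because \<open>mor\<close>
  quantifies over them and weakening is itself a consequence of \<open>deriv_mor\<close>.\<close>

lemma mor_upd:
  assumes m: "mor \<Theta> \<Gamma> \<Theta>' \<Gamma>' f" and r: "raw_mctx Sg \<Theta>" "raw_vctx Sg \<Theta> \<Gamma>"
    and A: "wfe \<Theta> \<Gamma> (Ty, 0) A" and a: "a \<notin> names \<Gamma>"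
    and \<Delta>: "map_of \<Gamma>' \<subseteq>\<^sub>m map_of \<Delta>" "raw_vctx Sg \<Theta>' \<Delta>"
    and u: "\<And>\<Delta>'. map_of \<Delta> \<subseteq>\<^sub>m map_of \<Delta>' \<Longrightarrow> raw_vctx Sg \<Theta>' \<Delta>' \<Longrightarrow>
      DT \<Theta>' \<Delta>' (HasTy u (sact f A))"
  shows "mor \<Theta> (\<Gamma> @ [(a, A)]) \<Theta>' \<Delta> (upd f a u)"
proof -
  have m': "mor \<Theta> \<Gamma> \<Theta>' \<Delta> f" by (rule mor_ext[OF m \<Delta>])
  have "wf_jdg Sg (mv_arity \<Theta>') (names \<Delta>) 0 (Thesis (HasTy u (sact f A)))"
    using deriv_wf[OF u[OF map_le_refl \<Delta>(2)] _ \<Delta>(2)] m by (auto simp: mor_def)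
  then have "wmor Sg (mv_arity \<Theta>) (insert a (names \<Gamma>)) (mv_arity \<Theta>') (names \<Delta>) (upd f a u)"
    using m' by (intro wmor_upd) (auto simp: mor_def)
  moreover have "sact (upd f a u) A = sact f A"
    using wf_arg_fv[OF A] a by (intro sact_upd) auto
  moreover have "sact (upd f a u) B = sact f B" if "map_of \<Gamma> b = Some B" for b B
    using wf_arg_fv[OF raw_vctx_lookup[OF r(2) that]] a by (intro sact_upd) auto
  moreover have "sact_bdry (upd f a u) B = sact_bdry f B" if "map_of \<Theta> M = Some B" for M B
    using sact_bdry_upd_closed[OF raw_mctx_map_of[OF r(1) that]] .
  moreover have "fst (upd f a u) b = (if b = a then u else fst f b)" "snd (upd f a u) = snd f" for b
    by (auto simp: upd_def)
  ultimately show ?thesis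
    using m' u a unfolding mor_def names_snoc
    by (simp add: map_of_snoc del: map_of_append)
qed

lemma fresh: "finite S \<Longrightarrow> \<exists>b::nat. b \<notin> S"
  by (rule ex_new_if_finite) auto

lemma wf_map_of_bdry: "raw_mctx Sg \<Theta> \<Longrightarrow> map_of \<Theta> M = Some B \<Longrightarrow> wf_bdry Sg (mv_arity \<Theta>) V 0 B"
  by (rule wf_bdry_mono[OF raw_mctx_map_of]) auto

lemma tys_nth: "tys \<Theta> \<Gamma> As ts \<longleftrightarrow> length As = length ts \<and>
    (\<forall>j<length ts. DT \<Theta> \<Gamma> (HasTy (ts ! j) (As ! j)))"
  by (auto simp: tys_def list_all2_conv_all_nth)

lemma eqs_nth: "length ss = length ts \<Longrightarrow> eqs \<Theta> \<Gamma> As ss ts \<longleftrightarrow> length As = length ts \<and>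
    (\<forall>j<length ts. DT \<Theta> \<Gamma> (JEqTm (ss ! j) (ts ! j) (As ! j)))"
  by (auto simp: eqs_def list_all2_conv_all_nth)

lemma fill_premise_wf:
  assumes "instantiates Sg \<Xi> \<Theta> \<Gamma> I" "i < length \<Xi>"
  shows "nabs (depth (premise_bdry \<Xi> I i)) (snd (I ! i))"
    "wfe \<Theta> \<Gamma> (bdry_arity (premise_bdry \<Xi> I i)) (snd (I ! i))"
proof -
  show w: "wfe \<Theta> \<Gamma> (bdry_arity (premise_bdry \<Xi> I i)) (snd (I ! i))"
    using assms by (simp add: instantiates_def premise_bdry_def act_bdry_sact)
  show "nabs (depth (premise_bdry \<Xi> I i)) (snd (I ! i))"
    by (rule wf_arg_bdry_nabs[OF w])
qed

lemma sact_fill_premise: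
  assumes "raw_mctx Sg \<Xi>" "instantiates Sg \<Xi> \<Theta> \<Gamma> I" "i < length \<Xi>" "mor \<Theta> \<Gamma> \<Theta>' \<Gamma>' f"
  shows "sact_jdg f (premise \<Xi> I i) =
    fill (premise_bdry \<Xi> (inst_act f I) i) (snd (inst_act f I ! i))"
  using assms instantiates_length[OF assms(2)]
  by (subst sact_fill) (auto simp: fill_premise_wf sact_premise_bdry mor_def)

lemma inst_mor:
  assumes "instantiates Sg \<Xi> \<Theta> \<Gamma> I" "mor \<Theta> \<Gamma> \<Theta>' \<Gamma>' f"
  shows "instantiates Sg \<Xi> \<Theta>' \<Gamma>' (inst_act f I)"
  using assms by (auto simp: mor_def intro: instantiates_inst_act)

text \<open>Variables and metavariables are covered by the clauses of \<open>mor\<close>, and the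
  instantiation in a rule instance is composed with \<open>f\<close>. Weakening, substitution,
  instantiation and promotion are all obtained by choosing \<open>f\<close>.\<close>

theorem deriv_mor:
  "D \<Theta> \<Gamma> J \<Longrightarrow> raw_mctx Sg \<Theta> \<Longrightarrow> raw_vctx Sg \<Theta> \<Gamma> \<Longrightarrow> mor \<Theta> \<Gamma> \<Theta>' \<Gamma>' f \<Longrightarrow> D \<Theta>' \<Gamma>' (sact_jdg f J)"
proof (induction arbitrary: \<Gamma>' f rule: deriv.induct)
  case (d_var \<Gamma> a A \<Theta>)
  then show ?case by (auto simp: mor_def)
next
  case (d_meta \<Theta> M B ts \<Gamma>)
  have ts: "\<forall>t\<in>set ts. wfe \<Theta> \<Gamma> (Tm, 0) t"
    using d_meta deriv_wf by (fastforce simp: in_set_conv_nth)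
  note w = sact_apply_bdry[OF wf_map_of_bdry[OF d_meta.prems(1) d_meta.hyps(1)] _ ts]
  have "map_bthesis (sact f) (apply_bdry B ts) = apply_bdry (sact_bdry f B) (map (sact f) ts)"
    and at: "map (sact f) (arg_types B ts) = arg_types (sact_bdry f B) (map (sact f) ts)"
    using w d_meta.prems(3) unfolding mor_def by blast+
  moreover have "tys \<Theta>' \<Gamma>' (arg_types (sact_bdry f B) (map (sact f) ts)) (map (sact f) ts)"
    unfolding at[symmetric] using d_meta.IH d_meta.hyps d_meta.prems
    by (simp add: tys_nth length_arg_types del: split_paired_All)
  ultimately show ?case
    using d_meta.prems d_meta.hyps unfolding mor_def by (auto simp: map_fill_thesis)
next
  case (d_meta_congr \<Theta> M B ss ts \<Gamma>)
  have ss: "\<forall>t\<in>set ss. wfe \<Theta> \<Gamma> (Tm, 0) t"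
    using d_meta_congr deriv_wf by (fastforce simp: in_set_conv_nth)
  have ts: "\<forall>t\<in>set ts. wfe \<Theta> \<Gamma> (Tm, 0) t"
    using d_meta_congr deriv_wf by (fastforce simp: in_set_conv_nth)
  have m: "wfm \<Theta> \<Gamma> \<Theta>' \<Gamma>' f"
    using d_meta_congr.prems(3) by (simp add: mor_def)
  note ws = sact_apply_bdry[OF wf_map_of_bdry[OF d_meta_congr.prems(1) d_meta_congr.hyps(1)] m ss]
  note wt = sact_apply_bdry[OF wf_map_of_bdry[OF d_meta_congr.prems(1) d_meta_congr.hyps(1)] m ts]
  note as = ws[THEN conjunct2, symmetric]
  note at = wt[THEN conjunct2, symmetric]
  have "tys \<Theta>' \<Gamma>' (arg_types (sact_bdry f B) (map (sact f) ss)) (map (sact f) ss)"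
    unfolding as using d_meta_congr.IH d_meta_congr.hyps d_meta_congr.prems
    by (simp add: tys_nth length_arg_types del: split_paired_All)
  moreover have "tys \<Theta>' \<Gamma>' (arg_types (sact_bdry f B) (map (sact f) ts)) (map (sact f) ts)"
    unfolding at using d_meta_congr.IH d_meta_congr.hyps d_meta_congr.prems
    by (simp add: tys_nth length_arg_types del: split_paired_All)
  moreover have "eqs \<Theta>' \<Gamma>' (arg_types (sact_bdry f B) (map (sact f) ss)) (map (sact f) ss)
      (map (sact f) ts)"
    unfolding as using d_meta_congr.IH d_meta_congr.hyps d_meta_congr.prems
    by (simp add: eqs_nth length_arg_types del: split_paired_All)
  ultimately show ?case
    using d_meta_congr.prems d_meta_congr.hyps ws unfolding mor_def by (auto simp: map_fill_eq_thesis)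
next
  case (d_abstr \<Theta> \<Gamma> A a J)
  define A' J' where "A' = sact f A" and "J' = sact_jdg f J"
  \<comment> \<open>\<open>a\<close> is known to be fresh for the source only, so the image is
    opened with another variable \<open>b\<close>, and \<open>f\<close> is extended by sending
    \<open>a\<close> to it.\<close>
  obtain b where b: "b \<notin> names \<Gamma>' \<union> fv A' \<union> fv_jdg J'"
    using fresh[of "names \<Gamma>' \<union> fv A' \<union> fv_jdg J'"] by auto
  have A': "DT \<Theta>' \<Gamma>' (IsTy A')"
    using d_abstr.IH(1) d_abstr.prems by (auto simp: A'_def)
  have r: "raw_mctx Sg \<Theta>'" "raw_vctx Sg \<Theta>' \<Gamma>'" using d_abstr.prems by (auto simp: mor_def)
  have wA: "wfe \<Theta> \<Gamma> (Ty, 0) A"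
    using deriv_wf[OF d_abstr.hyps(1)] d_abstr.prems by auto
  have r2: "raw_vctx Sg \<Theta> (\<Gamma> @ [(a, A)])"
    using raw_vctx_snoc wA d_abstr by blast
  have r': "raw_vctx Sg \<Theta>' (\<Gamma>' @ [(b, A')])"
    using raw_vctx_snoc[OF r(2)] deriv_wf[OF A' r] b by auto
  have f': "mor \<Theta> (\<Gamma> @ [(a, A)]) \<Theta>' (\<Gamma>' @ [(b, A')]) (upd f a (FVar b))"
    by (rule mor_upd[OF d_abstr.prems(3,1,2) wA d_abstr.hyps(2) ext_snoc r'])
      (use b in \<open>auto simp: A'_def[symmetric] intro!: d_var ext_snoc_lookup simp del: map_of_append\<close>)
  have wJ: "wf_jdg Sg (mv_arity \<Theta>) (names \<Gamma>) (Suc 0) J"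
    using deriv_wf[OF d_abstr.hyps(4)] d_abstr r2 by (intro wf_jdg_subst_FVar_D) auto
  have "D \<Theta>' (\<Gamma>' @ [(b, A')]) (sact_jdg (upd f a (FVar b)) (subst_jdg 0 (FVar a) J))"
    using d_abstr.IH(2)[OF d_abstr.prems(1) r2 f'] .
  also have "sact_jdg (upd f a (FVar b)) (subst_jdg 0 (FVar a) J) = subst_jdg 0 (FVar b) J'"
    unfolding J'_def by (rule sact_jdg_upd_subst[OF wJ]) (use d_abstr in \<open>auto simp: mor_def\<close>)
  finally show ?case
    using A' b by (auto simp: A'_def[symmetric] J'_def[symmetric] intro!: deriv.d_abstr[of _ _ _ _ _ b])
next
  case (d_rule \<Xi> J \<Theta> \<Gamma> I)
  have \<Xi>: "raw_mctx Sg \<Xi>" "wf_jthesis Sg (mv_arity \<Xi>) {} 0 J"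
    using raw_rule[OF d_rule.hyps(1)] by (auto simp: raw_rule_def)
  have "map_jthesis (sact f) (map_jthesis (act I) J) = map_jthesis (act (inst_act f I)) J"
    using sact_inst_jthesis[OF \<Xi>(2) d_rule.hyps(2) raw_mctx_distinct[OF \<Xi>(1)]
        mor_wmor[OF d_rule.prems(3)]] .
  moreover have "\<forall>i<length \<Xi>. D \<Theta>' \<Gamma>' (fill (premise_bdry \<Xi> (inst_act f I) i) (snd (inst_act f I ! i)))"
    using d_rule.IH d_rule.prems sact_fill_premise[OF \<Xi>(1) d_rule.hyps(2)] by metis
  ultimately show ?case
    using deriv.d_rule[OF d_rule.hyps(1) inst_mor[OF d_rule.hyps(2) d_rule.prems(3)]] by simp
next
  case (d_rule_congr \<Xi> b e \<Theta> \<Gamma> I I')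
  have \<Xi>: "raw_mctx Sg \<Xi>" "wf_jthesis Sg (mv_arity \<Xi>) {} 0 (fill_thesis b e)"
    using raw_rule[OF d_rule_congr.hyps(1)] by (auto simp: raw_rule_def)
  have d: "distinct (map fst \<Xi>)" by (rule raw_mctx_distinct[OF \<Xi>(1)])
  have m: "wfm \<Theta> \<Gamma> \<Theta>' \<Gamma>' f"
    using d_rule_congr.prems(3) by (simp add: mor_def)
  note si = sact_inst_jthesis[OF \<Xi>(2) d_rule_congr.hyps(3) d m]
  note si' = sact_inst_jthesis[OF \<Xi>(2) d_rule_congr.hyps(4) d m]
  have "map_jthesis (sact f) (fill_eq_thesis (map_bthesis (act I) b) (act I e) (act I' e)) =
      fill_eq_thesis (map_bthesis (act (inst_act f I)) b) (act (inst_act f I) e)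
          (act (inst_act f I') e)"
    using d_rule_congr.hyps(2) si si' by (cases b) (auto simp: is_object_thesis_def)
  moreover have "\<forall>i<length \<Xi>. D \<Theta>' \<Gamma>' (fill (premise_bdry \<Xi> (inst_act f I) i) (snd (inst_act f I ! i)))"
    using d_rule_congr.IH(1) d_rule_congr.prems sact_fill_premise[OF \<Xi>(1) d_rule_congr.hyps(3)] by metis
  moreover have "\<forall>i<length \<Xi>. D \<Theta>' \<Gamma>'
      (fill (premise_bdry \<Xi> (inst_act f I') i) (snd (inst_act f I' ! i)))"
    using d_rule_congr.IH(2) d_rule_congr.prems sact_fill_premise[OF \<Xi>(1) d_rule_congr.hyps(4)] by metis
  moreover have "\<forall>i<length \<Xi>. is_object (snd (\<Xi> ! i)) \<longrightarrow>
      D \<Theta>' \<Gamma>' (fill_eq (premise_bdry \<Xi> (inst_act f I) i)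
      (snd (inst_act f I ! i)) (snd (inst_act f I' ! i)))"
  proof (intro allI impI)
    fix i assume i: "i < length \<Xi>" "is_object (snd (\<Xi> ! i))"
    have "D \<Theta>' \<Gamma>' (sact_jdg f (fill_eq (premise_bdry \<Xi> I i) (snd (I ! i)) (snd (I' ! i))))"
      using d_rule_congr.IH(3) d_rule_congr.prems i by blast
    moreover have "nabs (depth (premise_bdry \<Xi> I i)) (snd (I' ! i))"
      using fill_premise_wf(1)[OF d_rule_congr.hyps(4) i(1)]
      by (simp add: premise_bdry_def act_bdry_sact)
    ultimately show "D \<Theta>' \<Gamma>' (fill_eq (premise_bdry \<Xi> (inst_act f I) i)
        (snd (inst_act f I ! i)) (snd (inst_act f I' ! i)))"
      using i fill_premise_wf(1)[OF d_rule_congr.hyps(3) i(1)]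
        sact_premise_bdry[OF \<Xi>(1) d_rule_congr.hyps(3) i(1) m]
        instantiates_length[OF d_rule_congr.hyps(3)] instantiates_length[OF d_rule_congr.hyps(4)]
      by (simp add: sact_fill_eq)
  qed
  ultimately show ?case
    using deriv.d_rule_congr[OF d_rule_congr.hyps(1,2)
        inst_mor[OF d_rule_congr.hyps(3) d_rule_congr.prems(3)]
        inst_mor[OF d_rule_congr.hyps(4) d_rule_congr.prems(3)]] by simp
next
  case (d_ty_trans \<Theta> \<Gamma> A B C)
  show ?case
    using deriv.d_ty_trans[of Sg T \<Theta>' \<Gamma>' "sact f A" "sact f B" "sact f C"]
      d_ty_trans.IH[OF d_ty_trans.prems] by simp
next
  case (d_tm_trans \<Theta> \<Gamma> s t A u)
  show ?case
    using deriv.d_tm_trans[of Sg T \<Theta>' \<Gamma>' "sact f s" "sact f t" "sact f A" "sact f u"]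
      d_tm_trans.IH[OF d_tm_trans.prems] by simp
next
  case (d_conv_tm \<Theta> \<Gamma> t A B)
  show ?case
    using deriv.d_conv_tm[of Sg T \<Theta>' \<Gamma>' "sact f t" "sact f A" "sact f B"]
      d_conv_tm.IH[OF d_conv_tm.prems] by simp
next
  case (d_conv_eq \<Theta> \<Gamma> s t A B)
  show ?case
    using deriv.d_conv_eq[of Sg T \<Theta>' \<Gamma>' "sact f s" "sact f t" "sact f A" "sact f B"]
      d_conv_eq.IH[OF d_conv_eq.prems] by simp
qed (auto intro: d_ty_refl d_ty_sym d_tm_refl d_tm_sym)

section \<open>Weakening and substitution\<close>

lemma wmor_id:
  assumes "V \<subseteq> V'" "\<And>M ck. ar M = Some ck \<Longrightarrow> ar' M = Some ck"
  shows "wmor Sg ar V ar' V' id_morph"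
  using assms by (auto simp: wmor_def intro: wf_arg.intros)

lemma mv_arity_ext: "map_of \<Theta> \<subseteq>\<^sub>m map_of \<Theta>' \<Longrightarrow> mv_arity \<Theta> M = Some ck \<Longrightarrow> mv_arity \<Theta>' M = Some ck"
  by (auto simp: mv_arity_def dest: ext_lookup)

lemma mor_id:
  assumes "raw_mctx Sg \<Theta>'" "raw_vctx Sg \<Theta>' \<Gamma>'" "map_of \<Theta> \<subseteq>\<^sub>m map_of \<Theta>'" "map_of \<Gamma> \<subseteq>\<^sub>m map_of \<Gamma>'"
  shows "mor \<Theta> \<Gamma> \<Theta>' \<Gamma>' id_morph"
  unfolding mor_def
proof (intro conjI allI impI)
  show "wfm \<Theta> \<Gamma> \<Theta>' \<Gamma>' id_morph"
    using wmor_id[OF ext_names[OF assms(4)] mv_arity_ext[OF assms(3)]] .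
next
  fix \<Delta> M B ts
  assume "map_of \<Theta> M = Some B" "length ts = depth B"
    "tys \<Theta>' \<Delta> (arg_types (sact_bdry id_morph B) ts) ts"
  then show "DT \<Theta>' \<Delta> (fill_thesis (apply_bdry (sact_bdry id_morph B) ts) (mapp (snd id_morph M) ts))"
    using ext_lookup[OF assms(3)] by (auto simp: tys_nth intro!: d_meta)
next
  fix \<Delta> M B ss ts
  assume "map_of \<Theta> M = Some B" "is_object B" "length ss = depth B" "length ts = depth B"
    "tys \<Theta>' \<Delta> (arg_types (sact_bdry id_morph B) ss) ss"
    "tys \<Theta>' \<Delta> (arg_types (sact_bdry id_morph B) ts) ts"
    "eqs \<Theta>' \<Delta> (arg_types (sact_bdry id_morph B) ss) ss ts"
  then show "DT \<Theta>' \<Delta> (fill_eq_thesis (apply_bdry (sact_bdry id_morph B) ss)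
      (mapp (snd id_morph M) ss) (mapp (snd id_morph M) ts))"
    using ext_lookup[OF assms(3)] by (auto simp: tys_nth eqs_nth intro!: d_meta_congr)
qed (use assms in \<open>auto intro!: d_var intro: ext_lookup\<close>)

text \<open>The identity is a morphism into any larger context, and weakening is its action.\<close>

lemma weaken:
  assumes "D \<Theta> \<Gamma> J" "raw_mctx Sg \<Theta>" "raw_vctx Sg \<Theta> \<Gamma>"
    "raw_mctx Sg \<Theta>'" "raw_vctx Sg \<Theta>' \<Gamma>'" "map_of \<Theta> \<subseteq>\<^sub>m map_of \<Theta>'" "map_of \<Gamma> \<subseteq>\<^sub>m map_of \<Gamma>'"
  shows "D \<Theta>' \<Gamma>' J"
  using deriv_mor[OF assms(1-3) mor_id[OF assms(4-7)]] by simp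

lemma weaken_vctx:
  assumes "D \<Theta> \<Gamma> J" "raw_mctx Sg \<Theta>" "raw_vctx Sg \<Theta> \<Gamma>" "raw_vctx Sg \<Theta> \<Gamma>'" "map_of \<Gamma> \<subseteq>\<^sub>m map_of \<Gamma>'"
  shows "D \<Theta> \<Gamma>' J"
  by (rule weaken[OF assms(1-3,2,4) _ assms(5)]) simp

lemma abstr_ty: "D \<Theta> \<Gamma> (Abstr A J) \<Longrightarrow> DT \<Theta> \<Gamma> (IsTy A)"
  by (erule deriv.cases) auto

text \<open>\<open>d_abstr\<close> provides the body at one variable; the identity, extended by
  sending that variable to \<open>t\<close>, instantiates it. The larger context
  \<open>\<Delta>\<close> builds weakening in.\<close>

lemma abstr_inst:
  assumes d: "D \<Theta> \<Gamma> (Abstr A J)" and r: "raw_mctx Sg \<Theta>" "raw_vctx Sg \<Theta> \<Gamma>" "raw_vctx Sg \<Theta> \<Delta>"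
    and e: "map_of \<Gamma> \<subseteq>\<^sub>m map_of \<Delta>" and t: "DT \<Theta> \<Delta> (HasTy t A)"
  shows "D \<Theta> \<Delta> (subst_jdg 0 t J)"
  using d
proof (cases)
  case (d_abstr a)
  have wA: "wfe \<Theta> \<Gamma> (Ty, 0) A"
    using deriv_wf[OF d_abstr(1) r(1,2)] by auto
  have r2: "raw_vctx Sg \<Theta> (\<Gamma> @ [(a, A)])"
    using raw_vctx_snoc r wA d_abstr by blast
  have m: "mor \<Theta> \<Gamma> \<Theta> \<Gamma> id_morph" using r by (intro mor_id) auto
  have "mor \<Theta> (\<Gamma> @ [(a, A)]) \<Theta> \<Delta> (upd id_morph a t)"
    by (rule mor_upd[OF m r(1,2) wA _ e r(3)]) (use d_abstr t weaken_vctx r in auto)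
  from deriv_mor[OF d_abstr(4) r(1) r2 this]
  have "D \<Theta> \<Delta> (sact_jdg (upd id_morph a t) (subst_jdg 0 (FVar a) J))" .
  moreover have "wf_jdg Sg (mv_arity \<Theta>) (names \<Gamma>) (Suc 0) J"
    using deriv_wf[OF d r(1,2)] by simp
  moreover have "lc 0 t" using deriv_wf[OF t r(1,3)] by (auto intro: wf_arg_lc)
  ultimately show ?thesis
    using sact_jdg_upd_subst[of Sg "mv_arity \<Theta>" "names \<Gamma>" "Suc 0" J "mv_arity \<Theta>" "names \<Gamma>"
        id_morph a t 0]
      wmor_id[of "names \<Gamma>" "names \<Gamma>" "mv_arity \<Theta>" "mv_arity \<Theta>"] d_abstr by auto
qed

lemma raw_snoc:
  assumes "DT \<Theta> \<Gamma> (IsTy A)" "raw_mctx Sg \<Theta>" "raw_vctx Sg \<Theta> \<Gamma>" "a \<notin> names \<Gamma>"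
  shows "raw_vctx Sg \<Theta> (\<Gamma> @ [(a, A)])"
  using assms deriv_wf[OF assms(1-3)] by (auto intro: raw_vctx_snoc)

text \<open>Inversion of \<open>d_abstr\<close> yields the body at some variable; substituting
  \<open>a\<close> for it gives the body at any variable outside the context.\<close>

lemma abstr_open:
  assumes "D \<Theta> \<Gamma> (Abstr A J)" "raw_mctx Sg \<Theta>" "raw_vctx Sg \<Theta> \<Gamma>" "a \<notin> names \<Gamma>"
  shows "D \<Theta> (\<Gamma> @ [(a, A)]) (subst_jdg 0 (FVar a) J)"
  by (rule abstr_inst[OF assms(1-3) raw_snoc[OF abstr_ty[OF assms(1)] assms(2-4)]
      ext_snoc[OF assms(4)]])
    (use assms(4) in \<open>simp add: d_var map_of_snoc del: map_of_append\<close>)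

lemma deriv_apply:
  assumes "D \<Theta> \<Gamma> J" "raw_mctx Sg \<Theta>" "raw_vctx Sg \<Theta> \<Gamma>" "raw_vctx Sg \<Theta> \<Delta>"
    "map_of \<Gamma> \<subseteq>\<^sub>m map_of \<Delta>" "length ts = depth J" "tys \<Theta> \<Delta> (jarg_types J ts) ts"
  shows "DT \<Theta> \<Delta> (apply_jdg J ts)"
  using assms
proof (induction ts arbitrary: \<Gamma> J)
  case Nil
  then obtain j where "J = Thesis j" by (cases J) auto
  with Nil show ?case using weaken_vctx by auto
next
  case (Cons t ts)
  then obtain A J' where J: "J = Abstr A J'" by (cases J) auto
  then have t: "DT \<Theta> \<Delta> (HasTy t A)" and ts: "tys \<Theta> \<Delta> (jarg_types (subst_jdg 0 t J') ts) ts"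
    using Cons.prems(7) by (auto simp: tys_def)
  have "D \<Theta> \<Delta> (subst_jdg 0 t J')"
    using abstr_inst[OF _ Cons.prems(2-5) t] Cons.prems(1) J by simp
  from Cons.IH[OF this Cons.prems(2,4,4) _ _ ts] Cons.prems J show ?case by simp
qed

section \<open>Pairs of judgementally equal morphisms\<close>

fun eq_jthesis :: "'s expr jthesis \<Rightarrow> 's expr jthesis \<Rightarrow> 's expr jthesis" where
  "eq_jthesis (IsTy A) (IsTy B) = JEqTy A B"
| "eq_jthesis (HasTy s A) (HasTy t B) = JEqTm s t A"
| "eq_jthesis j j' = j"

text \<open>Equational judgements have no equations between them; there \<open>eq_jthesis\<close>
  returns its first argument, so that \<open>deriv_emor\<close> can be stated for every judgement.
  Binders are taken from the first judgement, as equations live at the boundary of the left-hand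
  side.\<close>

fun eq_jdg :: "'s jdg \<Rightarrow> 's jdg \<Rightarrow> 's jdg" where
  "eq_jdg (Thesis j) (Thesis j') = Thesis (eq_jthesis j j')"
| "eq_jdg (Abstr A J) (Abstr A' J') = Abstr A (eq_jdg J J')"
| "eq_jdg J J' = J"

lemma map_eq_jthesis: "map_jthesis h (eq_jthesis j j') = eq_jthesis (map_jthesis h j)
    (map_jthesis h j')"
  by (cases j; cases j') auto

lemma subst_eq_jdg: "subst_jdg k u (eq_jdg J J') = eq_jdg (subst_jdg k u J) (subst_jdg k u J')"
  by (induction J J' arbitrary: k u rule: eq_jdg.induct) (auto simp: map_eq_jthesis)

lemma fv_eq_jdg: "fv_jdg (eq_jdg J J') \<subseteq> fv_jdg J \<union> fv_jdg J'"
proof (induction J J' rule: eq_jdg.induct)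
  case (1 j j')
  then show ?case by (cases j; cases j') (auto simp: fv_jdg_exprs)
qed (auto simp: fv_jdg_exprs)

lemma eq_fill_thesis: "is_object_thesis b \<Longrightarrow> bthesis_cls b = bthesis_cls b' \<Longrightarrow>
  eq_jthesis (fill_thesis b e) (fill_thesis b' e') = fill_eq_thesis b e e'"
  by (cases b; cases b') (auto simp: is_object_thesis_def)

lemma eq_fill_thesis': "\<not> is_object_thesis b \<Longrightarrow> eq_jthesis (fill_thesis b e) j = fill_thesis b e"
  by (cases b) (auto simp: is_object_thesis_def)

lemma eq_fill: "is_object B \<Longrightarrow> nabs (depth B) e \<Longrightarrow> nabs (depth B) e' \<Longrightarrow>
  eq_jdg (fill (sact_bdry f B) e) (fill (sact_bdry g B) e') = fill_eq (sact_bdry f B) e e'"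
  by (induction B arbitrary: e e') (auto simp: nabs_Suc eq_fill_thesis is_object_def)

text \<open>The two argument lists are typed along their own morphisms, while their equality is
  stated along \<open>f\<close>. This matches the congruence rules, where each side satisfies its
  own premises and the equations are at the boundaries of the left-hand side.\<close>

definition emor :: "'s mctx \<Rightarrow> 's vctx \<Rightarrow> 's mctx \<Rightarrow> 's vctx \<Rightarrow> 's morph \<Rightarrow> 's morph \<Rightarrow> bool" where
  "emor \<Theta> \<Gamma> \<Theta>' \<Gamma>' f g \<longleftrightarrow> mor \<Theta> \<Gamma> \<Theta>' \<Gamma>' f \<and> mor \<Theta> \<Gamma> \<Theta>' \<Gamma>' g \<and>
     (\<forall>\<Delta>. map_of \<Gamma>' \<subseteq>\<^sub>m map_of \<Delta> \<longrightarrow> raw_vctx Sg \<Theta>' \<Delta> \<longrightarrow>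
        (\<forall>a A. map_of \<Gamma> a = Some A \<longrightarrow> DT \<Theta>' \<Delta> (JEqTm (fst f a) (fst g a) (sact f A))) \<and>
        (\<forall>M B ss ts. map_of \<Theta> M = Some B \<longrightarrow> is_object B \<longrightarrow> length ss = depth B \<longrightarrow> length ts = depth B \<longrightarrow>
           tys \<Theta>' \<Delta> (arg_types (sact_bdry f B) ss) ss \<longrightarrow>
           tys \<Theta>' \<Delta> (arg_types (sact_bdry g B) ts) ts \<longrightarrow>
           eqs \<Theta>' \<Delta> (arg_types (sact_bdry f B) ss) ss ts \<longrightarrow>
           DT \<Theta>' \<Delta> (fill_eq_thesis (apply_bdry (sact_bdry f B) ss)
             (mapp (snd f M) ss) (mapp (snd g M) ts))))"

lemma emor_mor: "emor \<Theta> \<Gamma> \<Theta>' \<Gamma>' f g \<Longrightarrow> mor \<Theta> \<Gamma> \<Theta>' \<Gamma>' f" "emor \<Theta> \<Gamma> \<Theta>' \<Gamma>' f g \<Longrightarrow> mor \<Theta> \<Gamma> \<Theta>' \<Gamma>' g"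
  by (auto simp: emor_def)

lemma mor_raw: "mor \<Theta> \<Gamma> \<Theta>' \<Gamma>' f \<Longrightarrow> raw_mctx Sg \<Theta>'" "mor \<Theta> \<Gamma> \<Theta>' \<Gamma>' f \<Longrightarrow> raw_vctx Sg \<Theta>' \<Gamma>'"
  by (auto simp: mor_def)

lemma emor_refl: "mor \<Theta> \<Gamma> \<Theta>' \<Gamma>' f \<Longrightarrow> emor \<Theta> \<Gamma> \<Theta>' \<Gamma>' f f"
  unfolding emor_def mor_def by (auto intro: d_tm_refl)

lemma emor_ext: "emor \<Theta> \<Gamma> \<Theta>' \<Gamma>' f g \<Longrightarrow> map_of \<Gamma>' \<subseteq>\<^sub>m map_of \<Delta> \<Longrightarrow> raw_vctx Sg \<Theta>' \<Delta> \<Longrightarrow> emor \<Theta> \<Gamma> \<Theta>' \<Delta> f g"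
  unfolding emor_def by (meson map_le_trans mor_ext)

lemma upd_sel: "fst (upd f a u) b = (if b = a then u else fst f b)" "snd (upd f a u) = snd f"
  by (auto simp: upd_def)

text \<open>In contrast to \<open>mor_upd\<close>, weakening is available here, so typing and
  equality over \<open>\<Delta>\<close> carry over to all its extensions.\<close>

lemma emor_upd:
  assumes m: "emor \<Theta> \<Gamma> \<Theta>' \<Gamma>' f g" and r: "raw_mctx Sg \<Theta>" "raw_vctx Sg \<Theta> \<Gamma>"
    and A: "wfe \<Theta> \<Gamma> (Ty, 0) A" and a: "a \<notin> names \<Gamma>"
    and \<Delta>: "map_of \<Gamma>' \<subseteq>\<^sub>m map_of \<Delta>" "raw_vctx Sg \<Theta>' \<Delta>"
    and s: "DT \<Theta>' \<Delta> (HasTy s (sact f A))" and t: "DT \<Theta>' \<Delta> (HasTy t (sact g A))"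
    and st: "DT \<Theta>' \<Delta> (JEqTm s t (sact f A))"
  shows "emor \<Theta> (\<Gamma> @ [(a, A)]) \<Theta>' \<Delta> (upd f a s) (upd g a t)"
proof -
  have r': "raw_mctx Sg \<Theta>'" using m by (auto simp: emor_def mor_def)
  have "mor \<Theta> (\<Gamma> @ [(a, A)]) \<Theta>' \<Delta> (upd f a s)"
    by (rule mor_upd[OF emor_mor(1)[OF m] r A a \<Delta>]) (use weaken_vctx[OF s r' \<Delta>(2)] in auto)
  moreover have "mor \<Theta> (\<Gamma> @ [(a, A)]) \<Theta>' \<Delta> (upd g a t)"
    by (rule mor_upd[OF emor_mor(2)[OF m] r A a \<Delta>]) (use weaken_vctx[OF t r' \<Delta>(2)] in auto)
  moreover have "sact (upd f a s) A = sact f A"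
    using wf_arg_fv[OF A] a by (intro sact_upd) auto
  moreover have "sact (upd f a u) B = sact f B" if "map_of \<Gamma> b = Some B" for b B u
    using wf_arg_fv[OF raw_vctx_lookup[OF r(2) that]] a by (intro sact_upd) auto
  moreover have "sact_bdry (upd f a u) B = sact_bdry f B" if "map_of \<Theta> M = Some B" for M B f u
    using sact_bdry_upd_closed[OF raw_mctx_map_of[OF r(1) that]] .
  moreover have "DT \<Theta>' \<Delta>' (JEqTm (fst (upd f a s) b) (fst (upd g a t) b) (sact (upd f a s) B))"
    if "map_of \<Delta> \<subseteq>\<^sub>m map_of \<Delta>'" "raw_vctx Sg \<Theta>' \<Delta>'" "map_of (\<Gamma> @ [(a, A)]) b = Some B" for \<Delta>' b B
  proof (cases "b = a")
    case True
    then show ?thesis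
      using that weaken_vctx[OF st r' \<Delta>(2) that(2,1)] a calculation(3)
      by (simp add: map_of_snoc upd_sel del: map_of_append)
  next
    case False
    then have b: "map_of \<Gamma> b = Some B" using that(3) a by (simp add: map_of_snoc del: map_of_append)
    then show ?thesis
      using that(1,2) False emor_ext[OF m \<Delta>] calculation(4)[OF b]
      unfolding emor_def by (simp add: upd_sel)
  qed
  ultimately show ?thesis
    using emor_ext[OF m \<Delta>] unfolding emor_def by (simp add: upd_sel(2))
qed

lemma fill_thesis_cases: obtains b e where "(j :: 's expr jthesis) = fill_thesis b e"
  by (cases j) (metis fill_thesis.simps)+

lemma emor_raw: "emor \<Theta> \<Gamma> \<Theta>' \<Gamma>' f g \<Longrightarrow> raw_mctx Sg \<Theta>'" "emor \<Theta> \<Gamma> \<Theta>' \<Gamma>' f g \<Longrightarrow> raw_vctx Sg \<Theta>' \<Gamma>'"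
  by (auto simp: emor_def mor_def)

lemma emor_equation:
  assumes "D \<Theta> \<Gamma> J" "raw_mctx Sg \<Theta>" "raw_vctx Sg \<Theta> \<Gamma>" "emor \<Theta> \<Gamma> \<Theta>' \<Gamma>' f g"
    "eq_jdg (sact_jdg f J) (sact_jdg g J) = sact_jdg f J"
  shows "D \<Theta>' \<Gamma>' (eq_jdg (sact_jdg f J) (sact_jdg g J))"
  using deriv_mor[OF assms(1-3) emor_mor(1)[OF assms(4)]] assms(5) by simp

text \<open>An instance of an object rule turns into an instance of its congruence rule, with
  \<open>f\<close> and \<open>g\<close> composed into the two instantiations. On equational
  judgements \<open>eq_jdg\<close> returns the image under \<open>f\<close>, so
  \<open>deriv_mor\<close> is enough.\<close>

theorem deriv_emor:
  "D \<Theta> \<Gamma> J \<Longrightarrow> raw_mctx Sg \<Theta> \<Longrightarrow> raw_vctx Sg \<Theta> \<Gamma> \<Longrightarrow> emor \<Theta> \<Gamma> \<Theta>' \<Gamma>' f g \<Longrightarrow>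
   D \<Theta>' \<Gamma>' (eq_jdg (sact_jdg f J) (sact_jdg g J))"
proof (induction arbitrary: \<Gamma>' f g rule: deriv.induct)
  case (d_var \<Gamma> a A \<Theta>)
  have "DT \<Theta>' \<Gamma>' (JEqTm (fst f a) (fst g a) (sact f A))"
    using d_var.prems(3) emor_raw(2)[OF d_var.prems(3)] d_var.hyps map_le_refl
    unfolding emor_def by blast
  then show ?case by simp
next
  case (d_meta \<Theta> M B ts \<Gamma>)
  have D: "DT \<Theta> \<Gamma> (fill_thesis (apply_bdry B ts) (MvApp M ts))"
    using d_meta by (auto intro!: deriv.d_meta)
  show ?case
  proof (cases "is_object B")
    case True
    have ts: "\<forall>t\<in>set ts. wfe \<Theta> \<Gamma> (Tm, 0) t"
      using d_meta deriv_wf by (fastforce simp: in_set_conv_nth)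
    note w = sact_apply_bdry[OF wf_map_of_bdry[OF d_meta.prems(1) d_meta.hyps(1)] _ ts]
    have wf: "wfm \<Theta> \<Gamma> \<Theta>' \<Gamma>' f"
      and wg: "wfm \<Theta> \<Gamma> \<Theta>' \<Gamma>' g"
      using d_meta.prems(3) by (auto simp: emor_def mor_def)
    note af = w[OF wf, THEN conjunct2, symmetric]
    note ag = w[OF wg, THEN conjunct2, symmetric]
    have "tys \<Theta>' \<Gamma>' (arg_types (sact_bdry f B) (map (sact f) ts)) (map (sact f) ts)"
      "tys \<Theta>' \<Gamma>' (arg_types (sact_bdry g B) (map (sact g) ts)) (map (sact g) ts)"
      unfolding af ag
      using deriv_mor[OF _ d_meta.prems(1,2) emor_mor(1)[OF d_meta.prems(3)], of "Thesis (HasTy _ _)"]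
        deriv_mor[OF _ d_meta.prems(1,2) emor_mor(2)[OF d_meta.prems(3)], of "Thesis (HasTy _ _)"]
            d_meta.IH d_meta.hyps
      by (simp_all add: tys_nth length_arg_types del: split_paired_All)
    moreover have "eqs \<Theta>' \<Gamma>' (arg_types (sact_bdry f B) (map (sact f) ts)) (map (sact f) ts)
        (map (sact g) ts)"
      unfolding af using d_meta.IH d_meta.hyps d_meta.prems
      by (simp add: eqs_nth length_arg_types del: split_paired_All)
    ultimately have "DT \<Theta>' \<Gamma>' (fill_eq_thesis (apply_bdry (sact_bdry f B) (map (sact f) ts))
        (sact f (MvApp M ts)) (sact g (MvApp M ts)))"
      using d_meta.prems d_meta.hyps True unfolding emor_def mor_def by simp
    then show ?thesis using w[OF wf] w[OF wg] True
      by (simp add: map_fill_thesis eq_fill_thesis is_object_apply_bdry)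
  next
    case False
    then show ?thesis using deriv_mor[OF D d_meta.prems(1,2) emor_mor(1)[OF d_meta.prems(3)]]
      by (simp add: map_fill_thesis eq_fill_thesis' is_object_apply_bdry)
  qed
next
  case (d_meta_congr \<Theta> M B ss ts \<Gamma>)
  have "DT \<Theta> \<Gamma> (fill_eq_thesis (apply_bdry B ss) (MvApp M ss) (MvApp M ts))"
    by (rule deriv.d_meta_congr) (use d_meta_congr in auto)
  from deriv_mor[OF this d_meta_congr.prems(1,2) emor_mor(1)[OF d_meta_congr.prems(3)]]
  show ?case using d_meta_congr.hyps(2) is_object_apply_bdry[of B ss]
    by (cases "apply_bdry B ss") (auto simp: is_object_thesis_def)
next
  case (d_abstr \<Theta> \<Gamma> A a J)
  define A' A'' J' J'' where defs: "A' = sact f A" "A'' = sact g A" "J' = sact_jdg f J"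
      "J'' = sact_jdg g J"
  obtain b where b: "b \<notin> names \<Gamma>' \<union> fv A' \<union> fv_jdg J' \<union> fv_jdg J''"
    using fresh[of "names \<Gamma>' \<union> fv A' \<union> fv_jdg J' \<union> fv_jdg J''"] by auto
  have A': "DT \<Theta>' \<Gamma>' (IsTy A')"
    using deriv_mor[OF d_abstr.hyps(1) d_abstr.prems(1,2) emor_mor(1)[OF d_abstr.prems(3)]]
    by (auto simp: defs)
  have AA: "DT \<Theta>' \<Gamma>' (JEqTy A' A'')"
    using d_abstr.IH(1)[OF d_abstr.prems] by (auto simp: defs)
  note r = emor_raw[OF d_abstr.prems(3)]
  have wA: "wfe \<Theta> \<Gamma> (Ty, 0) A"
    using deriv_wf[OF d_abstr.hyps(1)] d_abstr.prems by auto
  have r2: "raw_vctx Sg \<Theta> (\<Gamma> @ [(a, A)])"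
    using raw_vctx_snoc wA d_abstr by blast
  have r': "raw_vctx Sg \<Theta>' (\<Gamma>' @ [(b, A')])"
    using raw_snoc[OF A' r] b by auto
  have ex: "map_of \<Gamma>' \<subseteq>\<^sub>m map_of (\<Gamma>' @ [(b, A')])" using b by (intro ext_snoc) simp
  have bA: "DT \<Theta>' (\<Gamma>' @ [(b, A')]) (HasTy (FVar b) A')"
    using b by (auto intro!: d_var ext_snoc_lookup simp del: map_of_append)
  \<comment> \<open>\<open>b\<close> is declared at the image of \<open>A\<close> under
    \<open>f\<close>; its typing at the image under \<open>g\<close> comes from converting along
    \<open>AA\<close>.\<close>
  have f': "emor \<Theta> (\<Gamma> @ [(a, A)]) \<Theta>' (\<Gamma>' @ [(b, A')]) (upd f a (FVar b)) (upd g a (FVar b))"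
    by (rule emor_upd[OF d_abstr.prems(3,1,2) wA d_abstr.hyps(2) ex r'])
      (use bA weaken_vctx[OF AA r r' ex] in \<open>auto simp: defs intro: d_tm_refl d_conv_tm\<close>)
  have wJ: "wf_jdg Sg (mv_arity \<Theta>) (names \<Gamma>) (Suc 0) J"
    using deriv_wf[OF d_abstr.hyps(4)] d_abstr r2 by (intro wf_jdg_subst_FVar_D) auto
  have "D \<Theta>' (\<Gamma>' @ [(b, A')]) (eq_jdg (sact_jdg (upd f a (FVar b)) (subst_jdg 0 (FVar a) J))
      (sact_jdg (upd g a (FVar b)) (subst_jdg 0 (FVar a) J)))"
    using d_abstr.IH(2)[OF d_abstr.prems(1) r2 f'] .
  also have "sact_jdg (upd f a (FVar b)) (subst_jdg 0 (FVar a) J) = subst_jdg 0 (FVar b) J'"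
    unfolding defs by (rule sact_jdg_upd_subst[OF wJ]) (use d_abstr in \<open>auto simp: emor_def mor_def\<close>)
  also have "sact_jdg (upd g a (FVar b)) (subst_jdg 0 (FVar a) J) = subst_jdg 0 (FVar b) J''"
    unfolding defs by (rule sact_jdg_upd_subst[OF wJ]) (use d_abstr in \<open>auto simp: emor_def mor_def\<close>)
  finally show ?case
    using A' b fv_eq_jdg[of J' J'']
    by (auto simp: defs[symmetric] subst_eq_jdg[symmetric] intro!: deriv.d_abstr[of _ _ _ _ _ b])
next
  case (d_rule \<Xi> J \<Theta> \<Gamma> I)
  have DJ: "DT \<Theta> \<Gamma> (map_jthesis (act I) J)" using d_rule by (auto intro: deriv.d_rule)
  have \<Xi>: "raw_mctx Sg \<Xi>" "wf_jthesis Sg (mv_arity \<Xi>) {} 0 J"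
    using raw_rule[OF d_rule.hyps(1)] by (auto simp: raw_rule_def)
  have d: "distinct (map fst \<Xi>)" by (rule raw_mctx_distinct[OF \<Xi>(1)])
  obtain b e where J: "J = fill_thesis b e" by (rule fill_thesis_cases)
  note mf = emor_mor(1)[OF d_rule.prems(3)] and mg = emor_mor(2)[OF d_rule.prems(3)]
  show ?case
  proof (cases "is_object_thesis b")
    case True
    have f: "map_jthesis (sact f) (map_jthesis (act I) J) = map_jthesis (act (inst_act f I)) J"
      using sact_inst_jthesis[OF \<Xi>(2) d_rule.hyps(2) d mor_wmor[OF mf]] .
    have g: "map_jthesis (sact g) (map_jthesis (act I) J) = map_jthesis (act (inst_act g I)) J"
      using sact_inst_jthesis[OF \<Xi>(2) d_rule.hyps(2) d mor_wmor[OF mg]] .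
    have 1: "\<forall>i<length \<Xi>. D \<Theta>' \<Gamma>' (fill (premise_bdry \<Xi> (inst_act f I) i) (snd (inst_act f I ! i)))"
      using d_rule.IH deriv_mor[OF _ d_rule.prems(1,2) mf]
          sact_fill_premise[OF \<Xi>(1) d_rule.hyps(2) _ mf] by metis
    have 2: "\<forall>i<length \<Xi>. D \<Theta>' \<Gamma>' (fill (premise_bdry \<Xi> (inst_act g I) i) (snd (inst_act g I ! i)))"
      using d_rule.IH deriv_mor[OF _ d_rule.prems(1,2) mg]
          sact_fill_premise[OF \<Xi>(1) d_rule.hyps(2) _ mg] by metis
    have 3: "\<forall>i<length \<Xi>. is_object (snd (\<Xi> ! i)) \<longrightarrow> D \<Theta>' \<Gamma>' (fill_eq (premise_bdry \<Xi> (inst_act f I) i)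
        (snd (inst_act f I ! i)) (snd (inst_act g I ! i)))"
    proof (intro allI impI)
      fix i assume i: "i < length \<Xi>" "is_object (snd (\<Xi> ! i))"
      have "D \<Theta>' \<Gamma>' (eq_jdg (sact_jdg f (premise \<Xi> I i))
          (sact_jdg g (premise \<Xi> I i)))"
        using d_rule.IH d_rule.prems i by blast
      moreover have "is_object (premise_bdry \<Xi> I i)"
        using i by (simp add: premise_bdry_def act_bdry_sact)
      ultimately show "D \<Theta>' \<Gamma>' (fill_eq (premise_bdry \<Xi> (inst_act f I) i)
          (snd (inst_act f I ! i)) (snd (inst_act g I ! i)))"
        using i fill_premise_wf(1)[OF d_rule.hyps(2) i(1)]
          instantiates_length[OF d_rule.hyps(2)]
        by (simp add: sact_fill eq_fill nabs_sact flip: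
            sact_premise_bdry[OF \<Xi>(1) d_rule.hyps(2) i(1) mor_wmor[OF mf]])
    qed
    have "DT \<Theta>' \<Gamma>'
        (fill_eq_thesis (map_bthesis (act (inst_act f I)) b) (act (inst_act f I) e)
        (act (inst_act g I) e))"
      by (rule deriv.d_rule_congr[OF _ True inst_mor[OF d_rule.hyps(2) mf]
          inst_mor[OF d_rule.hyps(2) mg] 1 2 3])
        (use d_rule J in auto)
    then show ?thesis
      using True by (simp only: sact_jdg_simps f g eq_jdg.simps)
          (simp add: J map_fill_thesis eq_fill_thesis)
  next
    case False
    then show ?thesis using deriv_mor[OF DJ d_rule.prems(1,2) mf]
      by (simp add: J map_fill_thesis eq_fill_thesis')
  qed
next
  case (d_rule_congr \<Xi> b e \<Theta> \<Gamma> I I')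
  have "DT \<Theta> \<Gamma> (fill_eq_thesis (map_bthesis (act I) b) (act I e) (act I' e))"
    by (rule deriv.d_rule_congr) (use d_rule_congr in auto)
  from deriv_mor[OF this d_rule_congr.prems(1,2) emor_mor(1)[OF d_rule_congr.prems(3)]]
  show ?case using d_rule_congr.hyps(2) by (cases b) (auto simp: is_object_thesis_def)
next
  case (d_ty_refl \<Theta> \<Gamma> A)
  show ?case by (rule emor_equation[OF deriv.d_ty_refl[OF d_ty_refl.hyps(1)] d_ty_refl.prems]) simp
next
  case (d_ty_sym \<Theta> \<Gamma> A B)
  show ?case by (rule emor_equation[OF deriv.d_ty_sym[OF d_ty_sym.hyps(1)] d_ty_sym.prems]) simp
next
  case (d_ty_trans \<Theta> \<Gamma> A B C)
  show ?case by (rule emor_equation[OF deriv.d_ty_trans[OF d_ty_trans.hyps(1,2)] d_ty_trans.prems]) simp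
next
  case (d_tm_refl \<Theta> \<Gamma> t A)
  show ?case by (rule emor_equation[OF deriv.d_tm_refl[OF d_tm_refl.hyps(1)] d_tm_refl.prems]) simp
next
  case (d_tm_sym \<Theta> \<Gamma> s t A)
  show ?case by (rule emor_equation[OF deriv.d_tm_sym[OF d_tm_sym.hyps(1)] d_tm_sym.prems]) simp
next
  case (d_tm_trans \<Theta> \<Gamma> s t A u)
  show ?case by (rule emor_equation[OF deriv.d_tm_trans[OF d_tm_trans.hyps(1,2)] d_tm_trans.prems]) simp
next
  case (d_conv_tm \<Theta> \<Gamma> t A B)
  show ?case using d_conv_tm.IH(1)[OF d_conv_tm.prems]
      deriv_mor[OF d_conv_tm.hyps(2) d_conv_tm.prems(1,2) emor_mor(1)[OF d_conv_tm.prems(3)]]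
    by (auto intro: d_conv_eq)
next
  case (d_conv_eq \<Theta> \<Gamma> s t A B)
  show ?case by (rule emor_equation[OF deriv.d_conv_eq[OF d_conv_eq.hyps(1,2)] d_conv_eq.prems]) simp
qed

section \<open>Derivable boundaries, their instances and their equality\<close>

lemma deriv_bdry_wf: "DB \<Theta> \<Gamma> B \<Longrightarrow> raw_mctx Sg \<Theta> \<Longrightarrow> raw_vctx Sg \<Theta> \<Gamma> \<Longrightarrow>
    wf_bdry Sg (mv_arity \<Theta>) (names \<Gamma>) 0 B"
proof (induction rule: deriv_bdry.induct)
  case (b_abstr \<Theta> \<Gamma> A a B)
  have "raw_vctx Sg \<Theta> (\<Gamma> @ [(a, A)])" using raw_snoc b_abstr by blast
  then have "wf_bdry Sg (mv_arity \<Theta>) (insert a (names \<Gamma>)) 0 (subst_bdry 0 (FVar a) B)"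
    using b_abstr by (simp only: names_snoc)
  then show ?case using deriv_wf[OF b_abstr.hyps(1)] b_abstr by (auto dest: wf_bdry_subst_FVar_D)
qed (auto dest!: deriv_wf)

text \<open>The two images of \<open>A\<close> are equal types, so the new variable may be declared
  at either of them and conversion types it at the other. \<open>fill_convert\<close> needs both
  choices.\<close>

lemma open_emor:
  assumes A: "DT \<Theta> \<Gamma> (IsTy A)" and a: "a \<notin> names \<Gamma>"
    and r: "raw_mctx Sg \<Theta>" "raw_vctx Sg \<Theta> \<Gamma>" and m: "emor \<Theta> \<Gamma> \<Theta>' \<Gamma>' f g"
    and b: "b \<notin> names \<Gamma>'" and A': "A' = sact f A \<or> A' = sact g A"
  shows "emor \<Theta> (\<Gamma> @ [(a, A)]) \<Theta>' (\<Gamma>' @ [(b, A')]) (upd f a (FVar b)) (upd g a (FVar b))"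
    "raw_vctx Sg \<Theta> (\<Gamma> @ [(a, A)])" "raw_vctx Sg \<Theta>' (\<Gamma>' @ [(b, A')])"
    "DT \<Theta>' \<Gamma>' (IsTy A')" "DT \<Theta>' \<Gamma>' (JEqTy (sact f A) (sact g A))"
proof -
  note r' = emor_raw[OF m]
  have wA: "wfe \<Theta> \<Gamma> (Ty, 0) A"
    using deriv_wf[OF A r] by auto
  show r2: "raw_vctx Sg \<Theta> (\<Gamma> @ [(a, A)])" by (rule raw_snoc[OF A r a])
  show A1: "DT \<Theta>' \<Gamma>' (IsTy A')"
    using deriv_mor[OF A r emor_mor(1)[OF m]] deriv_mor[OF A r emor_mor(2)[OF m]] A' by auto
  show AA: "DT \<Theta>' \<Gamma>' (JEqTy (sact f A) (sact g A))"
    using deriv_emor[OF A r m] by auto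
  show r3: "raw_vctx Sg \<Theta>' (\<Gamma>' @ [(b, A')])" by (rule raw_snoc[OF A1 r' b])
  have ex: "map_of \<Gamma>' \<subseteq>\<^sub>m map_of (\<Gamma>' @ [(b, A')])" by (rule ext_snoc[OF b])
  have bA: "DT \<Theta>' (\<Gamma>' @ [(b, A')]) (HasTy (FVar b) A')"
    using b by (auto intro!: d_var ext_snoc_lookup simp del: map_of_append)
  have "DT \<Theta>' (\<Gamma>' @ [(b, A')]) (HasTy (FVar b) (sact f A))"
    "DT \<Theta>' (\<Gamma>' @ [(b, A')]) (HasTy (FVar b) (sact g A))"
    using A' bA weaken_vctx[OF AA r' r3 ex] by (auto intro: d_conv_tm d_ty_sym)
  then show "emor \<Theta> (\<Gamma> @ [(a, A)]) \<Theta>' (\<Gamma>' @ [(b, A')]) (upd f a (FVar b)) (upd g a (FVar b))"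
    by (intro emor_upd[OF m r wA a ex r3]) (auto intro: d_tm_refl)
qed

lemma sact_open:
  assumes "DB \<Theta> (\<Gamma> @ [(a, A)]) (subst_bdry 0 (FVar a) B)" "raw_mctx Sg \<Theta>" "raw_vctx Sg \<Theta> (\<Gamma> @ [(a, A)])"
    "a \<notin> fv_bdry B" "mor \<Theta> \<Gamma> \<Theta>' \<Gamma>' f" "lc 0 u"
  shows "sact_bdry (upd f a u) (subst_bdry 0 (FVar a) B) = subst_bdry 0 u (sact_bdry f B)"
proof -
  have "wf_bdry Sg (mv_arity \<Theta>) (names \<Gamma>) (Suc 0) B"
    using deriv_bdry_wf[OF assms(1-3)] assms(4) by (auto intro: wf_bdry_subst_FVar_D)
  from sact_bdry_upd_subst[OF this mor_wmor[OF assms(5)] assms(4,6)] show ?thesis .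
qed

lemma deriv_bdry_mor:
  "DB \<Theta> \<Gamma> B \<Longrightarrow> raw_mctx Sg \<Theta> \<Longrightarrow> raw_vctx Sg \<Theta> \<Gamma> \<Longrightarrow> mor \<Theta> \<Gamma> \<Theta>' \<Gamma>' f \<Longrightarrow> DB \<Theta>' \<Gamma>' (sact_bdry f B)"
proof (induction arbitrary: \<Gamma>' f rule: deriv_bdry.induct)
  case (b_tm \<Theta> \<Gamma> A)
  then show ?case using deriv_mor[OF b_tm.hyps(1) b_tm.prems] by (auto intro: deriv_bdry.intros)
next
  case (b_eqty \<Theta> \<Gamma> A B)
  then show ?case using deriv_mor[OF _ b_eqty.prems, of "Thesis (IsTy _)"]
    by (auto intro!: deriv_bdry.intros)
next
  case (b_eqtm \<Theta> \<Gamma> A s t)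
  then show ?case using deriv_mor[OF _ b_eqtm.prems, of "Thesis (IsTy _)"]
      deriv_mor[OF _ b_eqtm.prems, of "Thesis (HasTy _ _)"]
    by (auto intro!: deriv_bdry.intros)
next
  case (b_abstr \<Theta> \<Gamma> A a B)
  obtain b where b: "b \<notin> names \<Gamma>' \<union> fv (sact f A) \<union> fv_bdry (sact_bdry f B)"
    using fresh[of "names \<Gamma>' \<union> fv (sact f A) \<union> fv_bdry (sact_bdry f B)"] by auto
  then have b': "b \<notin> names \<Gamma>'" by simp
  note o = open_emor[OF b_abstr.hyps(1,2) b_abstr.prems(1,2) emor_refl[OF b_abstr.prems(3)] b'
      disjI1[OF refl]]
  have "DB \<Theta>' (\<Gamma>' @ [(b, sact f A)]) (sact_bdry (upd f a (FVar b)) (subst_bdry 0 (FVar a) B))"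
    by (rule b_abstr.IH[OF b_abstr.prems(1) o(2) emor_mor(1)[OF o(1)]])
  also have "sact_bdry (upd f a (FVar b)) (subst_bdry 0 (FVar a) B) = subst_bdry 0 (FVar b)
      (sact_bdry f B)"
    by (rule sact_open[OF b_abstr.hyps(4) b_abstr.prems(1) o(2) _ b_abstr.prems(3)])
        (use b_abstr.hyps in auto)
  finally show ?case using o(4) b by (auto intro: deriv_bdry.b_abstr[of _ _ _ _ _ b])
qed (auto intro: deriv_bdry.intros)

text \<open>Each binder is absorbed by extending the morphism with the corresponding argument, until
  \<open>deriv_bdry_mor\<close> applies to an unabstracted boundary.\<close>

lemma deriv_bdry_apply:
  "DB \<Theta> \<Gamma> B \<Longrightarrow> raw_mctx Sg \<Theta> \<Longrightarrow> raw_vctx Sg \<Theta> \<Gamma> \<Longrightarrow> mor \<Theta> \<Gamma> \<Theta>' \<Gamma>' f \<Longrightarrow> length ts = depth B \<Longrightarrow>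
   tys \<Theta>' \<Gamma>' (arg_types (sact_bdry f B) ts) ts \<Longrightarrow> DB \<Theta>' \<Gamma>' (Thesis (apply_bdry (sact_bdry f B) ts))"
proof (induction arbitrary: f ts rule: deriv_bdry.induct)
  case (b_abstr \<Theta> \<Gamma> A a B)
  obtain t ts' where ts: "ts = t # ts'" using b_abstr.prems(4) by (cases ts) auto
  have t: "DT \<Theta>' \<Gamma>' (HasTy t (sact f A))"
    and ts': "tys \<Theta>' \<Gamma>' (arg_types (subst_bdry 0 t (sact_bdry f B)) ts') ts'"
    using b_abstr.prems(5) ts by (auto simp: tys_def)
  note r' = mor_raw[OF b_abstr.prems(3)]
  have r2: "raw_vctx Sg \<Theta> (\<Gamma> @ [(a, A)])" using raw_snoc b_abstr by blast
  have lt: "lc 0 t" using deriv_wf[OF t r'] by (auto intro: wf_arg_lc)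
  have wA: "wfe \<Theta> \<Gamma> (Ty, 0) A"
    using deriv_wf[OF b_abstr.hyps(1)] b_abstr.prems by auto
  have m: "mor \<Theta> (\<Gamma> @ [(a, A)]) \<Theta>' \<Gamma>' (upd f a t)"
    using emor_mor(1)[OF emor_upd[OF emor_refl[OF b_abstr.prems(3)] b_abstr.prems(1,2) wA
        b_abstr.hyps(2)
        map_le_refl r'(2) t t d_tm_refl[OF t]]] .
  note so = sact_open[OF b_abstr.hyps(4) b_abstr.prems(1) r2 _ b_abstr.prems(3) lt]
  show ?case
    using b_abstr.IH[OF b_abstr.prems(1) r2 m, of ts'] ts' b_abstr.prems(4) b_abstr.hyps(3) ts so
        by auto
next
  case (b_ty \<Theta> \<Gamma>)
  then show ?case by (auto intro: deriv_bdry.intros)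
next
  case (b_tm \<Theta> \<Gamma> A)
  show ?case using deriv_bdry_mor[OF deriv_bdry.b_tm[OF b_tm.hyps] b_tm.prems(1-3)] by simp
next
  case (b_eqty \<Theta> \<Gamma> A B)
  show ?case using deriv_bdry_mor[OF deriv_bdry.b_eqty[OF b_eqty.hyps] b_eqty.prems(1-3)] by simp
next
  case (b_eqtm \<Theta> \<Gamma> A s t)
  show ?case using deriv_bdry_mor[OF deriv_bdry.b_eqtm[OF b_eqtm.hyps] b_eqtm.prems(1-3)] by simp
qed

text \<open>Equational theses are compared in all their components, because filled equations have to
  be converted between equal boundaries too. Terms are compared at the type of the first
  boundary.\<close>

fun beq :: "'s mctx \<Rightarrow> 's vctx \<Rightarrow> 's expr bthesis \<Rightarrow> 's expr bthesis \<Rightarrow> bool" where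
  "beq \<Theta> \<Gamma> BTy BTy \<longleftrightarrow> True"
| "beq \<Theta> \<Gamma> (BTm A) (BTm A') \<longleftrightarrow> DT \<Theta> \<Gamma> (JEqTy A A')"
| "beq \<Theta> \<Gamma> (BEqTy A B) (BEqTy A' B') \<longleftrightarrow> DT \<Theta> \<Gamma> (JEqTy A A') \<and> DT \<Theta> \<Gamma> (JEqTy B B')"
| "beq \<Theta> \<Gamma> (BEqTm s t A) (BEqTm s' t' A') \<longleftrightarrow> DT \<Theta> \<Gamma> (JEqTy A A') \<and>
     DT \<Theta> \<Gamma> (JEqTm s s' A) \<and> DT \<Theta> \<Gamma> (JEqTm t t' A)"
| "beq \<Theta> \<Gamma> b b' \<longleftrightarrow> False"

lemma beq_fill: "beq \<Theta> \<Gamma> b b' \<Longrightarrow> DT \<Theta> \<Gamma> (fill_thesis b e) \<longleftrightarrow> DT \<Theta> \<Gamma> (fill_thesis b' e)"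
  by (cases "(\<Theta>, \<Gamma>, b, b')" rule: beq.cases)
    (auto, (meson d_ty_sym d_ty_trans d_tm_sym d_tm_trans d_conv_tm d_conv_eq)+)

lemma beq_fill_eq: "beq \<Theta> \<Gamma> b b' \<Longrightarrow> is_object_thesis b \<Longrightarrow>
  DT \<Theta> \<Gamma> (fill_eq_thesis b e e') \<longleftrightarrow> DT \<Theta> \<Gamma> (fill_eq_thesis b' e e')"
  by (cases "(\<Theta>, \<Gamma>, b, b')" rule: beq.cases)
    (auto simp: is_object_thesis_def, (meson d_ty_sym d_conv_eq)+)

lemma beq_emor:
  assumes "DB \<Theta> \<Gamma> (Thesis b)" "raw_mctx Sg \<Theta>" "raw_vctx Sg \<Theta> \<Gamma>" "emor \<Theta> \<Gamma> \<Theta>' \<Gamma>' f g"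
  shows "beq \<Theta>' \<Gamma>' (map_bthesis (sact f) b) (map_bthesis (sact g) b)"
  using assms(1)
  by (cases) (use deriv_emor[OF _ assms(2-4), of "Thesis _"] in \<open>force+\<close>)

text \<open>The arguments are only assumed to be typed and equal below \<open>n\<close>, so that the type of the next
  one can be converted before its own typing is known.\<close>

lemma deriv_bdry_emor:
  "DB \<Theta> \<Gamma> B \<Longrightarrow> raw_mctx Sg \<Theta> \<Longrightarrow> raw_vctx Sg \<Theta> \<Gamma> \<Longrightarrow> emor \<Theta> \<Gamma> \<Theta>' \<Gamma>' f g \<Longrightarrow>
   length ss = depth B \<Longrightarrow> length ts = depth B \<Longrightarrow> n \<le> depth B \<Longrightarrow>
   (\<And>j. j < n \<Longrightarrow> DT \<Theta>' \<Gamma>' (HasTy (ss ! j) (arg_types (sact_bdry f B) ss ! j))) \<Longrightarrow>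
   (\<And>j. j < n \<Longrightarrow> DT \<Theta>' \<Gamma>' (HasTy (ts ! j) (arg_types (sact_bdry g B) ts ! j))) \<Longrightarrow>
   (\<And>j. j < n \<Longrightarrow> DT \<Theta>' \<Gamma>' (JEqTm (ss ! j) (ts ! j) (arg_types (sact_bdry f B) ss ! j))) \<Longrightarrow>
   (\<forall>j\<le>n. j < depth B \<longrightarrow>
       DT \<Theta>' \<Gamma>' (JEqTy (arg_types (sact_bdry f B) ss ! j) (arg_types (sact_bdry g B) ts ! j))) \<and>
   (n = depth B \<longrightarrow> beq \<Theta>' \<Gamma>' (apply_bdry (sact_bdry f B) ss) (apply_bdry (sact_bdry g B) ts))"
proof (induction arbitrary: f g ss ts n rule: deriv_bdry.induct)
  case (b_abstr \<Theta> \<Gamma> A a B)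
  obtain s ss' where ss: "ss = s # ss'" using b_abstr.prems(4) by (cases ss) auto
  obtain t ts' where ts: "ts = t # ts'" using b_abstr.prems(5) by (cases ts) auto
  note m = b_abstr.prems(3)
  note r' = emor_raw[OF m]
  have AA: "DT \<Theta>' \<Gamma>' (JEqTy (sact f A) (sact g A))"
    using deriv_emor[OF b_abstr.hyps(1) b_abstr.prems(1,2) m] by auto
  show ?case
  proof (cases n)
    case 0
    then show ?thesis using AA ss ts by auto
  next
    case (Suc k)
    have s: "DT \<Theta>' \<Gamma>' (HasTy s (sact f A))" and t: "DT \<Theta>' \<Gamma>' (HasTy t (sact g A))"
      and st: "DT \<Theta>' \<Gamma>' (JEqTm s t (sact f A))"
      using b_abstr.prems(7-9)[of 0] Suc ss ts by auto
    have r2: "raw_vctx Sg \<Theta> (\<Gamma> @ [(a, A)])" using raw_snoc b_abstr by blast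
    have ls: "lc 0 s" "lc 0 t" using deriv_wf[OF s r'] deriv_wf[OF t r'] by (auto intro: wf_arg_lc)
    have wA: "wfe \<Theta> \<Gamma> (Ty, 0) A"
      using deriv_wf[OF b_abstr.hyps(1)] b_abstr.prems by auto
    have m': "emor \<Theta> (\<Gamma> @ [(a, A)]) \<Theta>' \<Gamma>' (upd f a s) (upd g a t)"
      using emor_upd[OF m b_abstr.prems(1,2) wA b_abstr.hyps(2) map_le_refl r'(2) s t st] .
    have aB: "a \<notin> fv_bdry B" using b_abstr.hyps by auto
    note so = sact_open[OF b_abstr.hyps(4) b_abstr.prems(1) r2 aB emor_mor(1)[OF m] ls(1)]
      sact_open[OF b_abstr.hyps(4) b_abstr.prems(1) r2 aB emor_mor(2)[OF m] ls(2)]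
    have "(\<forall>j\<le>k. j < depth B \<longrightarrow> DT \<Theta>' \<Gamma>' (JEqTy (arg_types (subst_bdry 0 s (sact_bdry f B)) ss' ! j)
          (arg_types (subst_bdry 0 t (sact_bdry g B)) ts' ! j))) \<and>
       (k = depth B \<longrightarrow> beq \<Theta>' \<Gamma>' (apply_bdry (subst_bdry 0 s (sact_bdry f B)) ss')
          (apply_bdry (subst_bdry 0 t (sact_bdry g B)) ts'))"
      using b_abstr.IH[OF b_abstr.prems(1) r2 m', of ss' ts' k, unfolded so]
        b_abstr.prems(4-6) b_abstr.prems(7-9)[of "Suc _"] Suc ss ts by simp
    then show ?thesis using AA ss ts Suc by (auto simp: nth_Cons split: nat.split)
  qed
next
  case (b_ty \<Theta> \<Gamma>)
  then show ?case by auto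
next
  case (b_tm \<Theta> \<Gamma> A)
  show ?case using beq_emor[OF deriv_bdry.b_tm[OF b_tm.hyps] b_tm.prems(1-3)] by simp
next
  case (b_eqty \<Theta> \<Gamma> A B)
  show ?case using beq_emor[OF deriv_bdry.b_eqty[OF b_eqty.hyps] b_eqty.prems(1-3)] by simp
next
  case (b_eqtm \<Theta> \<Gamma> A s t)
  show ?case using beq_emor[OF deriv_bdry.b_eqtm[OF b_eqtm.hyps] b_eqtm.prems(1-3)] by simp
qed

text \<open>Each binder becomes a variable that \<open>f\<close> sends to an entry of
  \<open>ss\<close> and \<open>g\<close> to the entry of \<open>ts\<close>; at the end
  \<open>deriv_emor\<close> applies to the unabstracted body.\<close>

lemma deriv_apply_eq:
  assumes "D \<Theta> \<Gamma> J" "raw_mctx Sg \<Theta>" "raw_vctx Sg \<Theta> \<Gamma>" "emor \<Theta> \<Gamma> \<Theta>' \<Gamma>' f g"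
    "length ss = depth J" "length ts = depth J"
    "tys \<Theta>' \<Gamma>' (jarg_types (sact_jdg f J) ss) ss" "tys \<Theta>' \<Gamma>' (jarg_types (sact_jdg g J) ts) ts"
    "eqs \<Theta>' \<Gamma>' (jarg_types (sact_jdg f J) ss) ss ts"
  shows "DT \<Theta>' \<Gamma>' (eq_jthesis (apply_jdg (sact_jdg f J) ss) (apply_jdg (sact_jdg g J) ts))"
  using assms
proof (induction ss arbitrary: \<Gamma> J f g ts)
  case Nil
  then obtain j where "J = Thesis j" by (cases J) auto
  with Nil show ?case using deriv_emor[OF Nil.prems(1-4)] by auto
next
  case (Cons s ss)
  obtain A J' where J: "J = Abstr A J'" using Cons.prems by (cases J) auto
  obtain t ts' where ts: "ts = t # ts'" using Cons.prems J by (cases ts) auto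
  note m = Cons.prems(4)
  note r' = emor_raw[OF m]
  have s: "DT \<Theta>' \<Gamma>' (HasTy s (sact f A))" and t: "DT \<Theta>' \<Gamma>' (HasTy t (sact g A))"
    and st: "DT \<Theta>' \<Gamma>' (JEqTm s t (sact f A))"
    using Cons.prems(7-9) J ts by (auto simp: tys_def eqs_def)
  from Cons.prems(1) obtain a where a: "DT \<Theta> \<Gamma> (IsTy A)" "a \<notin> names \<Gamma>" "a \<notin> fv A \<union> fv_jdg J'"
    "D \<Theta> (\<Gamma> @ [(a, A)]) (subst_jdg 0 (FVar a) J')"
    unfolding J by (cases) auto
  have r2: "raw_vctx Sg \<Theta> (\<Gamma> @ [(a, A)])" using raw_snoc Cons.prems a by blast
  have ls: "lc 0 s" "lc 0 t" using deriv_wf[OF s r'] deriv_wf[OF t r'] by (auto intro: wf_arg_lc)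
  have wA: "wfe \<Theta> \<Gamma> (Ty, 0) A" and wJ: "wf_jdg Sg (mv_arity \<Theta>) (names \<Gamma>) (Suc 0) J'"
    using deriv_wf[OF Cons.prems(1-3)] J by auto
  have m': "emor \<Theta> (\<Gamma> @ [(a, A)]) \<Theta>' \<Gamma>' (upd f a s) (upd g a t)"
    using emor_upd[OF m Cons.prems(2,3) wA a(2) map_le_refl r'(2) s t st] .
  have aJ: "a \<notin> fv_jdg J'" using a(3) by auto
  note so = sact_jdg_upd_subst[OF wJ mor_wmor[OF emor_mor(1)[OF m]] aJ ls(1)]
    sact_jdg_upd_subst[OF wJ mor_wmor[OF emor_mor(2)[OF m]] aJ ls(2)]
  show ?case
    using Cons.IH[OF a(4) Cons.prems(2) r2 m', of ts', unfolded so] Cons.prems(5-9) J ts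
    by (simp add: tys_def eqs_def)
qed

text \<open>Substituting typed arguments into a derivable abstraction gives the clauses of
  \<open>mor\<close> for arbitrary argument lists, and \<open>deriv_apply_eq\<close> with identity
  morphisms gives them for equal lists. A morphism can thus be checked entry by entry.\<close>

lemma mor_intro:
  assumes r: "raw_mctx Sg \<Theta>" "raw_mctx Sg \<Theta>'" "raw_vctx Sg \<Theta>' \<Gamma>'"
    and w: "wfm \<Theta> \<Gamma> \<Theta>' \<Gamma>' f"
    and v: "\<And>a A. map_of \<Gamma> a = Some A \<Longrightarrow> DT \<Theta>' \<Gamma>' (HasTy (fst f a) (sact f A))"
    and mv: "\<And>M B. map_of \<Theta> M = Some B \<Longrightarrow> case snd f M of
        Ren M' \<Rightarrow> map_of \<Theta>' M' = Some (sact_bdry f B) | Ins e \<Rightarrow> D \<Theta>' \<Gamma>' (fill (sact_bdry f B) e)"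
  shows "mor \<Theta> \<Gamma> \<Theta>' \<Gamma>' f"
  unfolding mor_def
proof (intro conjI allI impI)
  fix \<Delta> a A assume "map_of \<Gamma>' \<subseteq>\<^sub>m map_of \<Delta>" "raw_vctx Sg \<Theta>' \<Delta>" "map_of \<Gamma> a = Some A"
  then show "DT \<Theta>' \<Delta> (HasTy (fst f a) (sact f A))"
    using weaken_vctx[OF v r(2,3)] by blast
next
  fix \<Delta> M B ts
  assume \<Delta>: "map_of \<Gamma>' \<subseteq>\<^sub>m map_of \<Delta>" "raw_vctx Sg \<Theta>' \<Delta>" and M: "map_of \<Theta> M = Some B"
    and ts: "length ts = depth B" "tys \<Theta>' \<Delta> (arg_types (sact_bdry f B) ts) ts"
  show "DT \<Theta>' \<Delta> (fill_thesis (apply_bdry (sact_bdry f B) ts) (mapp (snd f M) ts))"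
  proof (cases "snd f M")
    case (Ren M')
    then show ?thesis using mv[OF M] ts by (auto simp: tys_nth intro!: d_meta)
  next
    case (Ins e)
    have "mv_arity \<Theta> M = Some (bdry_arity B)" using M by (simp add: mv_arity_def)
    then have "wfe \<Theta>' \<Gamma>' (bdry_arity B) e"
      using w Ins unfolding wmor_def by (cases "bdry_arity B") fastforce
    then have n: "nabs (depth (sact_bdry f B)) e" by (auto intro: wf_arg_bdry_nabs)
    show ?thesis using deriv_apply[OF _ r(2,3) \<Delta>(2,1), of "fill (sact_bdry f B) e" ts] mv[OF M] Ins ts n
      by (simp add: apply_fill jarg_types_fill)
  qed
next
  fix \<Delta> M B ss ts
  assume \<Delta>: "map_of \<Gamma>' \<subseteq>\<^sub>m map_of \<Delta>" "raw_vctx Sg \<Theta>' \<Delta>" and M: "map_of \<Theta> M = Some B" "is_object B"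
    and ts: "length ss = depth B" "length ts = depth B"
    "tys \<Theta>' \<Delta> (arg_types (sact_bdry f B) ss) ss" "tys \<Theta>' \<Delta> (arg_types (sact_bdry f B) ts) ts"
    "eqs \<Theta>' \<Delta> (arg_types (sact_bdry f B) ss) ss ts"
  show "DT \<Theta>' \<Delta>
      (fill_eq_thesis (apply_bdry (sact_bdry f B) ss) (mapp (snd f M) ss) (mapp (snd f M) ts))"
  proof (cases "snd f M")
    case (Ren M')
    then show ?thesis using mv[OF M(1)] M(2) ts by (auto simp: tys_nth eqs_nth intro!: d_meta_congr)
  next
    case (Ins e)
    have "mv_arity \<Theta> M = Some (bdry_arity B)" using M by (simp add: mv_arity_def)
    then have "wfe \<Theta>' \<Gamma>' (bdry_arity B) e"
      using w Ins unfolding wmor_def by (cases "bdry_arity B") fastforce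
    then have n: "nabs (depth (sact_bdry f B)) e" by (auto intro: wf_arg_bdry_nabs)
    have e: "emor \<Theta>' \<Gamma>' \<Theta>' \<Delta> id_morph id_morph"
      by (rule emor_refl[OF mor_id]) (use r \<Delta> in auto)
    show ?thesis
      using deriv_apply_eq[OF _ r(2,3) e, of "fill (sact_bdry f B) e" ss ts] mv[OF M(1)] Ins ts n M(2)
      by (simp add: apply_fill jarg_types_fill eq_fill_thesis is_object_apply_bdry)
  qed
qed (use r w in auto)

section \<open>Well-formed contexts, instantiations as morphisms, and equality of
  instantiations\<close>

lemma DB_simps [simp]:
  "DB \<Theta> \<Gamma> (Thesis BTy)"
  "DB \<Theta> \<Gamma> (Thesis (BTm A)) \<longleftrightarrow> DT \<Theta> \<Gamma> (IsTy A)"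
  "DB \<Theta> \<Gamma> (Thesis (BEqTy A B)) \<longleftrightarrow> DT \<Theta> \<Gamma> (IsTy A) \<and> DT \<Theta> \<Gamma> (IsTy B)"
  "DB \<Theta> \<Gamma> (Thesis (BEqTm s t A)) \<longleftrightarrow>
     DT \<Theta> \<Gamma> (IsTy A) \<and> DT \<Theta> \<Gamma> (HasTy s A) \<and> DT \<Theta> \<Gamma> (HasTy t A)"
  by (auto intro: deriv_bdry.intros elim: deriv_bdry.cases)

lemma wf_mctx_raw: "wf_mctx Sg T \<Theta> \<Longrightarrow> raw_mctx Sg \<Theta>"
proof (induction rule: wf_mctx.induct)
  case (wf_mctx_extend \<Theta> M B)
  have "wf_bdry Sg (mv_arity \<Theta>) {} 0 B"
    using deriv_bdry_wf[OF wf_mctx_extend.hyps(3) wf_mctx_extend.IH] by simp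
  then show ?case
    using wf_mctx_extend by (auto simp: raw_mctx_def nth_append less_Suc_eq)
qed (simp add: raw_mctx_def)

lemma wf_vctx_raw: "wf_vctx Sg T \<Theta> \<Gamma> \<Longrightarrow> raw_mctx Sg \<Theta> \<Longrightarrow> raw_vctx Sg \<Theta> \<Gamma>"
  by (induction rule: wf_vctx.induct) (auto intro: raw_snoc)

lemma wf_vctx_lookup:
  "wf_vctx Sg T \<Theta> \<Gamma> \<Longrightarrow> raw_mctx Sg \<Theta> \<Longrightarrow> map_of \<Gamma> a = Some A \<Longrightarrow> DT \<Theta> \<Gamma> (IsTy A)"
proof (induction arbitrary: a A rule: wf_vctx.induct)
  case (wf_vctx_extend \<Gamma> b B)
  have r: "raw_vctx Sg \<Theta> \<Gamma>" using wf_vctx_raw wf_vctx_extend by blast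
  have r2: "raw_vctx Sg \<Theta> (\<Gamma> @ [(b, B)])" using raw_snoc r wf_vctx_extend by blast
  have "DT \<Theta> \<Gamma> (IsTy A)"
    using wf_vctx_extend by (auto simp: map_of_snoc simp del: map_of_append split: if_splits)
  then show ?case
    using weaken_vctx[OF _ wf_vctx_extend.prems(1) r r2 ext_snoc[OF wf_vctx_extend.hyps(2)]] by blast
qed simp

lemma mctx_ext_take: "distinct (map fst \<Theta>) \<Longrightarrow> map_of (take n \<Theta>) \<subseteq>\<^sub>m map_of \<Theta>"
  unfolding map_le_def
  by (metis (no_types, lifting) domD in_set_takeD map_of_SomeD map_of_is_SomeI)

lemma wf_mctx_append: "wf_mctx Sg T (\<Theta> @ \<Theta>') \<Longrightarrow> wf_mctx Sg T \<Theta>"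
proof (induction \<Theta>' rule: rev_induct)
  case (snoc x xs)
  then show ?case by (auto elim: wf_mctx.cases)
qed simp

lemma wf_mctx_snoc_D: "wf_mctx Sg T (\<Theta> @ [(M, B)]) \<Longrightarrow> wf_mctx Sg T \<Theta> \<and> M \<notin> names \<Theta> \<and> DB \<Theta> [] B"
  by (erule wf_mctx.cases) auto

lemma wf_mctx_take: "wf_mctx Sg T \<Theta> \<Longrightarrow> wf_mctx Sg T (take n \<Theta>)"
  by (metis append_take_drop_id wf_mctx_append)

lemma wf_mctx_nth: "wf_mctx Sg T \<Theta> \<Longrightarrow> i < length \<Theta> \<Longrightarrow> DB (take i \<Theta>) [] (snd (\<Theta> ! i))"
  using wf_mctx_snoc_D[of "take i \<Theta>" "fst (\<Theta> ! i)" "snd (\<Theta> ! i)"] wf_mctx_take[of \<Theta> "Suc i"]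
  by (simp add: take_Suc_conv_app_nth)

lemma wf_mctx_lookup:
  assumes "wf_mctx Sg T \<Theta>" "map_of \<Theta> M = Some B" "raw_vctx Sg \<Theta> \<Gamma>"
  shows "DB \<Theta> \<Gamma> B"
proof -
  obtain i where i: "i < length \<Theta>" "\<Theta> ! i = (M, B)"
    using assms(2) map_of_SomeD in_set_conv_nth by metis
  have "mor (take i \<Theta>) [] \<Theta> \<Gamma> id_morph"
    by (rule mor_id) (use assms wf_mctx_raw[OF assms(1)] mctx_ext_take raw_mctx_distinct in auto)
  from deriv_bdry_mor[OF wf_mctx_nth[OF assms(1) i(1)] _ _ this] show ?thesis
    using wf_mctx_raw[OF wf_mctx_take[OF assms(1)]] i by simp
qed

lemma sact_eq_snoc:
  assumes "raw_mctx Sg (\<Theta> @ [(M, B)])" "map_of (\<Theta> @ [(M, B)]) M' = Some B'"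
  shows "M' = M \<and> B' = B \<or> M' \<noteq> M \<and> map_of \<Theta> M' = Some B'"
  using assms by (auto simp: raw_mctx_def map_of_snoc simp del: map_of_append split: if_splits)

text \<open>The types of an argument along \<open>f\<close> and \<open>g\<close> are equal once the
  earlier arguments are typed on both sides. So the arguments are converted from left to right, each
  of them being equal to itself.\<close>

lemma tys_conv:
  assumes B: "DB \<Theta> \<Gamma> B" "raw_mctx Sg \<Theta>" "raw_vctx Sg \<Theta> \<Gamma>" "emor \<Theta> \<Gamma> \<Theta>' \<Gamma>' f g"
    and ss: "length ss = depth B" "tys \<Theta>' \<Gamma>' (arg_types (sact_bdry f B) ss) ss"
  shows "tys \<Theta>' \<Gamma>' (arg_types (sact_bdry g B) ss) ss"
    "j < depth B \<Longrightarrow>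
        DT \<Theta>' \<Gamma>' (JEqTy (arg_types (sact_bdry f B) ss ! j) (arg_types (sact_bdry g B) ss ! j))"
    "beq \<Theta>' \<Gamma>' (apply_bdry (sact_bdry f B) ss) (apply_bdry (sact_bdry g B) ss)"
proof -
  have f: "DT \<Theta>' \<Gamma>' (HasTy (ss ! j) (arg_types (sact_bdry f B) ss ! j))" if "j < depth B" for j
    using ss that by (auto simp: tys_nth)
  have g: "n \<le> depth B \<Longrightarrow> \<forall>j<n. DT \<Theta>' \<Gamma>' (HasTy (ss ! j) (arg_types (sact_bdry g B) ss ! j))" for n
  proof (induction n)
    case (Suc n)
    have "j < n \<Longrightarrow> DT \<Theta>' \<Gamma>' (JEqTm (ss ! j) (ss ! j) (arg_types (sact_bdry f B) ss ! j))" for j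
      using f Suc.prems by (auto intro: d_tm_refl)
    then have "DT \<Theta>' \<Gamma>' (JEqTy (arg_types (sact_bdry f B) ss ! n) (arg_types (sact_bdry g B) ss ! n))"
      using deriv_bdry_emor[OF B ss(1,1), of n] f Suc by simp
    with Suc f[of n] show ?case by (auto simp: less_Suc_eq intro: d_conv_tm)
  qed simp
  then show "tys \<Theta>' \<Gamma>' (arg_types (sact_bdry g B) ss) ss"
    using ss by (auto simp: tys_nth length_arg_types)
  show "j < depth B \<Longrightarrow>
      DT \<Theta>' \<Gamma>' (JEqTy (arg_types (sact_bdry f B) ss ! j) (arg_types (sact_bdry g B) ss ! j))"
    "beq \<Theta>' \<Gamma>' (apply_bdry (sact_bdry f B) ss) (apply_bdry (sact_bdry g B) ss)"
    using deriv_bdry_emor[OF B ss(1,1), of "depth B"] f g[of "depth B"] d_tm_refl[OF f] by simp_all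
qed

lemma fill_eq_trans:
  "DT \<Theta> \<Gamma> (fill_eq_thesis b e e') \<Longrightarrow> DT \<Theta> \<Gamma> (fill_eq_thesis b e' e'') \<Longrightarrow>
   DT \<Theta> \<Gamma> (fill_eq_thesis b e e'')"
  by (cases b) (auto intro: d_ty_trans d_tm_trans)

text \<open>For the new metavariable the equation goes through \<open>e'\<close> applied to
  \<open>ss\<close>: the equation of \<open>e\<close> and \<open>e'\<close> is instantiated at
  \<open>ss\<close>, at the boundary along \<open>f\<close>, and then \<open>ss\<close> is replaced
  by \<open>ts\<close> inside \<open>e'\<close>, at the boundary along \<open>g\<close>. The
  equality of these two boundaries joins the steps.\<close>

lemma emor_snoc:
  assumes m: "emor \<Theta> [] \<Theta>' \<Gamma>' f g" and B: "DB \<Theta> [] B" and r: "raw_mctx Sg (\<Theta> @ [(M, B)])"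
      "raw_mctx Sg \<Theta>"
    and mf: "mor (\<Theta> @ [(M, B)]) [] \<Theta>' \<Gamma>' f" and mg: "mor (\<Theta> @ [(M, B)]) [] \<Theta>' \<Gamma>' g"
    and M: "snd f M = Ins e" "snd g M = Ins e'"
    and n: "nabs (depth B) e" "nabs (depth B) e'"
    and e': "D \<Theta>' \<Gamma>' (fill (sact_bdry g B) e')"
    and ee': "is_object B \<Longrightarrow> D \<Theta>' \<Gamma>' (fill_eq (sact_bdry f B) e e')"
  shows "emor (\<Theta> @ [(M, B)]) [] \<Theta>' \<Gamma>' f g"
  unfolding emor_def
proof (intro conjI allI impI)
  fix \<Delta> M' B' ss ts
  assume \<Delta>: "map_of \<Gamma>' \<subseteq>\<^sub>m map_of \<Delta>" "raw_vctx Sg \<Theta>' \<Delta>"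
    and M': "map_of (\<Theta> @ [(M, B)]) M' = Some B'" "is_object B'"
    and l: "length ss = depth B'" "length ts = depth B'"
    and ss: "tys \<Theta>' \<Delta> (arg_types (sact_bdry f B') ss) ss"
    and ts: "tys \<Theta>' \<Delta> (arg_types (sact_bdry g B') ts) ts"
    and st: "eqs \<Theta>' \<Delta> (arg_types (sact_bdry f B') ss) ss ts"
  note r' = emor_raw[OF m]
  show "DT \<Theta>' \<Delta>
      (fill_eq_thesis (apply_bdry (sact_bdry f B') ss) (mapp (snd f M') ss) (mapp (snd g M') ts))"
  proof (cases "M' = M")
    case False
    then have "map_of \<Theta> M' = Some B'" using sact_eq_snoc[OF r(1) M'(1)] by auto
    then show ?thesis using m \<Delta> M' l ss ts st unfolding emor_def by blast
  next
    case True
    then have B': "B' = B" using sact_eq_snoc[OF r(1) M'(1)] by auto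
    have 1: "DT \<Theta>' \<Delta>
        (fill_eq_thesis (apply_bdry (sact_bdry f B) ss) (apply_arg e ss) (apply_arg e' ss))"
      using deriv_apply[OF ee' r' \<Delta>(2,1), of ss] M'(2) ss l n
      by (simp add: B' apply_fill_eq jarg_types_fill_eq)
    note tc = tys_conv[OF B r(2) raw_vctx_Nil emor_ext[OF m \<Delta>] l(1)[unfolded B'] ss[unfolded B']]
    \<comment> \<open>The argument equations are given at the types along \<open>f\<close>; they are
      needed along \<open>g\<close>, where \<open>e'\<close> is derivable.\<close>
    have "DT \<Theta>' \<Delta> (JEqTm (ss ! j) (ts ! j) (arg_types (sact_bdry g B) ss ! j))" if "j < depth B" for j
      using st l tc(2)[OF that] that by (auto simp: eqs_nth B' intro: d_conv_eq)
    then have st': "eqs \<Theta>' \<Delta> (arg_types (sact_bdry g B) ss) ss ts"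
      using l by (simp add: eqs_nth B' length_arg_types)
    have "emor \<Theta>' \<Gamma>' \<Theta>' \<Delta> id_morph id_morph"
      by (rule emor_refl[OF mor_id]) (use r' \<Delta> in auto)
    from deriv_apply_eq[OF e' r' this, of ss ts]
    have 2: "DT \<Theta>' \<Delta>
        (fill_eq_thesis (apply_bdry (sact_bdry g B) ss) (apply_arg e' ss) (apply_arg e' ts))"
      using l ts st' tc(1) n M'(2)
          by (simp add: B' apply_fill jarg_types_fill eq_fill_thesis is_object_apply_bdry)
    have "is_object_thesis (apply_bdry (sact_bdry f B) ss)" using M'(2)
        by (simp add: B' is_object_apply_bdry)
    with 1 2 beq_fill_eq[OF tc(3) this]
    have "DT \<Theta>' \<Delta> (fill_eq_thesis (apply_bdry (sact_bdry f B) ss) (apply_arg e ss) (apply_arg e' ts))"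
      by (blast intro: fill_eq_trans)
    then show ?thesis by (simp add: True B' M)
  qed
qed (use mf mg in auto)

lemma inst_morph_nth:
  assumes "instantiates Sg \<Xi> \<Theta> \<Gamma> I" "distinct (map fst \<Xi>)" "i < length \<Xi>"
  shows "snd (inst_morph I) (fst (\<Xi> ! i)) = Ins (snd (I ! i))"
proof -
  have "distinct (map fst I)" using assms by (simp add: instantiates_def)
  then show ?thesis
    using distinct_map_of_nth[of I i] instantiates_fst[OF assms(1,3)]
        instantiates_length[OF assms(1)] assms(3)
    by (simp add: inst_morph_def)
qed

lemma wmor_inst_take:
  assumes "instantiates Sg \<Xi> \<Theta> \<Gamma> I" "distinct (map fst \<Xi>)"
  shows "wmor Sg (mv_arity (take n \<Xi>)) {} (mv_arity \<Theta>) (names \<Gamma>) (inst_morph I)"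
  using wmor_inst[OF assms] mv_arity_take[OF assms(2)] unfolding wmor_def by blast

text \<open>Stated for prefixes because the premises of an instantiation are established one after
  the other, each boundary depending on the earlier entries.\<close>

lemma mor_inst_take:
  assumes \<Xi>: "raw_mctx Sg \<Xi>" and r: "raw_mctx Sg \<Theta>" "raw_vctx Sg \<Theta> \<Gamma>" and I: "instantiates Sg \<Xi> \<Theta> \<Gamma> I"
    and d: "\<And>i. i < n \<Longrightarrow> i < length \<Xi> \<Longrightarrow> D \<Theta> \<Gamma> (premise \<Xi> I i)"
  shows "mor (take n \<Xi>) [] \<Theta> \<Gamma> (inst_morph I)"
proof (rule mor_intro[OF raw_mctx_take[OF \<Xi>] r])
  note di = raw_mctx_distinct[OF \<Xi>]
  show "wmor Sg (mv_arity (take n \<Xi>)) (names []) (mv_arity \<Theta>) (names \<Gamma>) (inst_morph I)"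
    using wmor_inst_take[OF I di] by simp
  fix M B assume "map_of (take n \<Xi>) M = Some B"
  then obtain i where i: "i < n" "i < length \<Xi>" "\<Xi> ! i = (M, B)"
    by (auto dest!: map_of_SomeD simp: in_set_conv_nth)
  show "case snd (inst_morph I) M of Ren M' \<Rightarrow> map_of \<Theta> M' = Some (sact_bdry (inst_morph I) B)
      | Ins e \<Rightarrow> D \<Theta> \<Gamma> (fill (sact_bdry (inst_morph I) B) e)"
    using d[OF i(1,2)] inst_morph_nth[OF I di i(2)] premise_bdry_full[OF \<Xi> I i(2)] i(3) by simp
qed simp

lemma mor_inst:
  assumes "raw_mctx Sg \<Xi>" "raw_mctx Sg \<Theta>" "raw_vctx Sg \<Theta> \<Gamma>" "instantiates Sg \<Xi> \<Theta> \<Gamma> I"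
    "\<And>i. i < length \<Xi> \<Longrightarrow> D \<Theta> \<Gamma> (premise \<Xi> I i)"
  shows "mor \<Xi> [] \<Theta> \<Gamma> (inst_morph I)"
  using mor_inst_take[OF assms(1-4), of "length \<Xi>"] assms(5) by simp

text \<open>The equality of the preceding entries is available in \<open>d'\<close> because the premises of \<open>I'\<close> are
  obtained by conversion along it.\<close>

lemma emor_inst:
  assumes \<Xi>: "wf_mctx Sg T \<Xi>" and r: "raw_mctx Sg \<Theta>" "raw_vctx Sg \<Theta> \<Gamma>"
    and I: "instantiates Sg \<Xi> \<Theta> \<Gamma> I" and I': "instantiates Sg \<Xi> \<Theta> \<Gamma> I'"
    and d: "\<And>i. i < length \<Xi> \<Longrightarrow> D \<Theta> \<Gamma> (premise \<Xi> I i)"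
    and d': "\<And>i. i < length \<Xi> \<Longrightarrow> emor (take i \<Xi>) [] \<Theta> \<Gamma> (inst_morph I) (inst_morph I') \<Longrightarrow>
      D \<Theta> \<Gamma> (premise \<Xi> I' i) \<and>
      (is_object (snd (\<Xi> ! i)) \<longrightarrow> D \<Theta> \<Gamma> (fill_eq (premise_bdry \<Xi> I i) (snd (I ! i)) (snd (I' ! i))))"
  shows "emor \<Xi> [] \<Theta> \<Gamma> (inst_morph I) (inst_morph I')"
    "i < length \<Xi> \<Longrightarrow> D \<Theta> \<Gamma> (premise \<Xi> I' i)"
    "i < length \<Xi> \<Longrightarrow> is_object (snd (\<Xi> ! i)) \<Longrightarrow>
        D \<Theta> \<Gamma> (fill_eq (premise_bdry \<Xi> I i) (snd (I ! i)) (snd (I' ! i)))"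
proof -
  note rX = wf_mctx_raw[OF \<Xi>]
  note di = raw_mctx_distinct[OF rX]
  have *: "n \<le> length \<Xi> \<Longrightarrow> emor (take n \<Xi>) [] \<Theta> \<Gamma> (inst_morph I) (inst_morph I') \<and>
    (\<forall>i<n. D \<Theta> \<Gamma> (premise \<Xi> I' i))" for n
  proof (induction n)
    case 0
    have "mor [] [] \<Theta> \<Gamma> (inst_morph I)" "mor [] [] \<Theta> \<Gamma> (inst_morph I')"
      using mor_inst_take[OF rX r I, of 0] mor_inst_take[OF rX r I', of 0] by simp_all
    then show ?case by (simp add: emor_def)
  next
    case (Suc n)
    then have m: "emor (take n \<Xi>) [] \<Theta> \<Gamma> (inst_morph I) (inst_morph I')"
      and pre: "\<forall>i<n. D \<Theta> \<Gamma> (premise \<Xi> I' i)" and n: "n < length \<Xi>" by auto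
    note dn = d'[OF n m]
    obtain M B where MB: "\<Xi> ! n = (M, B)" by fastforce
    have t: "take (Suc n) \<Xi> = take n \<Xi> @ [(M, B)]" using n MB by (simp add: take_Suc_conv_app_nth)
    have B: "DB (take n \<Xi>) [] B" using wf_mctx_nth[OF \<Xi> n] MB by simp
    have mf: "mor (take (Suc n) \<Xi>) [] \<Theta> \<Gamma> (inst_morph I)" by (rule mor_inst_take[OF rX r I d])
    have mg: "mor (take (Suc n) \<Xi>) [] \<Theta> \<Gamma> (inst_morph I')"
      by (rule mor_inst_take[OF rX r I']) (use pre dn in \<open>auto simp: less_Suc_eq\<close>)
    have "emor (take (Suc n) \<Xi>) [] \<Theta> \<Gamma> (inst_morph I) (inst_morph I')"
      unfolding t
    proof (rule emor_snoc[OF m B])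
      show "raw_mctx Sg (take n \<Xi> @ [(M, B)])" using raw_mctx_take[OF rX, of "Suc n"] t by simp
      show "raw_mctx Sg (take n \<Xi>)" by (rule raw_mctx_take[OF rX])
      show "snd (inst_morph I) M = Ins (snd (I ! n))" "snd (inst_morph I') M = Ins (snd (I' ! n))"
        using inst_morph_nth[OF I di n] inst_morph_nth[OF I' di n] MB by auto
      show "nabs (depth B) (snd (I ! n))" "nabs (depth B) (snd (I' ! n))"
        using fill_premise_wf(1)[OF I n] fill_premise_wf(1)[OF I' n] MB
        by (auto simp: premise_bdry_def act_bdry_sact)
      show "D \<Theta> \<Gamma> (fill (sact_bdry (inst_morph I') B) (snd (I' ! n)))"
        using dn premise_bdry_full[OF rX I' n] MB by simp
      show "is_object B \<Longrightarrow> D \<Theta> \<Gamma> (fill_eq (sact_bdry (inst_morph I) B) (snd (I ! n)) (snd (I' ! n)))"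
        using dn premise_bdry_full[OF rX I n] MB by simp
    qed (use mf mg t in auto)
    with dn pre show ?case by (auto simp: less_Suc_eq)
  qed
  show "emor \<Xi> [] \<Theta> \<Gamma> (inst_morph I) (inst_morph I')"
    "i < length \<Xi> \<Longrightarrow> D \<Theta> \<Gamma> (premise \<Xi> I' i)"
    using *[of "length \<Xi>"] by auto
  show "i < length \<Xi> \<Longrightarrow> is_object (snd (\<Xi> ! i)) \<Longrightarrow>
      D \<Theta> \<Gamma> (fill_eq (premise_bdry \<Xi> I i) (snd (I ! i)) (snd (I' ! i)))"
    using *[of i] d' by auto
qed

text \<open>The two filled boundaries declare their bound variable at different, but equal, types.
  So the given body is first instantiated at a variable declared at the other type and retyped by
  conversion; then the induction hypothesis compares the bodies.\<close>

lemma fill_convert: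
  "DB \<Theta> \<Gamma> B \<Longrightarrow> raw_mctx Sg \<Theta> \<Longrightarrow> raw_vctx Sg \<Theta> \<Gamma> \<Longrightarrow> emor \<Theta> \<Gamma> \<Theta>' \<Gamma>' f g \<Longrightarrow> nabs (depth B) e \<Longrightarrow>
   D \<Theta>' \<Gamma>' (fill (sact_bdry f B) e) \<longleftrightarrow> D \<Theta>' \<Gamma>' (fill (sact_bdry g B) e)"
proof (induction arbitrary: \<Gamma>' f g e rule: deriv_bdry.induct)
  case (b_abstr \<Theta> \<Gamma> A a B)
  obtain e' where e: "e = Abs e'" "nabs (depth B) e'" using b_abstr.prems(4) by (auto simp: nabs_Suc)
  define F where "F = names \<Gamma>' \<union> fv (sact f A) \<union> fv (sact g A) \<union> fv_bdry (sact_bdry f B) \<union>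
      fv_bdry (sact_bdry g B) \<union> fv e'"
  obtain b where b: "b \<notin> F" using fresh[of F] by (auto simp: F_def)
  then have b': "b \<notin> names \<Gamma>'" by (simp add: F_def)
  note m = b_abstr.prems(3)
  note r' = emor_raw[OF m]
  have fresh_b: "b \<notin> fv (sact f A) \<union> fv_jdg (fill (sact_bdry f B) e')" "b \<notin> fv (sact g A) \<union>
      fv_jdg (fill (sact_bdry g B) e')"
    using b fv_fill[of "sact_bdry f B" e'] fv_fill[of "sact_bdry g B" e'] e by (auto simp: F_def)
  \<comment> \<open>The bodies are compared over one common context, which may declare
    \<open>b\<close> at either image of \<open>A\<close>; each direction below uses the context of
    its target.\<close>
  have iff: "D \<Theta>' (\<Gamma>' @ [(b, A')]) (subst_jdg 0 (FVar b) (fill (sact_bdry f B) e')) \<longleftrightarrow>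
      D \<Theta>' (\<Gamma>' @ [(b, A')]) (subst_jdg 0 (FVar b) (fill (sact_bdry g B) e'))"
    if A': "A' = sact f A \<or> A' = sact g A" for A'
  proof -
    note o = open_emor[OF b_abstr.hyps(1,2) b_abstr.prems(1,2) m b' A']
    have aB: "a \<notin> fv_bdry B" using b_abstr.hyps(3) by auto
    have l: "lc 0 (FVar b)" by simp
    note so = sact_open[OF b_abstr.hyps(4) b_abstr.prems(1) o(2) aB emor_mor(1)[OF m] l]
      sact_open[OF b_abstr.hyps(4) b_abstr.prems(1) o(2) aB emor_mor(2)[OF m] l]
    show ?thesis
      using b_abstr.IH[OF b_abstr.prems(1) o(2,1), of "subst 0 (FVar b) e'", unfolded so] e
      by (simp add: subst_fill nabs_subst)
  qed
  note of = open_emor[OF b_abstr.hyps(1,2) b_abstr.prems(1,2) m b' disjI1[OF refl]]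
  note og = open_emor[OF b_abstr.hyps(1,2) b_abstr.prems(1,2) m b' disjI2[OF refl]]
  have ex: "map_of \<Gamma>' \<subseteq>\<^sub>m map_of (\<Gamma>' @ [(b, A')])" for A' by (rule ext_snoc[OF b'])
  have lk: "map_of (\<Gamma>' @ [(b, A')]) b = Some A'" for A' using b'
      by (simp add: map_of_snoc del: map_of_append)
  show ?case
  proof
    assume 1: "D \<Theta>' \<Gamma>' (fill (sact_bdry f (Abstr A B)) e)"
    have "DT \<Theta>' (\<Gamma>' @ [(b, sact g A)]) (HasTy (FVar b) (sact f A))"
      using d_conv_tm[OF d_var[OF lk] d_ty_sym[OF weaken_vctx[OF og(5) r' og(3) ex]]] .
    then have "D \<Theta>' (\<Gamma>' @ [(b, sact g A)]) (subst_jdg 0 (FVar b) (fill (sact_bdry f B) e'))"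
      using abstr_inst[OF _ r' og(3) ex] 1 e by simp
    then show "D \<Theta>' \<Gamma>' (fill (sact_bdry g (Abstr A B)) e)"
      using iff[of "sact g A"] og(4) fresh_b b' e by (auto intro!: d_abstr[of _ _ _ _ _ b])
  next
    assume 1: "D \<Theta>' \<Gamma>' (fill (sact_bdry g (Abstr A B)) e)"
    have "DT \<Theta>' (\<Gamma>' @ [(b, sact f A)]) (HasTy (FVar b) (sact g A))"
      using d_conv_tm[OF d_var[OF lk] weaken_vctx[OF of(5) r' of(3) ex]] .
    then have "D \<Theta>' (\<Gamma>' @ [(b, sact f A)]) (subst_jdg 0 (FVar b) (fill (sact_bdry g B) e'))"
      using abstr_inst[OF _ r' of(3) ex] 1 e by simp
    then show "D \<Theta>' \<Gamma>' (fill (sact_bdry f (Abstr A B)) e)"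
      using iff[of "sact f A"] of(4) fresh_b b' e by (auto intro!: d_abstr[of _ _ _ _ _ b])
  qed
next
  case (b_ty \<Theta> \<Gamma>)
  then show ?case by simp
next
  case (b_tm \<Theta> \<Gamma> A)
  show ?case using beq_fill[OF beq_emor[OF deriv_bdry.b_tm[OF b_tm.hyps] b_tm.prems(1-3)]] by simp
next
  case (b_eqty \<Theta> \<Gamma> A B)
  show ?case using beq_fill[OF beq_emor[OF deriv_bdry.b_eqty[OF b_eqty.hyps] b_eqty.prems(1-3)]] by simp
next
  case (b_eqtm \<Theta> \<Gamma> A s t)
  show ?case using beq_fill[OF beq_emor[OF deriv_bdry.b_eqtm[OF b_eqtm.hyps] b_eqtm.prems(1-3)]] by simp
qed

end

section \<open>Presuppositivity of finitary type theories\<close>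

locale finitary_tt = raw_tt Sg T for Sg :: "'s signature" and T :: "'s rul set" +
  assumes fin: "\<And>R. R \<in> T \<Longrightarrow> finitary_rule Sg T R"
begin

lemma thesis_bdry_fill [simp]: "thesis_bdry (fill_thesis b e) = b"
  by (cases b) auto

lemma thesis_bdry_map: "thesis_bdry (map_jthesis h j) = map_bthesis h (thesis_bdry j)"
  by (cases j) auto

text \<open>For metavariables and rules the boundary of the conclusion is an instance of a boundary
  that is derivable because the context is well formed or the rule is finitary. In a congruence rule
  the right-hand side is first derived at its own boundary and then moved along the equality of the
  two boundaries.\<close>

theorem presup: "D \<Theta> \<Gamma> J \<Longrightarrow> wf_mctx Sg T \<Theta> \<Longrightarrow> wf_vctx Sg T \<Theta> \<Gamma> \<Longrightarrow> J = Thesis j \<Longrightarrow>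
    DB \<Theta> \<Gamma> (Thesis (thesis_bdry j))"
proof (induction arbitrary: j rule: deriv.induct)
  case (d_var \<Gamma> a A \<Theta>)
  then show ?case using wf_vctx_lookup[of \<Theta> \<Gamma> a A] wf_mctx_raw[of \<Theta>] by (auto intro: b_tm)
next
  case (d_meta \<Theta> M B ts \<Gamma>)
  have r: "raw_mctx Sg \<Theta>" "raw_vctx Sg \<Theta> \<Gamma>" using d_meta.prems wf_mctx_raw wf_vctx_raw by auto
  have m: "mor \<Theta> \<Gamma> \<Theta> \<Gamma> id_morph" using r by (intro mor_id) auto
  show ?case
    using deriv_bdry_apply[OF wf_mctx_lookup[OF d_meta.prems(1) d_meta.hyps(1) r(2)] r m d_meta.hyps(2)]
      d_meta.IH d_meta.hyps d_meta.prems by (auto simp: tys_nth length_arg_types)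
next
  case (d_meta_congr \<Theta> M B ss ts \<Gamma>)
  have r: "raw_mctx Sg \<Theta>" "raw_vctx Sg \<Theta> \<Gamma>" using d_meta_congr.prems wf_mctx_raw wf_vctx_raw by auto
  have m: "mor \<Theta> \<Gamma> \<Theta> \<Gamma> id_morph" using r by (intro mor_id) auto
  have B: "DB \<Theta> \<Gamma> B" by (rule wf_mctx_lookup[OF d_meta_congr.prems(1) d_meta_congr.hyps(1) r(2)])
  have b: "DB \<Theta> \<Gamma> (Thesis (apply_bdry B ss))"
    using deriv_bdry_apply[OF B r m d_meta_congr.hyps(3)]
      d_meta_congr.IH d_meta_congr.hyps by (auto simp: tys_nth length_arg_types)
  have e: "beq \<Theta> \<Gamma> (apply_bdry B ss) (apply_bdry B ts)"
    using deriv_bdry_emor[OF B r emor_refl[OF m] d_meta_congr.hyps(3,4), of "depth B"]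
      d_meta_congr.IH by auto
  have 1: "DT \<Theta> \<Gamma> (fill_thesis (apply_bdry B ss) (MvApp M ss))"
    by (rule d_meta) (use d_meta_congr in auto)
  have "DT \<Theta> \<Gamma> (fill_thesis (apply_bdry B ts) (MvApp M ts))"
    by (rule d_meta) (use d_meta_congr in auto)
  then have 2: "DT \<Theta> \<Gamma> (fill_thesis (apply_bdry B ss) (MvApp M ts))" using beq_fill[OF e] by blast
  show ?case
    using 1 2 b d_meta_congr.prems(3) d_meta_congr.hyps(2) is_object_apply_bdry[of B ss]
    by (cases "apply_bdry B ss") (auto simp: is_object_thesis_def)
next
  case (d_rule \<Xi> J \<Theta> \<Gamma> I)
  have r: "raw_mctx Sg \<Theta>" "raw_vctx Sg \<Theta> \<Gamma>" using d_rule.prems wf_mctx_raw wf_vctx_raw by auto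
  have \<Xi>: "wf_mctx Sg T \<Xi>" "DB \<Xi> [] (Thesis (thesis_bdry J))"
    using fin[OF d_rule.hyps(1)] by (auto simp: finitary_rule_def)
  have "mor \<Xi> [] \<Theta> \<Gamma> (inst_morph I)"
    by (rule mor_inst[OF wf_mctx_raw[OF \<Xi>(1)] r d_rule.hyps(2)]) (use d_rule in auto)
  from deriv_bdry_mor[OF \<Xi>(2) wf_mctx_raw[OF \<Xi>(1)] raw_vctx_Nil this] d_rule.prems(3)
  show ?case by (auto simp: map_act_jthesis thesis_bdry_map)
next
  case (d_rule_congr \<Xi> b e \<Theta> \<Gamma> I I')
  have r: "raw_mctx Sg \<Theta>" "raw_vctx Sg \<Theta> \<Gamma>" using d_rule_congr.prems wf_mctx_raw wf_vctx_raw by auto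
  have \<Xi>: "wf_mctx Sg T \<Xi>" "DB \<Xi> [] (Thesis b)"
    using fin[OF d_rule_congr.hyps(1)] by (auto simp: finitary_rule_def)
  have rX: "raw_mctx Sg \<Xi>" by (rule wf_mctx_raw[OF \<Xi>(1)])
  have e: "emor \<Xi> [] \<Theta> \<Gamma> (inst_morph I) (inst_morph I')"
    by (rule emor_inst(1)[OF \<Xi>(1) r d_rule_congr.hyps(3,4)]) (use d_rule_congr in auto)
  have b: "DB \<Theta> \<Gamma> (Thesis (map_bthesis (act I) b))"
    using deriv_bdry_mor[OF \<Xi>(2) rX raw_vctx_Nil emor_mor(1)[OF e]] by (simp add: map_act_bthesis)
  have "beq \<Theta> \<Gamma> (map_bthesis (act I) b) (map_bthesis (act I') b)"
    using beq_emor[OF \<Xi>(2) rX raw_vctx_Nil e] by (simp add: map_act_bthesis)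
  note bf = beq_fill[OF this]
  have "DT \<Theta> \<Gamma> (map_jthesis (act I) (fill_thesis b e))"
    "DT \<Theta> \<Gamma> (map_jthesis (act I') (fill_thesis b e))"
    by (rule deriv.d_rule[OF d_rule_congr.hyps(1)]; use d_rule_congr in auto)+
  then have "DT \<Theta> \<Gamma> (fill_thesis (map_bthesis (act I) b) (act I e))"
    "DT \<Theta> \<Gamma> (fill_thesis (map_bthesis (act I) b) (act I' e))"
    using bf by (auto simp: map_fill_thesis)
  then show ?case
    using b d_rule_congr.prems(3) d_rule_congr.hyps(2)
    by (cases b) (auto simp: is_object_thesis_def)
qed (auto intro: d_conv_tm)

end

context raw_tt
begin

text \<open>Reflexivity under binders comes at once from \<open>deriv_emor\<close> for the identity
  paired with itself.\<close>

lemma fill_eq_refl: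
  assumes "D \<Theta> \<Gamma> (fill B e)" "raw_mctx Sg \<Theta>" "raw_vctx Sg \<Theta> \<Gamma>" "is_object B" "nabs (depth B) e"
  shows "D \<Theta> \<Gamma> (fill_eq B e e)"
proof -
  have "emor \<Theta> \<Gamma> \<Theta> \<Gamma> id_morph id_morph"
    by (rule emor_refl[OF mor_id]) (use assms in auto)
  from deriv_emor[OF assms(1-3) this] show ?thesis
    using eq_fill[OF assms(4,5,5), of id_morph id_morph] by simp
qed

lemma fill_eq_nonobject: "\<not> is_object B \<Longrightarrow> fill_eq B e e' = fill B e''"
proof (induction B arbitrary: e e' e'')
  case (Thesis b)
  then show ?case by (cases b) (auto simp: is_object_def is_object_thesis_def)
qed auto

end

context finitary_tt
begin

lemma presup_eq:
  assumes "DT \<Theta> \<Gamma> (fill_eq_thesis b e e')" "wf_mctx Sg T \<Theta>" "wf_vctx Sg T \<Theta> \<Gamma>" "is_object_thesis b"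
  shows "DT \<Theta> \<Gamma> (fill_thesis b e)" "DT \<Theta> \<Gamma> (fill_thesis b e')"
  using presup[OF assms(1-3) refl] assms(4) by (cases b; auto simp: is_object_thesis_def)+

text \<open>The equation is opened down to its thesis, where presuppositivity applies, and the
  result is abstracted again. The induction is on the depth because opening changes the boundary
  itself.\<close>

lemma presup_fill_eq:
  assumes "D \<Theta> \<Gamma> (fill_eq B e e')" "wf_mctx Sg T \<Theta>" "wf_vctx Sg T \<Theta> \<Gamma>" "is_object B"
    "nabs (depth B) e" "nabs (depth B) e'"
  shows "D \<Theta> \<Gamma> (fill B e')"
  using assms
proof (induction "depth B" arbitrary: B \<Gamma> e e')
  case 0
  then obtain b where "B = Thesis b" by (cases B) auto
  with 0 show ?case using presup_eq by (auto simp: is_object_def)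
next
  case (Suc n)
  then obtain A B' where B: "B = Abstr A B'" by (cases B) auto
  obtain d d' where e: "e = Abs d" "e' = Abs d'" and n: "nabs (depth B') d" "nabs (depth B') d'"
    using Suc.prems B by (auto simp: nabs_Suc)
  obtain a where a: "a \<notin> names \<Gamma> \<union> fv A \<union> fv_bdry B' \<union> fv d'"
    using fresh[of "names \<Gamma> \<union> fv A \<union> fv_bdry B' \<union> fv d'"] by auto
  have r: "raw_mctx Sg \<Theta>" "raw_vctx Sg \<Theta> \<Gamma>" using Suc.prems wf_mctx_raw wf_vctx_raw by auto
  have A: "DT \<Theta> \<Gamma> (IsTy A)" using Suc.prems(1) B by (auto intro: abstr_ty)
  have w: "wf_vctx Sg T \<Theta> (\<Gamma> @ [(a, A)])"
    using Suc.prems A a by (auto intro: wf_vctx.intros)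
  have "D \<Theta> (\<Gamma> @ [(a, A)]) (subst_jdg 0 (FVar a) (fill_eq B' d d'))"
    using abstr_open[OF _ r, of A _ a] Suc.prems(1) a B e by auto
  then have "D \<Theta> (\<Gamma> @ [(a, A)]) (fill (subst_bdry 0 (FVar a) B') (subst 0 (FVar a) d'))"
    using Suc.hyps(1)[of "subst_bdry 0 (FVar a) B'" "\<Gamma> @ [(a, A)]" "subst 0 (FVar a) d"
        "subst 0 (FVar a) d'"]
      Suc.hyps(2) Suc.prems(2,4) w n B
    by (simp add: subst_fill_eq nabs_subst)
  then have "D \<Theta> (\<Gamma> @ [(a, A)]) (subst_jdg 0 (FVar a) (fill B' d'))"
    using n by (simp add: subst_fill)
  moreover have "a \<notin> fv A \<union> fv_jdg (fill B' d')" using a fv_fill[OF n(2)] by auto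
  ultimately show ?case using A a B e by (auto intro: d_abstr[of _ _ _ _ _ a])
qed

end

section \<open>Inversion and congruence for standard theories\<close>

locale std_tt = finitary_tt Sg T for Sg :: "'s signature" and T :: "'s rul set" +
  assumes obj_rule: "\<And>R. R \<in> T \<Longrightarrow> is_object_rule R \<Longrightarrow> \<exists>S. is_symbol_rule S R"
    and sym_rule: "\<And>S. S \<in> dom Sg \<Longrightarrow> \<exists>!R. R \<in> T \<and> is_symbol_rule S R"
begin

lemma fill_thesis_inj: "fill_thesis b e = fill_thesis b' e' \<Longrightarrow> b = b'"
  by (metis thesis_bdry_fill)

lemma fill_thesis_inj_head: "fill_thesis b e = fill_thesis b' e' \<Longrightarrow> is_object_thesis b \<Longrightarrow> e = e'"
  by (cases b; cases b') (auto simp: is_object_thesis_def)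

lemma object_fill_thesis:
  assumes "is_object_thesis b"
  shows "IsTy A = fill_thesis b e \<longleftrightarrow> b = BTy \<and> e = A" "HasTy t A = fill_thesis b e \<longleftrightarrow> b = BTm A \<and> e = t"
    "JEqTy A A' \<noteq> fill_thesis b e" "JEqTm t t' A \<noteq> fill_thesis b e"
  using assms by (cases b; auto simp: is_object_thesis_def)+

text \<open>The assumption of a unique rule covers declared symbols; that \<open>S\<close> is
  declared follows from validity of the conclusion of the rule.\<close>

lemma symbol_rule_unique:
  assumes "(\<Xi>, symbol_concl S \<Xi> b) \<in> T" "(\<Xi>', symbol_concl S \<Xi>' b') \<in> T" "is_object_thesis b"
      "is_object_thesis b'"
  shows "\<Xi> = \<Xi>' \<and> b = b'"
proof -
  have "wf_jthesis Sg (mv_arity \<Xi>) {} 0 (symbol_concl S \<Xi> b)"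
    using raw_rule[OF assms(1)] by (auto simp: raw_rule_def)
  then have "wf_arg Sg (mv_arity \<Xi>) {} 0 (bthesis_cls b, 0) (SymApp S (map generic \<Xi>))"
    using assms(3) by (auto simp: symbol_concl_def dest: wf_fill_thesis_D)
  then have "S \<in> dom Sg" by (auto elim: wf_arg.cases)
  with sym_rule[of S] assms have "(\<Xi>, symbol_concl S \<Xi> b) = (\<Xi>', symbol_concl S \<Xi>' b')"
    unfolding is_symbol_rule_def by blast
  then show ?thesis by (auto simp: symbol_concl_def dest: fill_thesis_inj)
qed

lemma inst_zip: "instantiates Sg \<Xi> \<Theta> \<Gamma> I \<Longrightarrow> zip (map fst \<Xi>) (map snd I) = I"
  by (metis instantiates_def zip_map_fst_snd)

text \<open>An instantiation puts its own entries in place of the generic applications, so it can be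
  read off from the conclusion of an instance of a symbol rule. Inversion rests on this.\<close>

lemma act_generics:
  assumes "raw_mctx Sg \<Xi>" "instantiates Sg \<Xi> \<Theta> \<Gamma> I"
  shows "act I (SymApp S (map generic \<Xi>)) = SymApp S (map snd I)"
proof -
  have "map (act I) (map generic \<Xi>) = map snd I"
  proof (rule nth_equalityI)
    show "length (map (act I) (map generic \<Xi>)) = length (map snd I)"
      using instantiates_length[OF assms(2)] by simp
  next
    fix i assume "i < length (map (act I) (map generic \<Xi>))"
    then have i: "i < length \<Xi>" by simp
    obtain M B where MB: "\<Xi> ! i = (M, B)" by fastforce
    have "map_of I M = Some (snd (I ! i))"
      using inst_morph_nth[OF assms(2) raw_mctx_distinct[OF assms(1)] i] MB
      by (auto simp: inst_morph_def split: option.splits)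
    moreover have "wfe \<Theta> \<Gamma> (bdry_arity B) (snd (I ! i))"
      using assms(2) i MB by (auto simp: instantiates_def)
    ultimately show "map (act I) (map generic \<Xi>) ! i = map snd I ! i"
      using sact_generic[OF raw_sig] i MB instantiates_length[OF assms(2)] by (auto simp: act_sact)
  qed
  then show ?thesis by simp
qed

text \<open>An object judgement on a symbol application ends in an instance of a symbol rule or in a
  conversion, and transitivity carries the claim through conversions. Literal equality of the
  boundaries is kept as an alternative because reflexivity of \<open>beq\<close> would require a
  derivable type, hence well-formed contexts.\<close>

lemma inversion_sym:
  "D \<Theta> \<Gamma> J \<Longrightarrow> J = Thesis (fill_thesis b (SymApp S es)) \<Longrightarrow> is_object_thesis b \<Longrightarrow>
   \<exists>\<Xi> b0. (\<Xi>, symbol_concl S \<Xi> b0) \<in> T \<and> is_object_thesis b0 \<and> bthesis_cls b0 = bthesis_cls b \<and>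
     length es = length \<Xi> \<and> instantiates Sg \<Xi> \<Theta> \<Gamma> (zip (map fst \<Xi>) es) \<and>
     (\<forall>i<length \<Xi>. D \<Theta> \<Gamma> (fill (premise_bdry \<Xi> (zip (map fst \<Xi>) es) i) (es ! i))) \<and>
     (map_bthesis (act (zip (map fst \<Xi>) es)) b0 = b \<or>
         beq \<Theta> \<Gamma> (map_bthesis (act (zip (map fst \<Xi>) es)) b0) b)"
proof (induction arbitrary: b rule: deriv.induct)
  case (d_meta \<Theta> M B ts \<Gamma>)
  then show ?case by (cases b; cases "apply_bdry B ts") (auto simp: is_object_thesis_def)
next
  case (d_meta_congr \<Theta> M B ss ts \<Gamma>)
  then show ?case using is_object_apply_bdry[of B ss]
    by (cases b; cases "apply_bdry B ss") (auto simp: is_object_thesis_def)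
next
  case (d_conv_tm \<Theta> \<Gamma> t A B)
  then have b: "b = BTm B" "t = SymApp S es" by (cases b; auto)+
  obtain \<Xi> b0 where R: "(\<Xi>, symbol_concl S \<Xi> b0) \<in> T" "is_object_thesis b0" "bthesis_cls b0 = Tm"
    "length es = length \<Xi>" "instantiates Sg \<Xi> \<Theta> \<Gamma> (zip (map fst \<Xi>) es)"
    "\<forall>i<length \<Xi>. D \<Theta> \<Gamma> (fill (premise_bdry \<Xi> (zip (map fst \<Xi>) es) i) (es ! i))"
    and e: "map_bthesis (act (zip (map fst \<Xi>) es)) b0 = BTm A \<or>
        beq \<Theta> \<Gamma> (map_bthesis (act (zip (map fst \<Xi>) es)) b0) (BTm A)"
    using d_conv_tm.IH(1)[of "BTm A"] b by (auto simp: is_object_thesis_def)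
  have "beq \<Theta> \<Gamma> (map_bthesis (act (zip (map fst \<Xi>) es)) b0) (BTm B)"
    using e d_conv_tm.hyps(2) R(3) by (cases b0) (auto intro: d_ty_trans)
  then show ?case using R b by (intro exI[of _ \<Xi>] exI[of _ b0]) auto
next
  case (d_rule \<Xi> J \<Theta> \<Gamma> I)
  have "is_object_rule (\<Xi>, J)"
    using d_rule.prems thesis_bdry_map[of "act I" J] by (auto simp: is_object_rule_def)
  then obtain S' b0 where J: "J = symbol_concl S' \<Xi> b0" "is_object_thesis b0"
    using obj_rule[OF d_rule.hyps(1)] by (auto simp: is_symbol_rule_def)
  have "raw_mctx Sg \<Xi>" using raw_rule[OF d_rule.hyps(1)] by (auto simp: raw_rule_def)
  note g = act_generics[OF this d_rule.hyps(2)]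
  \<comment> \<open>Comparing the heads of the two judgements identifies the symbol and shows that
    \<open>I\<close> consists of the arguments \<open>es\<close>.\<close>
  have "fill_thesis (map_bthesis (act I) b0) (SymApp S' (map snd I)) = fill_thesis b (SymApp S es)"
    using d_rule.prems(1) by (simp only: J symbol_concl_def map_fill_thesis g abstracted.inject)
  then have b: "map_bthesis (act I) b0 = b" "S' = S" "es = map snd I"
    using fill_thesis_inj fill_thesis_inj_head J(2) by (fastforce, fastforce, fastforce)
  have l: "length I = length \<Xi>" by (rule instantiates_length[OF d_rule.hyps(2)])
  show ?case
    using d_rule J b l inst_zip[OF d_rule.hyps(2)] by (intro exI[of _ \<Xi>] exI[of _ b0]) auto
next
  case (d_rule_congr \<Xi> b' e \<Theta> \<Gamma> I I')
  then show ?case by (cases b; cases b') (auto simp: is_object_thesis_def)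
qed (simp_all add: object_fill_thesis)

text \<open>As for symbols: a rule instance cannot end in an object judgement on a metavariable
  application, because object rules of a standard theory conclude with a symbol.\<close>

lemma inversion_mv:
  "D \<Theta> \<Gamma> J \<Longrightarrow> J = Thesis (fill_thesis b (MvApp M ts)) \<Longrightarrow> is_object_thesis b \<Longrightarrow>
   \<exists>B. map_of \<Theta> M = Some B \<and> is_object B \<and> length ts = depth B \<and> tys \<Theta> \<Gamma> (arg_types B ts) ts \<and>
     (apply_bdry B ts = b \<or> beq \<Theta> \<Gamma> (apply_bdry B ts) b)"
proof (induction arbitrary: b rule: deriv.induct)
  case (d_meta \<Theta> M' B ts' \<Gamma>)
  then have "fill_thesis (apply_bdry B ts') (MvApp M' ts') = fill_thesis b (MvApp M ts)" by simp
  then have "apply_bdry B ts' = b" "M' = M" "ts' = ts"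
    using fill_thesis_inj fill_thesis_inj_head d_meta.prems(2)
        by (metis, metis expr.inject(4), metis expr.inject(4))
  then show ?case using d_meta is_object_apply_bdry[of B ts]
    by (intro exI[of _ B]) (auto simp: tys_nth length_arg_types)
next
  case (d_meta_congr \<Theta> M B ss ts \<Gamma>)
  then show ?case using is_object_apply_bdry[of B ss]
    by (cases b; cases "apply_bdry B ss") (auto simp: is_object_thesis_def)
next
  case (d_conv_tm \<Theta> \<Gamma> t A B)
  then have b: "b = BTm B" "t = MvApp M ts" by (cases b; auto)+
  obtain B' where R: "map_of \<Theta> M = Some B'" "is_object B'" "length ts = depth B'"
      "tys \<Theta> \<Gamma> (arg_types B' ts) ts"
    and e: "apply_bdry B' ts = BTm A \<or> beq \<Theta> \<Gamma> (apply_bdry B' ts) (BTm A)"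
    using d_conv_tm.IH(1)[of "BTm A"] b by (auto simp: is_object_thesis_def)
  have "beq \<Theta> \<Gamma> (apply_bdry B' ts) (BTm B)"
    using e d_conv_tm.hyps(2) by (cases "apply_bdry B' ts") (auto intro: d_ty_trans)
  then show ?case using R b by (intro exI[of _ B']) auto
next
  case (d_rule \<Xi> J \<Theta> \<Gamma> I)
  have "is_object_rule (\<Xi>, J)"
    using d_rule.prems thesis_bdry_map[of "act I" J] by (auto simp: is_object_rule_def)
  then obtain S' b0 where J: "J = symbol_concl S' \<Xi> b0" "is_object_thesis b0"
    using obj_rule[OF d_rule.hyps(1)] by (auto simp: is_symbol_rule_def)
  then show ?case
    using d_rule.prems by (cases b; cases b0) (auto simp: symbol_concl_def is_object_thesis_def)
next
  case (d_rule_congr \<Xi> b' e \<Theta> \<Gamma> I I')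
  then show ?case by (cases b; cases b') (auto simp: is_object_thesis_def)
qed (simp_all add: object_fill_thesis)

lemma head_bdrys_object: "head_bdrys T \<Theta> h es (bthesis_cls b) Bs \<Longrightarrow> is_object_thesis b"
  by (erule head_bdrys.cases) (auto simp: is_object_def is_object_thesis_def)

text \<open>The boundaries \<open>Bs\<close> are computed from a rule for the head, and inversion
  produces a rule as well; uniqueness of the symbol rule identifies the two. For a metavariable both
  are read from its declaration.\<close>

lemma head_inv:
  assumes h: "head_bdrys T \<Theta> h es (bthesis_cls b) Bs" and d: "DT \<Theta> \<Gamma> (fill_thesis b (happ h es))"
    and r: "raw_mctx Sg \<Theta>" "raw_vctx Sg \<Theta> \<Gamma>"
  shows "length Bs = length es \<and> (\<forall>i<length es. D \<Theta> \<Gamma> (fill (Bs ! i) (es ! i)) \<and>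
    wfe \<Theta> \<Gamma> (bdry_arity (Bs ! i)) (es ! i))"
  using h
proof cases
  case (head_sym \<Xi> S b')
  obtain \<Xi>' b0 where R: "(\<Xi>', symbol_concl S \<Xi>' b0) \<in> T" "is_object_thesis b0"
    "instantiates Sg \<Xi>' \<Theta> \<Gamma> (zip (map fst \<Xi>') es)"
    "\<forall>i<length \<Xi>'. D \<Theta> \<Gamma> (fill (premise_bdry \<Xi>' (zip (map fst \<Xi>') es) i) (es ! i))"
    using inversion_sym[OF d _ head_bdrys_object[OF h], of S es] head_sym by auto
  have \<Xi>: "\<Xi>' = \<Xi>" using symbol_rule_unique[OF R(1) _ R(2)] head_sym by blast
  show ?thesis
    using R head_sym fill_premise_wf(2)[OF R(3)] unfolding \<Xi> by auto
next
  case (head_mv M B)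
  obtain B' where R: "map_of \<Theta> M = Some B'" "length es = depth B'" "tys \<Theta> \<Gamma> (arg_types B' es) es"
    using inversion_mv[OF d _ head_bdrys_object[OF h], of M es] head_mv by auto
  have "DT \<Theta> \<Gamma> (HasTy (es ! i) (arg_types B es ! i))" if "i < length es" for i
    using R head_mv that by (auto simp: tys_nth)
  with deriv_wf[OF this r] show ?thesis
    using head_mv by (auto simp: length_arg_types bdry_arity_def)
qed

text \<open>Equality of the earlier arguments identifies the two boundaries of the next one, so the
  arguments are compared in order. Two uses shape the hypotheses. In a reduction the right-hand
  application is not yet known to be derivable, so \<open>wf'\<close> accepts arguments of the right
  arity. In a check it is derivable, and \<open>eq\<close> may then rely on its arguments at the
  left-hand boundaries. In both cases presuppositivity of the equation types the right-hand
  argument.\<close>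

lemma head_congr:
  assumes w: "wf_mctx Sg T \<Theta>" "wf_vctx Sg T \<Theta> \<Gamma>" and h: "head_bdrys T \<Theta> h es (bthesis_cls b) Bs"
    and d: "DT \<Theta> \<Gamma> (fill_thesis b (happ h es))" and l: "length es' = length es"
    and wf': "DT \<Theta> \<Gamma> (fill_thesis b (happ h es')) \<or>
      (\<forall>i<length es. wfe \<Theta> \<Gamma> (bdry_arity (Bs ! i)) (es' ! i))"
    and eq: "\<And>i. i < length es \<Longrightarrow> is_object (Bs ! i) \<Longrightarrow>
      (DT \<Theta> \<Gamma> (fill_thesis b (happ h es')) \<longrightarrow> D \<Theta> \<Gamma> (fill (Bs ! i) (es' ! i))) \<Longrightarrow>
      D \<Theta> \<Gamma> (fill_eq (Bs ! i) (es ! i) (es' ! i))"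
    and ne: "\<And>i. i < length es \<Longrightarrow> \<not> is_object (Bs ! i) \<Longrightarrow> es' ! i = es ! i"
  shows "DT \<Theta> \<Gamma> (fill_eq_thesis b (happ h es) (happ h es'))"
  using h
proof cases
  case (head_sym \<Xi> S b')
  note r = wf_mctx_raw[OF w(1)] wf_vctx_raw[OF w(2) wf_mctx_raw[OF w(1)]]
  define I I' where I: "I = zip (map fst \<Xi>) es" and I': "I' = zip (map fst \<Xi>) es'"
  have ob: "is_object_thesis b" by (rule head_bdrys_object[OF h])
  have inv: "instantiates Sg \<Xi> \<Theta> \<Gamma> (zip (map fst \<Xi>) us)"
    "\<forall>i<length \<Xi>. D \<Theta> \<Gamma> (fill (premise_bdry \<Xi> (zip (map fst \<Xi>) us) i) (us ! i))"
    "map_bthesis (act (zip (map fst \<Xi>) us)) b' = b \<or>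
        beq \<Theta> \<Gamma> (map_bthesis (act (zip (map fst \<Xi>) us)) b') b"
    if us: "DT \<Theta> \<Gamma> (fill_thesis b (SymApp S us))" for us
  proof -
    obtain \<Xi>' b0 where R: "(\<Xi>', symbol_concl S \<Xi>' b0) \<in> T" "is_object_thesis b0"
      "instantiates Sg \<Xi>' \<Theta> \<Gamma> (zip (map fst \<Xi>') us)"
      "\<forall>i<length \<Xi>'. D \<Theta> \<Gamma> (fill (premise_bdry \<Xi>' (zip (map fst \<Xi>') us) i) (us ! i))"
      "map_bthesis (act (zip (map fst \<Xi>') us)) b0 = b \<or>
          beq \<Theta> \<Gamma> (map_bthesis (act (zip (map fst \<Xi>') us)) b0) b"
      using inversion_sym[OF us refl ob] by auto
    have \<Xi>: "\<Xi>' = \<Xi>" "b0 = b'" using symbol_rule_unique[OF R(1) _ R(2)] head_sym by blast+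
    show "instantiates Sg \<Xi> \<Theta> \<Gamma> (zip (map fst \<Xi>) us)"
      "\<forall>i<length \<Xi>. D \<Theta> \<Gamma> (fill (premise_bdry \<Xi> (zip (map fst \<Xi>) us) i) (us ! i))"
      "map_bthesis (act (zip (map fst \<Xi>) us)) b' = b \<or>
          beq \<Theta> \<Gamma> (map_bthesis (act (zip (map fst \<Xi>) us)) b') b"
      using R \<Xi> by auto
  qed
  have Bs: "Bs ! i = premise_bdry \<Xi> I i" if "i < length \<Xi>" for i using head_sym that by (simp add: I)
  have sI: "snd (I ! i) = es ! i" "snd (I' ! i) = es' ! i" if "i < length \<Xi>" for i
    using head_sym that l by (auto simp: I I')
  have inI: "instantiates Sg \<Xi> \<Theta> \<Gamma> I" using inv(1) d head_sym by (simp add: I)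
  have pI: "\<And>i. i < length \<Xi> \<Longrightarrow> D \<Theta> \<Gamma> (premise \<Xi> I i)"
    using inv(2)[of es] d head_sym sI by (simp add: I)
  have inI': "instantiates Sg \<Xi> \<Theta> \<Gamma> I'"
    using wf'
  proof
    assume "DT \<Theta> \<Gamma> (fill_thesis b (happ h es'))"
    then show ?thesis using inv(1) head_sym by (simp add: I')
  next
    assume "\<forall>i<length es. wfe \<Theta> \<Gamma> (bdry_arity (Bs ! i)) (es' ! i)"
    then show ?thesis using head_sym l
      by (auto simp: instantiates_def I' Bs premise_bdry_def act_bdry_sact)
  qed
  have \<Xi>: "wf_mctx Sg T \<Xi>" using fin[OF head_sym(4)] by (simp add: finitary_rule_def)
  note rX = wf_mctx_raw[OF \<Xi>]
  have step: "D \<Theta> \<Gamma> (premise \<Xi> I' i) \<and>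
      (is_object (snd (\<Xi> ! i)) \<longrightarrow> D \<Theta> \<Gamma> (fill_eq (premise_bdry \<Xi> I i) (snd (I ! i)) (snd (I' ! i))))"
    if i: "i < length \<Xi>" and m: "emor (take i \<Xi>) [] \<Theta> \<Gamma> (inst_morph I) (inst_morph I')" for i
  proof -
    have n: "nabs (depth (snd (\<Xi> ! i))) (es ! i)" "nabs (depth (snd (\<Xi> ! i))) (es' ! i)"
      using fill_premise_wf(1)[OF inI i] fill_premise_wf(1)[OF inI' i] sI[OF i]
      by (auto simp: premise_bdry_def act_bdry_sact)
    \<comment> \<open>Both premise boundaries are images of one derivable boundary, under morphisms
      that are equal on the preceding metavariables.\<close>
    have "D \<Theta> \<Gamma> (fill (premise_bdry \<Xi> I i) e) \<longleftrightarrow> D \<Theta> \<Gamma> (fill (premise_bdry \<Xi> I' i) e)"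
      if "nabs (depth (snd (\<Xi> ! i))) e" for e
      using fill_convert[OF wf_mctx_nth[OF \<Xi> i] raw_mctx_take[OF rX] raw_vctx_Nil m that]
      by (simp add: premise_bdry_full[OF rX inI i] premise_bdry_full[OF rX inI' i])
    note conv = this[OF n(1)] this[OF n(2)]
    have ob: "is_object (Bs ! i) = is_object (snd (\<Xi> ! i))"
      using Bs[OF i] by (simp add: premise_bdry_def act_bdry_sact)
    show ?thesis
    proof (cases "is_object (snd (\<Xi> ! i))")
      case True
      have "DT \<Theta> \<Gamma> (fill_thesis b (happ h es')) \<longrightarrow> D \<Theta> \<Gamma> (fill (Bs ! i) (es' ! i))"
        using inv(2)[of es'] i conv(2) head_sym(1) by (simp add: I'[symmetric] Bs)
      then have 1: "D \<Theta> \<Gamma> (fill_eq (premise_bdry \<Xi> I i) (es ! i) (es' ! i))"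
        using eq[of i] i True ob head_sym by (simp add: I)
      \<comment> \<open>The equation presupposes its right-hand side at the left-hand boundary;
        \<open>conv\<close> then turns this into the premise of \<open>I'\<close>.\<close>
      have "D \<Theta> \<Gamma> (fill (premise_bdry \<Xi> I i) (es' ! i))"
        by (rule presup_fill_eq[OF 1 w]) (use True n in \<open>auto simp: premise_bdry_def act_bdry_sact\<close>)
      then show ?thesis using 1 conv(2) by (simp add: sI[OF i])
    next
      case False
      then have "es' ! i = es ! i" using ne[of i] i ob head_sym by simp
      then show ?thesis using False pI[OF i] conv(1) by (simp add: sI[OF i])
    qed
  qed
  note em = emor_inst[OF \<Xi> r inI inI' pI step]
  have ob': "is_object_thesis b'" using head_sym by simp
  have "DT \<Theta> \<Gamma>
      (fill_eq_thesis (map_bthesis (act I) b') (act I (SymApp S (map generic \<Xi>)))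
      (act I' (SymApp S (map generic \<Xi>))))"
    by (rule d_rule_congr[OF head_sym(4)[unfolded symbol_concl_def] ob' inI inI'])
      (use pI em(2,3) in auto)
  moreover have "map snd I = es" "map snd I' = es'" using head_sym l by (auto simp: I I')
  ultimately have "DT \<Theta> \<Gamma> (fill_eq_thesis (map_bthesis (act I) b') (SymApp S es) (SymApp S es'))"
    using act_generics[OF rX inI] act_generics[OF rX inI'] by simp
  then show ?thesis
    using inv(3)[of es] d head_sym beq_fill_eq ob' by (auto simp: I)
next
  case (head_mv M B)
  note r = wf_mctx_raw[OF w(1)] wf_vctx_raw[OF w(2) wf_mctx_raw[OF w(1)]]
  have ob: "is_object_thesis b" by (rule head_bdrys_object[OF h])
  have inv: "tys \<Theta> \<Gamma> (arg_types B us) us" "apply_bdry B us = b \<or> beq \<Theta> \<Gamma> (apply_bdry B us) b"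
    if us: "DT \<Theta> \<Gamma> (fill_thesis b (MvApp M us))" for us
    using inversion_mv[OF us refl ob] head_mv by auto
  have m: "emor \<Theta> \<Gamma> \<Theta> \<Gamma> id_morph id_morph" by (rule emor_refl[OF mor_id]) (use r in auto)
  have B: "DB \<Theta> \<Gamma> B" by (rule wf_mctx_lookup[OF w(1) _ r(2)]) (use head_mv in auto)
  have le: "length es = depth B" "length es' = depth B" using head_mv l by auto
  have t: "DT \<Theta> \<Gamma> (HasTy (es ! j) (arg_types B es ! j))" if "j < depth B" for j
    using inv(1) d head_mv that by (auto simp: tys_nth)
  \<comment> \<open>The same argument for a metavariable: the two types of argument \<open>n\<close>
    are equal once the arguments before it are typed and equal.\<close>
  have "n \<le> depth B \<Longrightarrow> \<forall>j<n. DT \<Theta> \<Gamma> (HasTy (es' ! j) (arg_types B es' ! j)) \<and>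
      DT \<Theta> \<Gamma> (JEqTm (es ! j) (es' ! j) (arg_types B es ! j))" for n
  proof (induction n)
    case (Suc n)
    have AA: "DT \<Theta> \<Gamma> (JEqTy (arg_types B es ! n) (arg_types B es' ! n))"
      using deriv_bdry_emor[OF B r m le, of n] Suc t by simp
    have "DT \<Theta> \<Gamma> (fill_thesis b (happ h es')) \<longrightarrow> D \<Theta> \<Gamma> (fill (Bs ! n) (es' ! n))"
      using inv(1)[of es'] head_mv d_conv_tm[OF _ d_ty_sym[OF AA]] Suc.prems le
      by (auto simp: tys_nth length_arg_types)
    then have 1: "DT \<Theta> \<Gamma> (JEqTm (es ! n) (es' ! n) (arg_types B es ! n))"
      using eq[of n] head_mv Suc.prems le
          by (simp add: length_arg_types is_object_def is_object_thesis_def)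
    then have "DT \<Theta> \<Gamma> (HasTy (es' ! n) (arg_types B es ! n))"
      using presup[OF _ w] by fastforce
    then show ?case using 1 Suc d_conv_tm[OF _ AA] by (auto simp: less_Suc_eq)
  qed simp
  from this[of "depth B"] have "DT \<Theta> \<Gamma> (fill_eq_thesis (apply_bdry B es) (MvApp M es) (MvApp M es'))"
    using head_mv le t by (intro d_meta_congr) auto
  then show ?thesis
    using inv(2)[of es] d head_mv beq_fill_eq is_object_apply_bdry[of B es] by auto
qed

text \<open>Inversion compares both types with the one type that the symbol rule assigns to the
  arguments \<open>es\<close>. Where it returns literal equality, presuppositivity supplies the
  reflexivity of the type.\<close>

lemma unique_type_sym:
  assumes "DT \<Theta> \<Gamma> (HasTy (SymApp S es) A)" "DT \<Theta> \<Gamma> (HasTy (SymApp S es) A')"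
    "wf_mctx Sg T \<Theta>" "wf_vctx Sg T \<Theta> \<Gamma>"
  shows "DT \<Theta> \<Gamma> (JEqTy A A')"
proof -
  have *: "\<exists>\<Xi> B. (\<Xi>, symbol_concl S \<Xi> (BTm B)) \<in> T \<and> DT \<Theta> \<Gamma> (JEqTy (act (zip (map fst \<Xi>) es) B) A)"
    if t: "DT \<Theta> \<Gamma> (HasTy (SymApp S es) A)" for A
  proof -
    have ob: "is_object_thesis (BTm A)" by (simp add: is_object_thesis_def)
    have t': "Thesis (HasTy (SymApp S es) A) = Thesis (fill_thesis (BTm A) (SymApp S es))" by simp
    obtain \<Xi> b0 where R: "(\<Xi>, symbol_concl S \<Xi> b0) \<in> T" "bthesis_cls b0 = Tm"
      "map_bthesis (act (zip (map fst \<Xi>) es)) b0 = BTm A \<or>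
          beq \<Theta> \<Gamma> (map_bthesis (act (zip (map fst \<Xi>) es)) b0) (BTm A)"
      using inversion_sym[OF t t' ob] by auto
    have "DT \<Theta> \<Gamma> (JEqTy A A)" using presup[OF t assms(3,4) refl] by (auto intro: d_ty_refl)
    then show ?thesis using R by (cases b0) auto
  qed
  obtain \<Xi> B where 1: "(\<Xi>, symbol_concl S \<Xi> (BTm B)) \<in> T"
      "DT \<Theta> \<Gamma> (JEqTy (act (zip (map fst \<Xi>) es) B) A)"
    using *[OF assms(1)] by auto
  obtain \<Xi>' B' where 2: "(\<Xi>', symbol_concl S \<Xi>' (BTm B')) \<in> T"
      "DT \<Theta> \<Gamma> (JEqTy (act (zip (map fst \<Xi>') es) B') A')"
    using *[OF assms(2)] by auto
  have "\<Xi>' = \<Xi> \<and> BTm B' = BTm B"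
    using symbol_rule_unique[OF 2(1) 1(1)] by (simp add: is_object_thesis_def)
  with 1 2 show ?thesis by (auto intro: d_ty_trans d_ty_sym)
qed

lemma natural_type_sym:
  assumes "(\<Xi>, symbol_concl S \<Xi> (BTm B)) \<in> T"
  shows "natural_type T \<Theta> \<Gamma> (SymApp S es) = act (zip (map fst \<Xi>) es) B"
proof -
  have "\<Xi>' = \<Xi> \<and> B' = B" if "(\<Xi>', symbol_concl S \<Xi>' (BTm B')) \<in> T" for \<Xi>' B'
    using symbol_rule_unique[OF that assms] by (simp add: is_object_thesis_def)
  then show ?thesis unfolding natural_type.simps
    by (intro the_equality) (use assms in blast)+
qed

end

section \<open>Object-invertible rules\<close>

text \<open>To apply object-invertibility over a nonempty variable context, the variables are turned into
  metavariables. At the same time all metavariables are renamed above \<open>K\<close>, away from the rule.\<close>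

definition pm :: "nat \<Rightarrow> mvar \<Rightarrow> mvar" where
  "pm K M = K + 2 * M"

definition pf :: "nat \<Rightarrow> fvar \<Rightarrow> mvar" where
  "pf K a = K + (2 * a + 1)"

definition prom :: "nat \<Rightarrow> 's morph" where
  "prom K = (\<lambda>a. MvApp (pf K a) [], \<lambda>M. Ren (pm K M))"

text \<open>Names below \<open>K\<close> belong to the rule and receive the arguments from
  \<open>I\<close>; from \<open>K\<close> upwards the parity of the offset tells promoted
  metavariables from promoted variables. So this morphism undoes the promotion and instantiates the
  rule at the same time.\<close>

definition unprom :: "nat \<Rightarrow> 's inst \<Rightarrow> 's morph" where
  "unprom K I = (FVar, \<lambda>M. if M < K then Ins (the (map_of I M)) else
     if even (M - K) then Ren ((M - K) div 2) else Ins (FVar ((M - K) div 2)))"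

text \<open>Variables come after the metavariables, since their types mention these, and become
  nullary term metavariables in their original order.\<close>

definition promote :: "nat \<Rightarrow> 's mctx \<Rightarrow> 's vctx \<Rightarrow> 's mctx" where
  "promote K \<Theta> \<Gamma> = map (\<lambda>(M, B). (pm K M, sact_bdry (prom K) B)) \<Theta> @
     map (\<lambda>(a, A). (pf K a, Thesis (BTm (sact (prom K) A)))) \<Gamma>"

lemma p_simps [simp]: "pm K M = pm K M' \<longleftrightarrow> M = M'" "pf K a = pf K a' \<longleftrightarrow> a = a'" "pm K M \<noteq> pf K a"
    "pf K a \<noteq> pm K M"
  unfolding pm_def pf_def by presburger+

lemma unprom_p [simp]: "snd (unprom K I) (pm K M) = Ren M" "snd (unprom K I) (pf K a) = Ins (FVar a)"
  by (auto simp: unprom_def pm_def pf_def)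

lemma comp_unprom_prom: "comp_morph (unprom K I) (prom K) = id_morph"
  by (auto simp: comp_morph_def prom_def)

lemma map_of_promote [simp]:
  "map_of (promote K \<Theta> \<Gamma>) (pm K M) = map_option (sact_bdry (prom K)) (map_of \<Theta> M)"
  "map_of (promote K \<Theta> \<Gamma>) (pf K a) = map_option (\<lambda>A. Thesis (BTm (sact (prom K) A))) (map_of \<Gamma> a)"
proof -
  have 1: "map_of (map (\<lambda>(a, A). (pf K a, Thesis (BTm (sact (prom K) A)))) \<Gamma>) (pm K M) = None"
    by (induction \<Gamma>) auto
  have 2: "map_of (map (\<lambda>(a, A). (pf K a, Thesis (BTm (sact (prom K) A)))) \<Gamma>) (pf K a) =
      map_option (\<lambda>A. Thesis (BTm (sact (prom K) A))) (map_of \<Gamma> a)"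
    by (induction \<Gamma>) auto
  show "map_of (promote K \<Theta> \<Gamma>) (pm K M) = map_option (sact_bdry (prom K)) (map_of \<Theta> M)"
    unfolding promote_def by (induction \<Theta>) (auto simp: 1)
  show "map_of (promote K \<Theta> \<Gamma>) (pf K a) = map_option (\<lambda>A. Thesis (BTm (sact (prom K) A))) (map_of \<Gamma> a)"
    unfolding promote_def by (induction \<Theta>) (auto simp: 2)
qed

lemma promote_lookup:
  assumes "map_of (promote K \<Theta> \<Gamma>) N = Some B"
  obtains (mv) M B' where "N = pm K M" "map_of \<Theta> M = Some B'" "B = sact_bdry (prom K) B'"
  | (fv) a A where "N = pf K a" "map_of \<Gamma> a = Some A" "B = Thesis (BTm (sact (prom K) A))"
proof -
  have "N \<in> range (pm K) \<union> range (pf K)"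
    using map_of_SomeD[OF assms] by (auto simp: promote_def)
  then show thesis using assms mv fv by auto
qed

lemma wmor_prom: "wmor Sg (mv_arity \<Theta>) (names \<Gamma>) (mv_arity (promote K \<Theta> \<Gamma>)) {} (prom K)"
  unfolding wmor_def
proof (intro conjI ballI allI impI)
  fix a assume "a \<in> names \<Gamma>"
  then obtain A where "map_of \<Gamma> a = Some A" by (metis map_of_eq_None_iff not_None_eq set_map)
  then have "mv_arity (promote K \<Theta> \<Gamma>) (pf K a) = Some (Tm, 0)"
    by (simp add: mv_arity_def bdry_arity_def)
  then show "wf_arg Sg (mv_arity (promote K \<Theta> \<Gamma>)) {} 0 (Tm, 0) (fst (prom K) a)"
    by (auto simp: prom_def intro: wf_arg.intros)
qed (auto simp: prom_def mv_arity_def)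

section \<open>Promotion as a morphism, and derivability of matching instantiations\<close>

context raw_tt
begin

lemma mor_prom:
  assumes "raw_mctx Sg \<Theta>" "raw_mctx Sg (promote K \<Theta> \<Gamma>)"
  shows "mor \<Theta> \<Gamma> (promote K \<Theta> \<Gamma>) [] (prom K)"
proof (rule mor_intro[OF assms raw_vctx_Nil])
  show "wmor Sg (mv_arity \<Theta>) (names \<Gamma>) (mv_arity (promote K \<Theta> \<Gamma>)) (names []) (prom K)"
    using wmor_prom by simp
next
  fix a A assume "map_of \<Gamma> a = Some A"
  then have "DT (promote K \<Theta> \<Gamma>) []
      (fill_thesis (apply_bdry (Thesis (BTm (sact (prom K) A))) []) (MvApp (pf K a) []))"
    by (intro d_meta) auto
  then show "DT (promote K \<Theta> \<Gamma>) [] (HasTy (fst (prom K) a) (sact (prom K) A))"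
    by (simp add: prom_def)
qed (simp add: prom_def)

lemma names_map_of: "N \<notin> names xs \<longleftrightarrow> map_of xs N = None"
  by (simp add: map_of_eq_None_iff)

lemma wf_promote_mctx: "wf_mctx Sg T \<Theta> \<Longrightarrow> wf_mctx Sg T (promote K \<Theta> [])"
proof (induction rule: wf_mctx.induct)
  case wf_mctx_empty
  then show ?case by (simp add: promote_def wf_mctx.intros)
next
  case (wf_mctx_extend \<Theta> M B)
  have "DB (promote K \<Theta> []) [] (sact_bdry (prom K) B)"
    by (rule deriv_bdry_mor[OF wf_mctx_extend.hyps(3) _ raw_vctx_Nil mor_prom])
      (use wf_mctx_extend wf_mctx_raw in auto)
  moreover have "promote K (\<Theta> @ [(M, B)]) [] = promote K \<Theta> [] @ [(pm K M, sact_bdry (prom K) B)]"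
    by (simp add: promote_def)
  moreover have "pm K M \<notin> names (promote K \<Theta> [])"
    using wf_mctx_extend.hyps(2) unfolding names_map_of by simp
  ultimately show ?case using wf_mctx_extend.IH by (auto intro: wf_mctx.wf_mctx_extend)
qed

lemma wf_promote: "wf_vctx Sg T \<Theta> \<Gamma> \<Longrightarrow> wf_mctx Sg T \<Theta> \<Longrightarrow> wf_mctx Sg T (promote K \<Theta> \<Gamma>)"
proof (induction rule: wf_vctx.induct)
  case wf_vctx_empty
  then show ?case by (rule wf_promote_mctx)
next
  case (wf_vctx_extend \<Gamma> a A)
  note r = wf_mctx_raw[OF wf_vctx_extend.prems]
  have "D (promote K \<Theta> \<Gamma>) [] (sact_jdg (prom K) (Thesis (IsTy A)))"
    by (rule deriv_mor[OF wf_vctx_extend.hyps(3) r _ mor_prom])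
      (use wf_vctx_extend wf_mctx_raw wf_vctx_raw in auto)
  then have "DB (promote K \<Theta> \<Gamma>) [] (Thesis (BTm (sact (prom K) A)))" by simp
  moreover have "promote K \<Theta> (\<Gamma> @ [(a, A)]) = promote K \<Theta> \<Gamma> @
      [(pf K a, Thesis (BTm (sact (prom K) A)))]"
    by (simp add: promote_def)
  moreover have "pf K a \<notin> names (promote K \<Theta> \<Gamma>)"
    using wf_vctx_extend.hyps(2) unfolding names_map_of by simp
  ultimately show ?case using wf_vctx_extend by (auto intro: wf_mctx.wf_mctx_extend)
qed

text \<open>The residue is well formed, so its equational premises can be discharged one after the other:
  the sides of each of them are derivable once the preceding ones are.\<close>

theorem object_invertible_derivable:
  assumes oi: "object_invertible Sg T (\<Xi>, J)" and w: "wf_mctx Sg T \<Theta>" "wf_vctx Sg T \<Theta> \<Gamma>"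
    and I: "instantiates Sg \<Xi> \<Theta> \<Gamma> I" and d: "DT \<Theta> \<Gamma> (map_jthesis (act I) J)"
    and eqp: "\<And>i. i < length \<Xi> \<Longrightarrow> \<not> is_object (snd (\<Xi> ! i)) \<Longrightarrow> DB \<Theta> \<Gamma> (premise_bdry \<Xi> I i) \<Longrightarrow>
      D \<Theta> \<Gamma> (premise \<Xi> I i)"
    and i: "i < length \<Xi>"
  shows "D \<Theta> \<Gamma> (premise \<Xi> I i)"
proof -
  \<comment> \<open>Strictly above all names of the rule, so that the promoted names avoid them as
    object-invertibility requires.\<close>
  define K where "K = Suc (Max (names \<Xi>))"
  define \<Theta>' where "\<Theta>' = promote K \<Theta> \<Gamma>"
  define f :: "'s morph" where "f = prom K"
  \<comment> \<open>The way back: \<open>h\<close> will be shown to be a morphism from the residue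
    to the original contexts.\<close>
  define h where "h = unprom K I"
  define I' where "I' = inst_act f I"
  note r = wf_mctx_raw[OF w(1)] wf_vctx_raw[OF w(2) wf_mctx_raw[OF w(1)]]
  have rJ: "raw_mctx Sg \<Xi>" "wf_jthesis Sg (mv_arity \<Xi>) {} 0 J"
    using oi by (auto simp: object_invertible_def derivable_rule_def raw_rule_def)
  note di = raw_mctx_distinct[OF rJ(1)]
  have w': "wf_mctx Sg T \<Theta>'" using wf_promote w by (simp add: \<Theta>'_def)
  note r' = wf_mctx_raw[OF w']
  have f: "mor \<Theta> \<Gamma> \<Theta>' [] f" using mor_prom r r' by (simp add: \<Theta>'_def f_def)
  have I': "instantiates Sg \<Xi> \<Theta>' [] I'" unfolding I'_def by (rule inst_mor[OF I f])
  have "DT \<Theta>' [] (map_jthesis (act I') J)"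
    using deriv_mor[OF d r f] sact_inst_jthesis[OF rJ(2) I di mor_wmor[OF f]] by (simp add: I'_def)
  then have "derivable Sg T \<Theta>' [] (Thesis (map_jthesis (act I') J))"
    using w' by (auto simp: derivable_def intro: wf_vctx.intros)
  moreover have K: "fst (\<Xi> ! j) < K" if "j < length \<Xi>" for j
    using that by (auto simp: K_def less_Suc_eq_le intro!: Max_ge)
  have "names \<Xi> \<inter> names \<Theta>' = {}"
  proof -
    have "K \<le> N" if "N \<in> names \<Theta>'" for N using that by (auto simp: \<Theta>'_def promote_def pm_def pf_def)
    moreover have "N < K" if "N \<in> names \<Xi>" for N using that by (simp add: K_def less_Suc_eq_le)
    ultimately show ?thesis by fastforce
  qed
  ultimately have di': "derivable_inst Sg T \<Xi> (residue \<Xi> \<Theta>' I') [] (residual_inst \<Xi> I')"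
    using oi w' I' by (auto simp: object_invertible_def)
  \<comment> \<open>The promoted context with only the equational premises in \<open>js\<close>
    added; the residue is the case of all of them, and its prefixes are the cases met in the
    induction.\<close>
  define R where "R = (\<lambda>js. \<Theta>' @ map (\<lambda>j. (fst (\<Xi> ! j), premise_bdry \<Xi> I' j)) js)"
  define Js where "Js = filter (\<lambda>j. \<not> is_object (snd (\<Xi> ! j))) [0..<length \<Xi>]"
  have res: "residue \<Xi> \<Theta>' I' = R Js" by (simp add: residue_def R_def Js_def)
  define Ir where "Ir = residual_inst \<Xi> I'"
  have Ir: "instantiates Sg \<Xi> (R Js) [] Ir" "wf_mctx Sg T (R Js)"
    and dr: "D (R Js) [] (fill (premise_bdry \<Xi> Ir i) (snd (Ir ! i)))"
    using di' i by (auto simp: derivable_inst_def derivable_def res Ir_def)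
  have hf: "sact h (sact f e) = e" if "wf_arg Sg (mv_arity \<Theta>) (names \<Gamma>) n ck e"
      "wmor Sg (mv_arity \<Theta>') {} (mv_arity \<Theta>) (names \<Gamma>) h" for n ck e
    using wf_sact_comp[OF that(1) mor_wmor[OF f], of "mv_arity \<Theta>" "names \<Gamma>" h] that(2)
    by (simp add: h_def f_def comp_unprom_prom)
  have hfB: "sact_bdry h (sact_bdry f B) = B" if "wf_bdry Sg (mv_arity \<Theta>) (names \<Gamma>) n B"
      "wmor Sg (mv_arity \<Theta>') {} (mv_arity \<Theta>) (names \<Gamma>) h" for n B
    using sact_bdry_comp[OF that(1) mor_wmor[OF f], of "mv_arity \<Theta>" "names \<Gamma>" h] that(2)
    by (simp add: h_def f_def comp_unprom_prom)
  have lk: "map_of (R js) N = Some B \<Longrightarrow> map_of \<Theta>' N = Some B \<or>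
      (\<exists>j\<in>set js. N = fst (\<Xi> ! j) \<and> B = premise_bdry \<Xi> I' j)" for js N B
    by (auto simp: R_def map_add_Some_iff dest!: map_of_SomeD[of "map _ js"])
  have hj: "snd h (fst (\<Xi> ! j)) = Ins (snd (I ! j))" if "j < length \<Xi>" for j
    using K[OF that] inst_morph_nth[OF I di that]
    by (auto simp: h_def unprom_def inst_morph_def split: option.splits)
  have wh: "wmor Sg (mv_arity (R js)) {} (mv_arity \<Theta>) (names \<Gamma>) h" if js: "\<forall>j\<in>set js. j < length \<Xi>"
      for js
    unfolding wmor_def
  proof (intro conjI ballI allI impI)
    fix N c k assume "mv_arity (R js) N = Some (c, k)"
    then obtain B where B: "map_of (R js) N = Some B" "bdry_arity B = (c, k)"
        by (auto simp: mv_arity_def)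
    from lk[OF B(1)] show "case snd h N of Ren M' \<Rightarrow> mv_arity \<Theta> M' = Some (c, k)
        | Ins e \<Rightarrow> wfe \<Theta> \<Gamma> (c, k) e"
    proof
      assume "map_of \<Theta>' N = Some B"
      then show ?thesis unfolding \<Theta>'_def
      proof (cases rule: promote_lookup)
        case (mv M B')
        then show ?thesis using B by (simp add: h_def mv_arity_def)
      next
        case (fv a A)
        then show ?thesis using B lookup_names[of \<Gamma> a A]
          by (auto simp: h_def bdry_arity_def intro: wf_arg.intros)
      qed
    next
      assume "\<exists>j\<in>set js. N = fst (\<Xi> ! j) \<and> B = premise_bdry \<Xi> I' j"
      then obtain j where j: "j < length \<Xi>" "N = fst (\<Xi> ! j)" "B = premise_bdry \<Xi> I' j" using js by auto
      then show ?thesis using hj[OF j(1)] B(2) I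
        by (auto simp: instantiates_def premise_bdry_def act_bdry_sact)
    qed
  qed simp
  have wh0: "wmor Sg (mv_arity \<Theta>') {} (mv_arity \<Theta>) (names \<Gamma>) h"
    using wh[of "[]"] by (simp add: R_def)
  have pb: "wf_bdry Sg (mv_arity \<Theta>) (names \<Gamma>) 0 (premise_bdry \<Xi> I j)" if "j < length \<Xi>" for j
    unfolding premise_bdry_full[OF rJ(1) I that]
    by (rule wf_sact_bdry[OF raw_mctx_nth'[OF rJ(1) that] wmor_inst[OF I di]])
  have hp: "sact_bdry h (premise_bdry \<Xi> I' j) = premise_bdry \<Xi> I j" if "j < length \<Xi>" for j
    using sact_premise_bdry[OF rJ(1) I that mor_wmor[OF f]] hfB[OF pb[OF that] wh0]
        by (simp add: I'_def)
  \<comment> \<open>Apart from the promoted context, \<open>h\<close> has to fill just the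
    metavariables of \<open>js\<close>, so derivability of those premises makes it a
    morphism.\<close>
  have mh: "mor (R js) [] \<Theta> \<Gamma> h"
    if js: "\<forall>j\<in>set js. j < length \<Xi> \<and> D \<Theta> \<Gamma> (premise \<Xi> I j)"
      and wR: "wf_mctx Sg T (R js)" for js
  proof (rule mor_intro[OF wf_mctx_raw[OF wR] r])
    show "wmor Sg (mv_arity (R js)) (names []) (mv_arity \<Theta>) (names \<Gamma>) h" using wh js by simp
    fix N B assume "map_of (R js) N = Some B"
    from lk[OF this] show "case snd h N of Ren M' \<Rightarrow> map_of \<Theta> M' = Some (sact_bdry h B)
        | Ins e \<Rightarrow> D \<Theta> \<Gamma> (fill (sact_bdry h B) e)"
    proof
      assume "map_of \<Theta>' N = Some B"
      then show ?thesis unfolding \<Theta>'_def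
      proof (cases rule: promote_lookup)
        case (mv M B')
        have "sact_bdry h B = B'" unfolding mv(3) f_def[symmetric]
          by (rule hfB[OF wf_map_of_bdry[OF r(1) mv(2)] wh0])
        then show ?thesis using mv by (simp add: h_def)
      next
        case (fv a A)
        have "sact h (sact f A) = A" by (rule hf[OF raw_vctx_lookup[OF r(2) fv(2)] wh0])
        then show ?thesis using fv
            by (simp add: h_def[symmetric] f_def[symmetric]) (simp add: h_def d_var)
      qed
    next
      assume "\<exists>j\<in>set js. N = fst (\<Xi> ! j) \<and> B = premise_bdry \<Xi> I' j"
      then show ?thesis using js hj hp by auto
    qed
  qed simp
  have "wf_mctx Sg T (R js) \<Longrightarrow> \<forall>j\<in>set js. j < length \<Xi> \<and> \<not> is_object (snd (\<Xi> ! j)) \<Longrightarrow>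
      \<forall>j\<in>set js. D \<Theta> \<Gamma> (premise \<Xi> I j)" for js
  proof (induction js rule: rev_induct)
    case (snoc j js)
    have "R (js @ [j]) = R js @ [(fst (\<Xi> ! j), premise_bdry \<Xi> I' j)]" by (simp add: R_def)
    then have wR: "wf_mctx Sg T (R js)" and db: "DB (R js) [] (premise_bdry \<Xi> I' j)"
      using wf_mctx_snoc_D snoc.prems(1) by auto
    have js: "\<forall>j\<in>set js. D \<Theta> \<Gamma> (premise \<Xi> I j)" using snoc wR by simp
    have "mor (R js) [] \<Theta> \<Gamma> h" by (rule mh[OF _ wR]) (use js snoc.prems in auto)
    from deriv_bdry_mor[OF db wf_mctx_raw[OF wR] raw_vctx_Nil this]
    have "DB \<Theta> \<Gamma> (premise_bdry \<Xi> I j)" using hp snoc.prems(2) by simp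
    then show ?case using js eqp snoc.prems(2) by simp
  qed simp
  then have mJ: "mor (R Js) [] \<Theta> \<Gamma> h" using mh[OF _ Ir(2)] Ir(2) by (simp add: Js_def)
  \<comment> \<open>On object metavariables \<open>h\<close> undoes the promotion; on equational
    ones both sides are the iterated abstraction of \<open>Star\<close>.\<close>
  have "inst_act h Ir = I"
  proof (rule nth_equalityI)
    show l: "length (inst_act h Ir) = length I"
      using instantiates_length[OF I] instantiates_length[OF Ir(1)] by simp
    fix j assume "j < length (inst_act h Ir)"
    then have j: "j < length \<Xi>" "j < length Ir" "j < length I"
      using instantiates_length[OF I] instantiates_length[OF Ir(1)] by simp_all
    have wI: "wfe \<Theta> \<Gamma> (bdry_arity (snd (\<Xi> ! j))) (snd (I ! j))"
      using I j by (simp add: instantiates_def)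
    have "sact h (snd (Ir ! j)) = snd (I ! j)"
    proof (cases "is_object (snd (\<Xi> ! j))")
      case True
      then show ?thesis using hf[OF wI wh0] j by (simp add: Ir_def residual_inst_def I'_def)
    next
      case False
      obtain M B where MB: "\<Xi> ! j = (M, B)" by fastforce
      have "snd (I ! j) = (Abs ^^ depth B) Star"
        using wf_arg_eq_Star[OF raw_sig, of "mv_arity \<Theta>" "names \<Gamma>" "bthesis_cls (core B)"
            "depth B"] wI False MB
        by (auto simp: is_object_def is_object_thesis_def bdry_arity_def)
      then show ?thesis using False MB j by (simp add: Ir_def residual_inst_def generic_def sact_absn)
    qed
    moreover have "fst (Ir ! j) = fst (I ! j)"
      using instantiates_fst[OF I j(1)] instantiates_fst[OF Ir(1) j(1)] by simp
    ultimately show "inst_act h Ir ! j = I ! j" using j by (simp add: prod_eq_iff)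
  qed
  then show ?thesis
    using deriv_mor[OF dr wf_mctx_raw[OF Ir(2)] raw_vctx_Nil mJ]
      sact_fill_premise[OF rJ(1) Ir(1) i mJ] by simp
qed

section \<open>Equational premises\<close>

lemma eq_hole_sact: "eq_hole (sact_bdry f B) = sact_bdry f (eq_hole B)"
proof (induction B)
  case (Thesis b)
  then show ?case by (cases b) auto
qed auto

lemma eq_sides_sact: "eq_lhs (sact_bdry f B) = sact f (eq_lhs B)"
    "eq_rhs (sact_bdry f B) = sact f (eq_rhs B)"
proof (induction B)
  case (Thesis b)
  case 1 show ?case by (cases b) auto
  case 2 show ?case by (cases b) auto
qed auto

lemma eq_hole_subst: "eq_hole (subst_bdry k u B) = subst_bdry k u (eq_hole B)"
proof (induction B arbitrary: k u)
  case (Thesis b)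
  then show ?case by (cases b) auto
qed auto

lemma eq_sides_subst: "eq_lhs (subst_bdry k u B) = subst k u (eq_lhs B) \<and>
    eq_rhs (subst_bdry k u B) = subst k u (eq_rhs B)"
proof (induction B arbitrary: k u)
  case (Thesis b)
  show ?case by (cases b) auto
qed auto

lemma depth_eq_hole [simp]: "depth (eq_hole B) = depth B"
proof (induction B)
  case (Thesis b)
  show ?case by (cases b) auto
qed auto

lemma is_object_eq_hole: "is_object (eq_hole B)"
proof (induction B)
  case (Thesis b)
  show ?case by (cases b) (auto simp: is_object_def is_object_thesis_def)
qed auto

lemma nabs_eq_sides: "nabs (depth B) (eq_lhs B) \<and> nabs (depth B) (eq_rhs B)"
  by (induction B) (auto simp: nabs_Suc)

lemma fv_eq_sides: "fv_bdry (eq_hole B) \<subseteq> fv_bdry B \<and> fv (eq_lhs B) \<subseteq> fv_bdry B \<and>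
    fv (eq_rhs B) \<subseteq> fv_bdry B"
proof (induction B)
  case (Thesis b)
  show ?case by (cases b) (auto simp: fv_bdry_exprs)
qed (auto simp: fv_bdry_exprs)

lemma fill_eq_sides: "\<not> is_object B \<Longrightarrow> fill_eq (eq_hole B) (eq_lhs B) (eq_rhs B) = fill B e"
proof (induction B arbitrary: e)
  case (Thesis b)
  then show ?case by (cases b) (auto simp: is_object_def is_object_thesis_def)
qed auto

text \<open>A derivable equational boundary contains derivations of both sides; under a binder the
  variable of \<open>b_abstr\<close> can be kept, since it is fresh for the sides as well.\<close>

lemma eq_sides_derivable:
  "DB \<Theta> \<Gamma> B \<Longrightarrow> \<not> is_object B \<Longrightarrow> D \<Theta> \<Gamma> (fill (eq_hole B) (eq_lhs B)) \<and> D \<Theta> \<Gamma> (fill (eq_hole B) (eq_rhs B))"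
proof (induction rule: deriv_bdry.induct)
  case (b_abstr \<Theta> \<Gamma> A a B)
  have "a \<notin> fv A \<union> fv_jdg (fill (eq_hole B) (eq_lhs B))" "a \<notin> fv A \<union>
      fv_jdg (fill (eq_hole B) (eq_rhs B))"
    using b_abstr.hyps(3) fv_eq_sides[of B] fv_fill[of "eq_hole B"
        "eq_lhs B"] fv_fill[of "eq_hole B" "eq_rhs B"]
      nabs_eq_sides[of B] by auto
  moreover have "D \<Theta> (\<Gamma> @ [(a, A)]) (subst_jdg 0 (FVar a) (fill (eq_hole B) (eq_lhs B)))"
    "D \<Theta> (\<Gamma> @ [(a, A)]) (subst_jdg 0 (FVar a) (fill (eq_hole B) (eq_rhs B)))"
    using b_abstr.IH b_abstr.prems nabs_eq_sides[of B]
        by (auto simp: subst_fill eq_hole_subst eq_sides_subst)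
  ultimately show ?case using b_abstr.hyps by (auto intro: d_abstr[of _ _ _ _ _ a])
qed (auto simp: is_object_def is_object_thesis_def)

text \<open>A check yields the equation for derivable sides, and derivability of the boundary
  supplies these. The head \<open>e\<close> is arbitrary because the filled judgement of an
  equational boundary does not contain it.\<close>

lemma equation_sound:
  assumes "DB \<Theta> \<Gamma> (sact_bdry (inst_morph I) B)" "\<not> is_object B"
    and "D \<Theta> \<Gamma> (fill (act_bdry I (eq_hole B)) (act I (eq_lhs B))) \<Longrightarrow>
      D \<Theta> \<Gamma> (fill (act_bdry I (eq_hole B)) (act I (eq_rhs B))) \<Longrightarrow>
      D \<Theta> \<Gamma> (fill_eq (act_bdry I (eq_hole B)) (act I (eq_lhs B)) (act I (eq_rhs B)))"
  shows "D \<Theta> \<Gamma> (fill (sact_bdry (inst_morph I) B) e)"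
  using eq_sides_derivable[OF assms(1)] assms(2,3) fill_eq_sides[of "sact_bdry (inst_morph I) B" e]
  by (simp add: eq_hole_sact eq_sides_sact act_bdry_sact act_sact)

end

section \<open>Soundness\<close>

text \<open>A free variable is not an abstraction, so opening cannot create one.\<close>

lemma nabs_subst_FVar_D: "nabs n (subst k (FVar a) e) \<Longrightarrow> nabs n e"
proof (induction n arbitrary: e k)
  case (Suc n)
  then show ?case by (cases e) (auto simp: nabs_Suc split: if_splits)
qed simp

lemma nabs_close: "nabs n e \<Longrightarrow> nabs n (close k a e)"
  by (induction n arbitrary: e k) (auto simp: nabs_Suc)

context std_tt
begin

lemma premise_sound:
  assumes "raw_mctx Sg \<Xi>" "instantiates Sg \<Xi> \<Theta> \<Gamma> I" "i < length \<Xi>" "\<not> is_object (snd (\<Xi> ! i))"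
    and "DB \<Theta> \<Gamma> (premise_bdry \<Xi> I i)"
    and "D \<Theta> \<Gamma> (fill (act_bdry I (eq_hole (snd (\<Xi> ! i)))) (act I (eq_lhs (snd (\<Xi> ! i))))) \<Longrightarrow>
      D \<Theta> \<Gamma> (fill (act_bdry I (eq_hole (snd (\<Xi> ! i)))) (act I (eq_rhs (snd (\<Xi> ! i))))) \<Longrightarrow>
      D \<Theta> \<Gamma> (fill_eq (act_bdry I (eq_hole (snd (\<Xi> ! i)))) (act I (eq_lhs (snd (\<Xi> ! i))))
          (act I (eq_rhs (snd (\<Xi> ! i)))))"
  shows "D \<Theta> \<Gamma> (fill (premise_bdry \<Xi> I i) e)"
  using equation_sound[of \<Theta> \<Gamma> I "snd (\<Xi> ! i)" e] assms(4-6) premise_bdry_full[OF assms(1-3)] by simp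

text \<open>What the induction hypothesis says about one checked premise. It has to stay
  conditional, since the sides become derivable only after the preceding premises have been
  discharged.\<close>

definition sides_sound :: "'s mctx \<Rightarrow> 's vctx \<Rightarrow> 's inst \<Rightarrow> 's bdry \<Rightarrow> bool" where
  "sides_sound \<Theta> \<Gamma> I B \<longleftrightarrow>
     (D \<Theta> \<Gamma> (fill (act_bdry I (eq_hole B)) (act I (eq_lhs B))) \<longrightarrow>
      D \<Theta> \<Gamma> (fill (act_bdry I (eq_hole B)) (act I (eq_rhs B))) \<longrightarrow>
      D \<Theta> \<Gamma> (fill_eq (act_bdry I (eq_hole B)) (act I (eq_lhs B)) (act I (eq_rhs B))))"

lemma match_derivable:
  assumes "object_invertible Sg T (\<Xi>, J)" "wf_mctx Sg T \<Theta>" "wf_vctx Sg T \<Theta> \<Gamma>"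
    and "instantiates Sg \<Xi> \<Theta> \<Gamma> I" "DT \<Theta> \<Gamma> (map_jthesis (act I) J)"
    and ss: "\<forall>(M, B)\<in>set \<Xi>. \<not> is_object B \<longrightarrow> sides_sound \<Theta> \<Gamma> I B"
    and i: "i < length \<Xi>"
  shows "D \<Theta> \<Gamma> (premise \<Xi> I i)"
proof (rule object_invertible_derivable[OF assms(1-5) _ i])
  fix j assume j: "j < length \<Xi>" "\<not> is_object (snd (\<Xi> ! j))" "DB \<Theta> \<Gamma> (premise_bdry \<Xi> I j)"
  have r: "raw_mctx Sg \<Xi>"
    using assms(1) by (auto simp: object_invertible_def derivable_rule_def raw_rule_def)
  have "\<Xi> ! j \<in> set \<Xi>" using j by simp
  then have "sides_sound \<Theta> \<Gamma> I (snd (\<Xi> ! j))" using ss j(2) by auto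
  then show "D \<Theta> \<Gamma> (premise \<Xi> I j)"
    by (intro premise_sound[OF r assms(4) j]) (simp add: sides_sound_def)
qed

text \<open>The natural type of the pattern is the type in the symbol rule of \<open>S\<close>
  instantiated by \<open>es\<close>, so acting with \<open>I\<close> yields that type at the
  instantiated arguments. Inversion of the given typing compares this very type with
  \<open>A\<close>.\<close>

lemma natural_type_derivable:
  assumes w: "wf_mctx Sg T \<Theta>" "wf_vctx Sg T \<Theta> \<Gamma>" and r: "raw_mctx Sg \<Xi>" and I: "instantiates Sg \<Xi> \<Theta> \<Gamma> I"
    and u: "DT \<Xi> [] (HasTy (SymApp S es) \<tau>)" and \<tau>: "\<tau> = natural_type T \<Xi> [] (SymApp S es)"
    and s: "DT \<Theta> \<Gamma> (HasTy (act I (SymApp S es)) A)"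
  shows "DT \<Theta> \<Gamma> (HasTy (act I (SymApp S es)) (act I \<tau>))"
proof -
  have ob: "is_object_thesis (BTm A)" for A :: "'s expr" by (simp add: is_object_thesis_def)
  have 1: "Thesis (HasTy (SymApp S es) \<tau>) = Thesis (fill_thesis (BTm \<tau>) (SymApp S es))" by simp
  obtain \<Xi>0 b where R: "(\<Xi>0, symbol_concl S \<Xi>0 b) \<in> T" "bthesis_cls b = Tm" "length es = length \<Xi>0"
    "instantiates Sg \<Xi>0 \<Xi> [] (zip (map fst \<Xi>0) es)"
    using inversion_sym[OF u 1 ob] by auto
  then obtain B where b: "b = BTm B" by (cases b) auto
  let ?es' = "map (act I) es"
  have 2: "Thesis (HasTy (act I (SymApp S es)) A) = Thesis (fill_thesis (BTm A) (SymApp S ?es'))"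
      by simp
  obtain \<Xi>1 b1 where R1: "(\<Xi>1, symbol_concl S \<Xi>1 b1) \<in> T" "is_object_thesis b1"
    "map_bthesis (act (zip (map fst \<Xi>1) ?es')) b1 = BTm A \<or>
        beq \<Theta> \<Gamma> (map_bthesis (act (zip (map fst \<Xi>1) ?es')) b1) (BTm A)"
    using inversion_sym[OF s 2 ob] by auto
  have eq: "\<Xi>1 = \<Xi>0" "b1 = BTm B"
    using symbol_rule_unique[OF R1(1) R(1) R1(2)] b by (auto simp: is_object_thesis_def)
  have B: "wf_arg Sg (mv_arity \<Xi>0) {} 0 (Ty, 0) B" "raw_mctx Sg \<Xi>0"
    using raw_rule[OF R(1)] by (auto simp: raw_rule_def symbol_concl_def b)
  have "\<tau> = act (zip (map fst \<Xi>0) es) B"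
    using natural_type_sym R(1) b \<tau> by metis
  then have "act I \<tau> = act (inst_act (inst_morph I) (zip (map fst \<Xi>0) es)) B"
    using sact_inst[OF B(1) R(4) raw_mctx_distinct[OF B(2)], of _ _ "inst_morph I"]
        wmor_inst[OF I raw_mctx_distinct[OF r]]
    by (simp add: act_sact)
  also have "inst_act (inst_morph I) (zip (map fst \<Xi>0) es) = zip (map fst \<Xi>0) ?es'"
    using R(3) by (auto simp: inst_act_def zip_map2 act_sact[abs_def])
  finally have "act I \<tau> = A \<or> DT \<Theta> \<Gamma> (JEqTy (act I \<tau>) A)"
    using R1(3) eq by auto
  then show ?thesis using s by (auto intro: d_conv_tm d_ty_sym)
qed

text \<open>A type rule is covered by object-invertibility directly. For a term rule three types
  meet: the natural type of the pattern, at which the rule is object-invertible; the type of the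
  rule, at which the equation is obtained; and the type at which \<open>s\<close> is given.
  \<open>natural_type_derivable\<close> reaches the first, and \<open>unique_type_sym\<close> leads
  from the second to the third.\<close>

lemma red_c_sound:
  assumes R: "computation_rule Sg T (\<Xi>, fill_eq_thesis b' p v)" and b: "is_object_thesis b'"
      "bthesis_cls b = bthesis_cls b'"
    and m: "matches Sg \<Xi> p \<Theta> \<Gamma> s I" and ss: "\<forall>(M, B)\<in>set \<Xi>. \<not> is_object B \<longrightarrow> sides_sound \<Theta> \<Gamma> I B"
    and w: "wf_mctx Sg T \<Theta>" "wf_vctx Sg T \<Theta> \<Gamma>" and d: "DT \<Theta> \<Gamma> (fill_thesis b s)"
  shows "DT \<Theta> \<Gamma> (fill_eq_thesis b s (act I v))"
proof -
  note r = wf_mctx_raw[OF w(1)] wf_vctx_raw[OF w(2) wf_mctx_raw[OF w(1)]]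
  have I: "instantiates Sg \<Xi> \<Theta> \<Gamma> I" and s: "s = act I p" using m by (auto simp: matches_def)
  from R have rr: "raw_mctx Sg \<Xi>" and dr: "DT \<Xi> [] (fill_eq_thesis b' p v)"
    by (auto simp: computation_rule_def type_computation_rule_def term_computation_rule_def
        derivable_rule_def
        derivable_def raw_rule_def)
  have concl: "DT \<Theta> \<Gamma> (fill_eq_thesis (map_bthesis (act I) b') s (act I v))"
    if "\<And>i. i < length \<Xi> \<Longrightarrow> D \<Theta> \<Gamma> (premise \<Xi> I i)"
    using deriv_mor[OF dr rr raw_vctx_Nil mor_inst[OF rr r I that]]
    by (simp add: map_fill_eq_thesis s act_sact map_act_bthesis)
  show ?thesis
  proof (cases b')
    case BTy
    then have "b = BTy" using b by (cases b) auto
    moreover have "object_invertible Sg T (\<Xi>, IsTy p)"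
      using R BTy by (auto simp: computation_rule_def type_computation_rule_def
          term_computation_rule_def)
    ultimately show ?thesis using match_derivable[OF _ w I _ ss] d s BTy concl by auto
  next
    case (BTm A)
    then obtain A0 where A0: "b = BTm A0" using b by (cases b) auto
    obtain S es where p: "p = SymApp S es"
        and oi: "object_invertible Sg T (\<Xi>, HasTy p (natural_type T \<Xi> [] p))"
      using R BTm by (auto simp: computation_rule_def type_computation_rule_def
          term_computation_rule_def)
    then have "DT \<Xi> [] (HasTy p (natural_type T \<Xi> [] p))"
      by (auto simp: object_invertible_def derivable_rule_def derivable_def)
    then have "DT \<Theta> \<Gamma> (HasTy (act I p) (act I (natural_type T \<Xi> [] p)))"
      using natural_type_derivable[OF w rr I _ refl] d s A0 unfolding p by auto
    then have "\<And>i. i < length \<Xi> \<Longrightarrow> D \<Theta> \<Gamma> (premise \<Xi> I i)"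
      using match_derivable[OF oi w I _ ss] by simp
    from concl[OF this] have e: "DT \<Theta> \<Gamma> (JEqTm s (act I v) (act I A))" by (simp add: BTm)
    then have "DT \<Theta> \<Gamma> (HasTy s (act I A))" using presup[OF e w refl] by simp
    then have "DT \<Theta> \<Gamma> (JEqTy (act I A) A0)"
      using unique_type_sym[OF _ _ w] d s A0 p by simp
    then show ?thesis using e A0 by (auto intro: d_conv_eq)
  qed (use b in \<open>auto simp: is_object_thesis_def\<close>)
qed

text \<open>The notion of extensionality rule hides the decomposition behind existential
  quantifiers. It is recovered from the rule: the conclusion names \<open>P\<close>,
  \<open>s\<close> and \<open>t\<close>, and distinctness of the names fixes where the list of
  premises is cut.\<close>

lemma ext_rule_inj:
  assumes "ext_rule \<Xi> P s t \<Phi> = ext_rule \<Xi>' P' s' t' \<Phi>'" "raw_rule Sg (ext_rule \<Xi> P s t \<Phi>)"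
  shows "\<Xi> = \<Xi>' \<and> P = P' \<and> s = s' \<and> t = t' \<and> \<Phi> = \<Phi>'"
proof -
  have d: "distinct (map fst (\<Xi> @ [(s, Thesis (BTm P)), (t, Thesis (BTm P))] @ \<Phi>))"
    using assms(2) by (simp add: ext_rule_def raw_rule_def raw_mctx_def)
  have h: "P = P'" "s = s'" "t = t'"
    and l: "\<Xi> @ (s, Thesis (BTm P)) # (t, Thesis (BTm P)) # \<Phi> = \<Xi>' @ (s, Thesis (BTm P)) #
        (t, Thesis (BTm P)) # \<Phi>'"
    using assms(1) by (auto simp: ext_rule_def)
  have "(s, Thesis (BTm P)) \<notin> set \<Xi>" "(s, Thesis (BTm P)) \<notin> set ((t, Thesis (BTm P)) # \<Phi>)"
    using d by (auto intro: rev_image_eqI)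
  from append_Cons_eq_iff[OF this] l h show ?thesis by auto
qed

text \<open>Object-invertibility makes the instantiation found by matching derivable, and
  \<open>u\<close> and \<open>v\<close> fill the two premises at \<open>P\<close>. The premises in
  \<open>\<Phi>\<close> are equations that have been checked, so the extended instantiation becomes
  derivable premise by premise.\<close>

lemma chk_e_ext_sound:
  assumes R: "extensionality_rule Sg T (ext_rule \<Xi> P s t \<Phi>)" and m: "matches Sg \<Xi> P \<Theta> \<Gamma> A I"
    and ss: "\<forall>(M, B)\<in>set \<Xi>. \<not> is_object B \<longrightarrow> sides_sound \<Theta> \<Gamma> I B"
    and ss': "\<forall>(M, B)\<in>set \<Phi>. sides_sound \<Theta> \<Gamma> (I @ [(s, u), (t, v)]) B"
    and w: "wf_mctx Sg T \<Theta>" "wf_vctx Sg T \<Theta> \<Gamma>"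
    and u: "DT \<Theta> \<Gamma> (HasTy u A)" and v: "DT \<Theta> \<Gamma> (HasTy v A)"
  shows "DT \<Theta> \<Gamma> (JEqTm u v A)"
proof -
  note r = wf_mctx_raw[OF w(1)] wf_vctx_raw[OF w(2) wf_mctx_raw[OF w(1)]]
  have I: "instantiates Sg \<Xi> \<Theta> \<Gamma> I" and A: "A = act I P" using m by (auto simp: matches_def)
  define n where "n = length \<Xi>"
  have lI: "length I = n" using instantiates_length[OF I] by (simp add: n_def)
  define \<Psi> where "\<Psi> = \<Xi> @ [(s, Thesis (BTm P)), (t, Thesis (BTm P))] @ \<Phi>"
  have rule: "derivable_rule Sg T (ext_rule \<Xi> P s t \<Phi>)" "finitary_rule Sg T (ext_rule \<Xi> P s t \<Phi>)"
    and oi: "object_invertible Sg T (\<Xi>, IsTy P)" and \<Phi>: "\<forall>(M, B)\<in>set \<Phi>. \<not> is_object B"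
  proof -
    obtain \<Xi>' P' s' t' \<Phi>' where R': "ext_rule \<Xi> P s t \<Phi> = ext_rule \<Xi>' P' s' t' \<Phi>'"
      "\<forall>(M, B)\<in>set \<Phi>'. \<not> is_object B" "derivable_rule Sg T (ext_rule \<Xi> P s t \<Phi>)"
      "finitary_rule Sg T (ext_rule \<Xi> P s t \<Phi>)" "object_invertible Sg T (\<Xi>', IsTy P')"
      using R unfolding extensionality_rule_def by blast
    have "raw_rule Sg (ext_rule \<Xi> P s t \<Phi>)" using R'(3) by (auto simp: derivable_rule_def ext_rule_def)
    from ext_rule_inj[OF R'(1) this] R'
    show "derivable_rule Sg T (ext_rule \<Xi> P s t \<Phi>)" "finitary_rule Sg T (ext_rule \<Xi> P s t \<Phi>)"
      "object_invertible Sg T (\<Xi>, IsTy P)" "\<forall>(M, B)\<in>set \<Phi>. \<not> is_object B" by auto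
  qed
  have w\<Psi>: "wf_mctx Sg T \<Psi>" using rule(2) by (simp add: finitary_rule_def ext_rule_def \<Psi>_def)
  note r\<Psi> = wf_mctx_raw[OF w\<Psi>]
  note di = raw_mctx_distinct[OF r\<Psi>]
  have d\<Psi>: "DT \<Psi> [] (JEqTm (MvApp s []) (MvApp t []) P)"
    using rule(1) by (simp add: derivable_rule_def derivable_def ext_rule_def \<Psi>_def)
  have rX: "raw_mctx Sg \<Xi>" "wf_arg Sg (mv_arity \<Xi>) {} 0 (Ty, 0) P"
    using oi by (auto simp: object_invertible_def derivable_rule_def raw_rule_def)
  have pX: "D \<Theta> \<Gamma> (premise \<Xi> I i)" if "i < n" for i
    using match_derivable[OF oi w I _ ss] presup[OF u w refl] that by (simp add: A n_def)
  \<comment> \<open>The premises in \<open>\<Phi>\<close> are equational, so iterated abstractions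
    of \<open>Star\<close> are the only valid entries for them.\<close>
  define Is where "Is = map (\<lambda>(M, B :: 's bdry). (M, (Abs ^^ depth B) Star :: 's expr)) \<Phi>"
  define I1 where "I1 = I @ [(s, u), (t, v)]"
  define I2 where "I2 = I1 @ Is"
  have nth\<Psi>: "\<Psi> ! i =
      (if i < n then \<Xi> ! i else if i = n then (s, Thesis (BTm P)) else if i = Suc n then
      (t, Thesis (BTm P)) else \<Phi> ! (i - n - 2))" for i
    by (auto simp: \<Psi>_def n_def nth_append nth_Cons')
  have nthI: "I2 ! i = (if i < n then I ! i else if i = n then (s, u) else if i = Suc n then (t, v)
      else Is ! (i - n - 2))" for i
    by (auto simp: I2_def I1_def lI nth_append nth_Cons')
  have l\<Psi>: "length \<Psi> = n + 2 + length \<Phi>" "length Is = length \<Phi>" by (auto simp: \<Psi>_def n_def Is_def)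
  have wu: "wfe \<Theta> \<Gamma> (Tm, 0) u" "wfe \<Theta> \<Gamma> (Tm, 0) v"
    using deriv_wf[OF u r] deriv_wf[OF v r] by auto
  have wS: "wf_arg Sg ar V k (c, m) ((Abs ^^ m) Star)" if "c \<notin> {Ty, Tm}" for ar V c m k
    using that by (induction m arbitrary: k) (cases c; auto intro: wf_arg.intros)+
  have I2: "instantiates Sg \<Psi> \<Theta> \<Gamma> I2"
    unfolding instantiates_def
  proof (intro conjI allI impI)
    have "map fst Is = map fst \<Phi>" by (auto simp: Is_def)
    then show "map fst I2 = map fst \<Psi>" using I by (simp add: I2_def I1_def \<Psi>_def instantiates_def)
    fix i assume i: "i < length \<Psi>"
    consider "i < n" | "i = n" | "i = Suc n" | k where "i = n + 2 + k" "k < length \<Phi>"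
      using i l\<Psi> by (metis add_2_eq_Suc' add_less_cancel_left le_Suc_ex less_antisym not_less
          not_less_eq)
    then show "wfe \<Theta> \<Gamma> (bdry_arity (snd (\<Psi> ! i))) (snd (I2 ! i))"
    proof cases
      case 4
      obtain M B where MB: "\<Phi> ! k = (M, B)" by fastforce
      then have "\<not> is_object B" using \<Phi> 4 nth_mem by fastforce
      then show ?thesis using 4 MB wS
        by (auto simp: nth\<Psi> nthI Is_def bdry_arity_def is_object_def is_object_thesis_def)
    qed (use I wu in \<open>auto simp: nth\<Psi> nthI instantiates_def n_def bdry_arity_def\<close>)
  qed
  have pr0: "premise_bdry \<Psi> I2 i = premise_bdry \<Xi> I i" if "i < n" for i
    using that by (simp add: premise_bdry_def nth\<Psi> I2_def I1_def lI)
  have actP: "act I2 P = A"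
    unfolding A act_sact
  proof (rule sact_cong[OF rX(2)])
    fix M c k assume "mv_arity \<Xi> M = Some (c, k)"
    then obtain e where e: "map_of I M = Some e" using mv_arity_inst[OF I] by blast
    have "distinct (map fst I2)" using I2 di by (simp add: instantiates_def)
    then have "map_of I2 M = Some e" using map_of_SomeD[OF e] by (auto simp: I2_def I1_def)
    then show "snd (inst_morph I2) M = snd (inst_morph I) M" using e by (simp add: inst_morph_def)
  qed (simp add: inst_morph_def)
  \<comment> \<open>Induction on the position, because the boundary of a premise is obtained as
    derivable only by way of the preceding premises.\<close>
  have all: "\<forall>j<i. j < length \<Psi> \<longrightarrow> D \<Theta> \<Gamma> (fill (premise_bdry \<Psi> I2 j) (snd (I2 ! j)))" for i
  proof (induction i)
    case (Suc i)
    have "D \<Theta> \<Gamma> (fill (premise_bdry \<Psi> I2 i) (snd (I2 ! i)))" if i: "i < length \<Psi>"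
    proof -
      consider "i < n" | "i = n" | "i = Suc n" | k where "i = n + 2 + k" "k < length \<Phi>"
        using i l\<Psi> by (metis add_2_eq_Suc' add_less_cancel_left le_Suc_ex less_antisym not_less
            not_less_eq)
      then show ?thesis
      proof cases
        case 1
        then show ?thesis using pX pr0 by (simp add: nthI)
      next
        case 2
        then show ?thesis using u actP premise_bdry_full[OF r\<Psi> I2 i] by (simp add: nth\<Psi> nthI act_sact)
      next
        case 3
        then show ?thesis using v actP premise_bdry_full[OF r\<Psi> I2 i] by (simp add: nth\<Psi> nthI act_sact)
      next
        case 4
        define B where "B = snd (\<Psi> ! i)"
        have B: "B = snd (\<Phi> ! k)" "\<Phi> ! k \<in> set \<Phi>" using 4 by (auto simp: B_def nth\<Psi>)
        then have nB: "\<not> is_object B" and sB: "sides_sound \<Theta> \<Gamma> I1 B" using \<Phi> ss' by (auto simp: I1_def)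
        have "mor (take i \<Psi>) [] \<Theta> \<Gamma> (inst_morph I2)"
          by (rule mor_inst_take[OF r\<Psi> r I2]) (use Suc.IH in auto)
        from deriv_bdry_mor[OF wf_mctx_nth[OF w\<Psi> i] raw_mctx_take[OF r\<Psi>] raw_vctx_Nil this]
        have db: "DB \<Theta> \<Gamma> (sact_bdry (inst_morph I2) B)" by (simp add: B_def)
        \<comment> \<open>The checks were made under an instantiation without entries for
          \<open>\<Phi>\<close>. Valid expressions contain object metavariables only, so both
          instantiations act alike on \<open>B\<close>.\<close>
        have "sact_bdry (inst_morph I2) B = sact_bdry (inst_morph I1) B"
        proof (rule sact_bdry_cong)
          fix e assume "e \<in> exprs_bdry B"
          then obtain l ck where wf: "wf_arg Sg (mv_arity \<Psi>) {} l ck e"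
            using wf_bdry_exprs[OF raw_mctx_nth'[OF r\<Psi> i]] unfolding B_def by blast
          show "sact (inst_morph I2) e = sact (inst_morph I1) e"
          proof (rule sact_cong[OF wf])
            fix M c l assume M: "mv_arity \<Psi> M = Some (c, l)" "c \<in> {Ty, Tm}"
            have "map_of Is M = None"
            proof (rule ccontr)
              assume "map_of Is M \<noteq> None"
              then have "M \<in> names Is" by (metis names_map_of)
              then obtain B' where B': "(M, B') \<in> set \<Phi>" by (auto simp: Is_def)
              then have "(M, B') \<in> set \<Psi>" by (simp add: \<Psi>_def)
              then have "map_of \<Psi> M = Some B'" by (rule map_of_is_SomeI[OF di])
              then show False using M B' \<Phi>
                  by (auto simp: mv_arity_def bdry_arity_def is_object_def is_object_thesis_def)
            qed
            then show "snd (inst_morph I2) M = snd (inst_morph I1) M"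
              by (simp add: inst_morph_def I2_def map_add_def split: option.split)
          qed (simp add: inst_morph_def)
        qed
        with db have "D \<Theta> \<Gamma> (fill (sact_bdry (inst_morph I2) B) (snd (I2 ! i)))"
          using equation_sound[OF _ nB, of \<Theta> \<Gamma> I1] sB by (simp add: sides_sound_def)
        then show ?thesis by (simp add: premise_bdry_full[OF r\<Psi> I2 i] B_def)
      qed
    qed
    with Suc show ?case by (auto simp: less_Suc_eq)
  qed simp
  have "mor \<Psi> [] \<Theta> \<Gamma> (inst_morph I2)" using mor_inst[OF r\<Psi> r I2] all by blast
  from deriv_mor[OF d\<Psi> r\<Psi> raw_vctx_Nil this]
  have "DT \<Theta> \<Gamma> (JEqTm (sact (inst_morph I2) (MvApp s [])) (sact (inst_morph I2) (MvApp t [])) A)"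
    using actP by (simp add: act_sact)
  moreover have "snd (inst_morph I2) s = Ins u" "snd (inst_morph I2) t = Ins v"
    using inst_morph_nth[OF I2 di, of n] inst_morph_nth[OF I2 di, of "Suc n"] l\<Psi>
        by (auto simp: nth\<Psi> nthI)
  moreover have "apply_arg e [] = e" for e :: "'s expr" by (cases e) auto
  ultimately show ?thesis by simp
qed

section \<open>Mutual induction over the relations of the algorithm\<close>

definition wfc :: "'s mctx \<Rightarrow> 's vctx \<Rightarrow> bool" where
  "wfc \<Theta> \<Gamma> \<longleftrightarrow> wf_mctx Sg T \<Theta> \<and> wf_vctx Sg T \<Theta> \<Gamma>"

lemma wfc_raw: "wfc \<Theta> \<Gamma> \<Longrightarrow> raw_mctx Sg \<Theta> \<and> raw_vctx Sg \<Theta> \<Gamma>"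
  using wf_mctx_raw wf_vctx_raw by (auto simp: wfc_def)

lemma wfc_open:
  assumes "wfc \<Theta> \<Gamma>" "D \<Theta> \<Gamma> (Abstr A J)" "a \<notin> names \<Gamma>"
  shows "wfc \<Theta> (\<Gamma> @ [(a, A)])" "D \<Theta> (\<Gamma> @ [(a, A)]) (subst_jdg 0 (FVar a) J)" "DT \<Theta> \<Gamma> (IsTy A)"
  using assms abstr_ty abstr_open wfc_raw by (auto simp: wfc_def intro: wf_vctx.intros)

text \<open>For reductions only the source is assumed derivable. Their claim also records validity
  of the result: at an equational boundary the filled equation says nothing about it, yet
  \<open>head_congr\<close> needs it for every argument. The conditions \<open>nabs\<close> stand
  outside the derivability hypotheses, because they are what lets filling commute with opening when
  those hypotheses are transferred to the body.\<close>

theorem soundness: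
  assumes C: "\<forall>R\<in>C. computation_rule Sg T R" and E: "\<forall>R\<in>E. extensionality_rule Sg T R"
  shows "red Sg T C E pr \<Theta> \<Gamma> B e e' \<Longrightarrow> nabs (depth B) e \<and> nabs (depth B) e' \<and>
      (wfc \<Theta> \<Gamma> \<longrightarrow> D \<Theta> \<Gamma> (fill B e) \<longrightarrow>
        D \<Theta> \<Gamma> (fill_eq B e e') \<and> wfe \<Theta> \<Gamma> (bdry_arity B) e')"
    and "red_p Sg T C E pr \<Theta> \<Gamma> b e e' \<Longrightarrow> is_object_thesis b \<and>
      (wfc \<Theta> \<Gamma> \<longrightarrow> DT \<Theta> \<Gamma> (fill_thesis b e) \<longrightarrow> DT \<Theta> \<Gamma> (fill_eq_thesis b e e'))"
    and "red_c Sg T C E pr \<Theta> \<Gamma> b e e' \<Longrightarrow>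
      wfc \<Theta> \<Gamma> \<longrightarrow> DT \<Theta> \<Gamma> (fill_thesis b e) \<longrightarrow> DT \<Theta> \<Gamma> (fill_eq_thesis b e e')"
    and "chk Sg T C E pr \<Theta> \<Gamma> B e e' \<Longrightarrow> nabs (depth B) e \<and> nabs (depth B) e' \<and>
      (wfc \<Theta> \<Gamma> \<longrightarrow> is_object B \<longrightarrow> D \<Theta> \<Gamma> (fill B e) \<longrightarrow> D \<Theta> \<Gamma> (fill B e') \<longrightarrow> D \<Theta> \<Gamma> (fill_eq B e e'))"
    and "chk_e Sg T C E pr \<Theta> \<Gamma> A u v \<Longrightarrow>
      wfc \<Theta> \<Gamma> \<longrightarrow> DT \<Theta> \<Gamma> (HasTy u A) \<longrightarrow> DT \<Theta> \<Gamma> (HasTy v A) \<longrightarrow> DT \<Theta> \<Gamma> (JEqTm u v A)"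
    and "chk_n Sg T C E pr \<Theta> \<Gamma> B e e' \<Longrightarrow>
      wfc \<Theta> \<Gamma> \<longrightarrow> is_object B \<longrightarrow> D \<Theta> \<Gamma> (fill B e) \<longrightarrow> D \<Theta> \<Gamma> (fill B e') \<longrightarrow> D \<Theta> \<Gamma> (fill_eq B e e')"
proof (induction rule: red_red_p_red_c_chk_chk_e_chk_n.inducts)
  case (red_c_rule \<Xi> b' p v b \<Theta> \<Gamma> s I)
  have "\<forall>(M, B)\<in>set \<Xi>. \<not> is_object B \<longrightarrow> sides_sound \<Theta> \<Gamma> I B" if "wfc \<Theta> \<Gamma>"
    using red_c_rule.IH that is_object_eq_hole by (fastforce simp: sides_sound_def act_bdry_sact)
  then show ?case
    using red_c_sound[OF _ \<open>is_object_thesis b'\<close> \<open>bthesis_cls b = bthesis_cls b'\<close>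
        \<open>matches Sg \<Xi> p \<Theta> \<Gamma> s I\<close>] C \<open>(\<Xi>, fill_eq_thesis b' p v) \<in> C\<close> by (auto simp: wfc_def)
next
  case (red_p_app \<Theta> h es b Bs es' \<Gamma>)
  have hb: "head_bdrys T \<Theta> h es (bthesis_cls b) Bs" and le: "length es' = length es"
    and np: "\<forall>i<length es. i \<notin> pr h \<longrightarrow> es' ! i = es ! i"
    using red_p_app by blast+
  note ob = head_bdrys_object[OF hb]
  show ?case
  proof (intro conjI impI ob)
    assume w: "wfc \<Theta> \<Gamma>" and d: "DT \<Theta> \<Gamma> (fill_thesis b (happ h es))"
    have w': "wf_mctx Sg T \<Theta>" "wf_vctx Sg T \<Theta> \<Gamma>" using w by (auto simp: wfc_def)
    note r = wfc_raw[OF w, THEN conjunct1] wfc_raw[OF w, THEN conjunct2]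
    note inv = head_inv[OF hb d r]
    \<comment> \<open>A principal argument is valid by the induction hypothesis; any other is
      unchanged and valid as an argument of the left-hand application.\<close>
    have wf: "wfe \<Theta> \<Gamma> (bdry_arity (Bs ! i)) (es' ! i)" if "i < length es" for i
      using red_p_app that inv w by (cases "i \<in> pr h") auto
    show "DT \<Theta> \<Gamma> (fill_eq_thesis b (happ h es) (happ h es'))"
    proof (rule head_congr[OF w' hb d le])
      show "DT \<Theta> \<Gamma> (fill_thesis b (happ h es')) \<or>
        (\<forall>i<length es. wfe \<Theta> \<Gamma> (bdry_arity (Bs ! i)) (es' ! i))"
        using wf by blast
    next
      fix i assume i: "i < length es" "is_object (Bs ! i)"
      show "D \<Theta> \<Gamma> (fill_eq (Bs ! i) (es ! i) (es' ! i))"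
      proof (cases "i \<in> pr h")
        case True
        then show ?thesis using red_p_app i inv w by auto
      next
        case False
        then show ?thesis
          using fill_eq_refl[OF _ r i(2), of "es ! i"] inv i np wf_arg_bdry_nabs by fastforce
      qed
    next
      fix i assume i: "i < length es" "\<not> is_object (Bs ! i)"
      \<comment> \<open>A principal argument may be equational and thus be reduced as well; validity
        forces it and its reduct to be the same abstraction of \<open>Star\<close>.\<close>
      have "e = (Abs ^^ depth (Bs ! i)) Star" if "wfe \<Theta> \<Gamma> (bdry_arity (Bs ! i)) e" for e
        using wf_arg_eq_Star[OF raw_sig] that i(2)
            by (auto simp: bdry_arity_def is_object_def is_object_thesis_def)
      then show "es' ! i = es ! i" using wf[OF i(1)] inv i(1) by metis
    qed
  qed
next
  case (red_step \<Theta> \<Gamma> b h es es' e'' e''')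
  show ?case
  proof (intro conjI impI)
    assume w: "wfc \<Theta> \<Gamma>" and d: "D \<Theta> \<Gamma> (fill (Thesis b) (happ h es))"
    then have w': "wf_mctx Sg T \<Theta>" "wf_vctx Sg T \<Theta> \<Gamma>" by (auto simp: wfc_def)
    have ob: "is_object_thesis b" and 1: "DT \<Theta> \<Gamma> (fill_eq_thesis b (happ h es) (happ h es'))"
      using red_step w d by auto
    \<comment> \<open>Each intermediate expression of the chain is derivable because the equation
      leading to it presupposes it.\<close>
    then have 2: "DT \<Theta> \<Gamma> (fill_eq_thesis b (happ h es') e'')"
      using red_step w presup_eq(2)[OF 1 w' ob] by auto
    then have 3: "DT \<Theta> \<Gamma> (fill_eq_thesis b e'' e''')"
      "wfe \<Theta> \<Gamma> (bdry_arity (Thesis b)) e'''"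
      using red_step w presup_eq(2)[OF 2 w' ob] by auto
    show "D \<Theta> \<Gamma> (fill_eq (Thesis b) (happ h es) e''')" using 1 2 3(1) by (auto intro: fill_eq_trans)
    show "wfe \<Theta> \<Gamma> (bdry_arity (Thesis b)) e'''" by (rule 3(2))
  qed auto
next
  case (red_stop \<Theta> \<Gamma> b h es es')
  show ?case
  proof (intro conjI impI)
    assume w: "wfc \<Theta> \<Gamma>" and d: "D \<Theta> \<Gamma> (fill (Thesis b) (happ h es))"
    then have w': "wf_mctx Sg T \<Theta>" "wf_vctx Sg T \<Theta> \<Gamma>" by (auto simp: wfc_def)
    have ob: "is_object_thesis b" and 1: "DT \<Theta> \<Gamma> (fill_eq_thesis b (happ h es) (happ h es'))"
      using red_stop w d by auto
    then show "D \<Theta> \<Gamma> (fill_eq (Thesis b) (happ h es) (happ h es'))" by simp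
    show "wfe \<Theta> \<Gamma> (bdry_arity (Thesis b)) (happ h es')"
      using deriv_wf[OF presup_eq(2)[OF 1 w' ob]] wfc_raw[OF w] ob
      by (auto simp: bdry_arity_def dest: wf_fill_thesis_D)
  qed auto
next
  case (red_abs a \<Gamma> A B e \<Theta> e')
  \<comment> \<open>Writing the reduct as the opening of its closed form, in which \<open>a\<close>
    does not occur, brings the equation into the shape that \<open>d_abstr\<close> asks for.\<close>
  define d where "d = close 0 a e'"
  have e': "e' = subst 0 (FVar a) d" by (simp add: d_def subst_close)
  have n: "nabs (depth B) e" "nabs (depth B) d"
    using red_abs.IH by (auto simp: d_def intro: nabs_subst_FVar_D nabs_close)
  have ad: "a \<notin> fv d" by (simp add: d_def fv_close)
  show ?case
  proof (intro conjI impI)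
    show "nabs (depth (Abstr A B)) (Abs e)" "nabs (depth (Abstr A B)) (Abs (close 0 a e'))"
      using n by (auto simp: nabs_Suc d_def)
    assume w: "wfc \<Theta> \<Gamma>" and dd: "D \<Theta> \<Gamma> (fill (Abstr A B) (Abs e))"
    then have "D \<Theta> \<Gamma> (Abstr A (fill B e))" by simp
    note o = wfc_open[OF w this red_abs.hyps(1)]
    have 1: "D \<Theta> (\<Gamma> @ [(a, A)]) (fill_eq (subst_bdry 0 (FVar a) B) (subst 0 (FVar a) e) e')"
      and wf: "wf_arg Sg (mv_arity \<Theta>) (insert a (names \<Gamma>)) 0 (bdry_arity B) e'"
      using red_abs.IH o n by (auto simp: subst_fill)
    have "a \<notin> fv A \<union> fv_jdg (fill_eq B e d)" using fv_fill_eq[OF n] red_abs.hyps(2) ad by auto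
    moreover have "D \<Theta> (\<Gamma> @ [(a, A)]) (subst_jdg 0 (FVar a) (fill_eq B e d))"
      using 1 n by (simp add: subst_fill_eq e')
    ultimately show "D \<Theta> \<Gamma> (fill_eq (Abstr A B) (Abs e) (Abs (close 0 a e')))"
      using o(3) red_abs.hyps(1) by (auto simp: d_def intro: d_abstr[of _ _ _ _ _ a])
    show "wfe \<Theta> \<Gamma> (bdry_arity (Abstr A B)) (Abs (close 0 a e'))"
      using wf_arg_subst_FVar_D[OF wf e' ad] by (auto simp: bdry_arity_def d_def intro: wf_Abs)
  qed
next
  case (red_var \<Theta> \<Gamma> A a)
  show ?case using deriv_wf wfc_raw by (fastforce simp: bdry_arity_def intro: d_tm_refl)
next
  case (red_star b \<Theta> \<Gamma>)
  then show ?case using fill_eq_nonobject[of "Thesis b" Star Star Star]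
    by (cases b) (auto simp: is_object_def is_object_thesis_def bdry_arity_def intro: wf_arg.intros)
next
  case (chk_tm \<Theta> \<Gamma> A A' u v)
  show ?case
  proof (intro conjI impI)
    assume w: "wfc \<Theta> \<Gamma>" and d: "D \<Theta> \<Gamma> (fill (Thesis (BTm A)) u)" "D \<Theta> \<Gamma> (fill (Thesis (BTm A)) v)"
    then have w': "wf_mctx Sg T \<Theta>" "wf_vctx Sg T \<Theta> \<Gamma>" by (auto simp: wfc_def)
    have "DT \<Theta> \<Gamma> (IsTy A)" using presup[OF d(1) w', of "HasTy u A"] by simp
    then have AA: "DT \<Theta> \<Gamma> (JEqTy A A')" using chk_tm.IH w by simp
    \<comment> \<open>The check takes place at the normalised type, so both terms are converted to
      it and the resulting equation is converted back.\<close>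
    then have "DT \<Theta> \<Gamma> (JEqTm u v A')"
      using chk_tm.IH w d d_conv_tm[OF _ AA] by simp
    then show "D \<Theta> \<Gamma> (fill_eq (Thesis (BTm A)) u v)" using AA by (auto intro: d_conv_eq d_ty_sym)
  qed auto
next
  case (chk_ty \<Theta> \<Gamma> A A' B B')
  show ?case
  proof (intro conjI impI)
    assume w: "wfc \<Theta> \<Gamma>" and d: "D \<Theta> \<Gamma> (fill (Thesis BTy) A)" "D \<Theta> \<Gamma> (fill (Thesis BTy) B)"
    then have w': "wf_mctx Sg T \<Theta>" "wf_vctx Sg T \<Theta> \<Gamma>" by (auto simp: wfc_def)
    have AA: "DT \<Theta> \<Gamma> (JEqTy A A')" "DT \<Theta> \<Gamma> (JEqTy B B')" using chk_ty.IH w d by auto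
    then have "DT \<Theta> \<Gamma> (IsTy A')" "DT \<Theta> \<Gamma> (IsTy B')"
      using presup[OF _ w'] by fastforce+
    then have "DT \<Theta> \<Gamma> (JEqTy A' B')"
      using chk_ty.IH w by (simp add: is_object_def is_object_thesis_def)
    then show "D \<Theta> \<Gamma> (fill_eq (Thesis BTy) A B)" using AA by (auto intro: d_ty_trans d_ty_sym)
  qed auto
next
  case (chk_abs a \<Gamma> A B e e' \<Theta>)
  have n: "nabs (depth B) e" "nabs (depth B) e'"
    using chk_abs.IH by (auto intro: nabs_subst_FVar_D)
  show ?case
  proof (intro conjI impI)
    show "nabs (depth (Abstr A B)) (Abs e)" "nabs (depth (Abstr A B)) (Abs e')"
      using n by (auto simp: nabs_Suc)
    assume w: "wfc \<Theta> \<Gamma>" and ob: "is_object (Abstr A B)"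
      and d: "D \<Theta> \<Gamma> (fill (Abstr A B) (Abs e))" "D \<Theta> \<Gamma> (fill (Abstr A B) (Abs e'))"
    then have d': "D \<Theta> \<Gamma> (Abstr A (fill B e))" "D \<Theta> \<Gamma> (Abstr A (fill B e'))" by simp_all
    note o = wfc_open[OF w d'(1) chk_abs.hyps(1)] and o' = wfc_open[OF w d'(2) chk_abs.hyps(1)]
    have "D \<Theta> (\<Gamma> @ [(a, A)])
        (fill_eq (subst_bdry 0 (FVar a) B) (subst 0 (FVar a) e) (subst 0 (FVar a) e'))"
      using chk_abs.IH o o' n ob by (simp add: subst_fill)
    then have "D \<Theta> (\<Gamma> @ [(a, A)]) (subst_jdg 0 (FVar a) (fill_eq B e e'))"
      using n by (simp add: subst_fill_eq)
    moreover have "a \<notin> fv A \<union> fv_jdg (fill_eq B e e')" using fv_fill_eq[OF n] chk_abs.hyps(2) by auto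
    ultimately show "D \<Theta> \<Gamma> (fill_eq (Abstr A B) (Abs e) (Abs e'))"
      using o(3) chk_abs.hyps(1) by (auto intro: d_abstr[of _ _ _ _ _ a])
  qed
next
  case (chk_e_ext \<Xi> P s t \<Phi> \<Theta> \<Gamma> A I I' u v)
  have R: "extensionality_rule Sg T (ext_rule \<Xi> P s t \<Phi>)" and m: "matches Sg \<Xi> P \<Theta> \<Gamma> A I"
    using E chk_e_ext by blast+
  have "\<forall>(M, B)\<in>set \<Xi>. \<not> is_object B \<longrightarrow> sides_sound \<Theta> \<Gamma> I B" if "wfc \<Theta> \<Gamma>"
    using chk_e_ext that is_object_eq_hole by (fastforce simp: sides_sound_def act_bdry_sact)
  moreover have "\<forall>(M, B)\<in>set \<Phi>. sides_sound \<Theta> \<Gamma> (I @ [(s, u), (t, v)]) B" if "wfc \<Theta> \<Gamma>"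
    using chk_e_ext that is_object_eq_hole by (fastforce simp: sides_sound_def act_bdry_sact)
  ultimately show ?case
    using chk_e_ext_sound[OF R m] by (auto simp: wfc_def)
next
  case (chk_e_norm \<Theta> \<Gamma> A u u' v v')
  show ?case
  proof (intro impI)
    assume w: "wfc \<Theta> \<Gamma>" and d: "DT \<Theta> \<Gamma> (HasTy u A)" "DT \<Theta> \<Gamma> (HasTy v A)"
    then have w': "wf_mctx Sg T \<Theta>" "wf_vctx Sg T \<Theta> \<Gamma>" by (auto simp: wfc_def)
    have uu: "DT \<Theta> \<Gamma> (JEqTm u u' A)" "DT \<Theta> \<Gamma> (JEqTm v v' A)" using chk_e_norm.IH w d by auto
    then have "DT \<Theta> \<Gamma> (HasTy u' A)" "DT \<Theta> \<Gamma> (HasTy v' A)"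
      using presup[OF _ w'] by fastforce+
    then have "DT \<Theta> \<Gamma> (JEqTm u' v' A)"
      using chk_e_norm.IH w by (simp add: is_object_def is_object_thesis_def)
    then show "DT \<Theta> \<Gamma> (JEqTm u v A)" using uu by (auto intro: d_tm_trans d_tm_sym)
  qed
next
  case (chk_n_var \<Theta> \<Gamma> A a)
  show ?case by (auto intro: d_tm_refl)
next
  case (chk_n_app \<Theta> h es b Bs es' \<Gamma>)
  have hb: "head_bdrys T \<Theta> h es (bthesis_cls b) Bs" and le: "length es' = length es"
    and ne: "\<forall>i<length es. \<not> is_object (Bs ! i) \<longrightarrow> es ! i = es' ! i"
    using chk_n_app by blast+
  show ?case
  proof (intro impI)
    assume w: "wfc \<Theta> \<Gamma>" and d: "D \<Theta> \<Gamma> (fill (Thesis b) (happ h es))"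
        "D \<Theta> \<Gamma> (fill (Thesis b) (happ h es'))"
    then have d': "DT \<Theta> \<Gamma> (fill_thesis b (happ h es))" "DT \<Theta> \<Gamma> (fill_thesis b (happ h es'))" by simp_all
    have w': "wf_mctx Sg T \<Theta>" "wf_vctx Sg T \<Theta> \<Gamma>" using w by (auto simp: wfc_def)
    note inv = head_inv[OF hb d'(1) wfc_raw[OF w, THEN conjunct1] wfc_raw[OF w, THEN conjunct2]]
    have "DT \<Theta> \<Gamma> (fill_eq_thesis b (happ h es) (happ h es'))"
    proof (rule head_congr[OF w' hb d'(1) le])
      \<comment> \<open>The right-hand application is derivable too, so the implication handed over
        by \<open>head_congr\<close> types its argument at the left-hand boundary, as the induction
        hypothesis requires.\<close>
      fix i assume "i < length es" "is_object (Bs ! i)"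
        "DT \<Theta> \<Gamma> (fill_thesis b (happ h es')) \<longrightarrow> D \<Theta> \<Gamma> (fill (Bs ! i) (es' ! i))"
      then show "D \<Theta> \<Gamma> (fill_eq (Bs ! i) (es ! i) (es' ! i))"
        using chk_n_app w inv d'(2) by (cases "i \<in> pr h") auto
    qed (use d' ne in auto)
    then show "D \<Theta> \<Gamma> (fill_eq (Thesis b) (happ h es) (happ h es'))" by simp
  qed
qed

end

theorem theorem3p27:
  fixes Sg :: "'s signature" and T C E :: "'s rul set" and pr :: "'s head \<Rightarrow> nat set"
  assumes "standard_theory Sg T"
    and "\<forall>R\<in>C. computation_rule Sg T R"
    and "\<forall>R\<in>E. extensionality_rule Sg T R"
    and "principal_spec Sg pr"
  shows "(\<forall>\<Theta> \<Gamma> BB e e'. is_object BB \<longrightarrow>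
            derivable Sg T \<Theta> \<Gamma> (fill BB e) \<longrightarrow> derivable Sg T \<Theta> \<Gamma> (fill BB e') \<longrightarrow>
            chk Sg T C E pr \<Theta> \<Gamma> BB e e' \<longrightarrow>
            derivable Sg T \<Theta> \<Gamma> (fill_eq BB e e')) \<and>
         (\<forall>\<Theta> \<Gamma> u v A.
            derivable Sg T \<Theta> \<Gamma> (Thesis (HasTy u A)) \<longrightarrow>
            derivable Sg T \<Theta> \<Gamma> (Thesis (HasTy v A)) \<longrightarrow>
            chk_e Sg T C E pr \<Theta> \<Gamma> A u v \<longrightarrow>
            derivable Sg T \<Theta> \<Gamma> (Thesis (JEqTm u v A))) \<and>
         (\<forall>\<Theta> \<Gamma> A B.
            derivable Sg T \<Theta> \<Gamma> (Thesis (IsTy A)) \<longrightarrow>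
            derivable Sg T \<Theta> \<Gamma> (Thesis (IsTy B)) \<longrightarrow>
            chk_n Sg T C E pr \<Theta> \<Gamma> (Thesis BTy) A B \<longrightarrow>
            derivable Sg T \<Theta> \<Gamma> (Thesis (JEqTy A B))) \<and>
         (\<forall>\<Theta> \<Gamma> u v A.
            derivable Sg T \<Theta> \<Gamma> (Thesis (HasTy u A)) \<longrightarrow>
            derivable Sg T \<Theta> \<Gamma> (Thesis (HasTy v A)) \<longrightarrow>
            chk_n Sg T C E pr \<Theta> \<Gamma> (Thesis (BTm A)) u v \<longrightarrow>
            derivable Sg T \<Theta> \<Gamma> (Thesis (JEqTm u v A)))"
proof -
  interpret std_tt Sg T
    by unfold_locales (use assms(1) in \<open>auto simp: standard_theory_def finitary_theory_def\<close>)
  note s = soundness[OF assms(2,3), of pr]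
  \<comment> \<open>The last two claims are both the \<open>chk_n\<close> clause, taken at the
    unabstracted object boundaries.\<close>
  have ob: "is_object (Thesis BTy :: 's bdry)" "is_object (Thesis (BTm A))" for A :: "'s expr"
    by (auto simp: is_object_def is_object_thesis_def)
  show ?thesis
    unfolding derivable_def
    using s(4) s(5) s(6)[of _ _ "Thesis BTy"] s(6)[of _ _ "Thesis (BTm _)"] ob by (simp add: wfc_def)
qed

end
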